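(* Let $X=\mathbb{R}^n\times D$, where $D$ is a countable discrete Abelian group. Let $\delta\in \mathrm{Aut}(X)$ be such that $\mathrm{Ker}(I+\delta)=\{0\}$. Let $\xi_1$ and $\xi_2$ be independent random variables with values in $X$ and distributions $\mu_1$ and $\mu_2$. If the conditional distribution of the linear statistic $L_2=\xi_1+\delta\xi_2$ given $L_1=\xi_1+\xi_2$ is symmetric, then there exist distributions $\gamma_j\in\Gamma(\mathbb{R}^n)$, probability distributions $\rho_j$ with $\sigma(\rho_j)\subset D_2$, elements $g_j\in D$ ($j=1,2$), and a finite subgroup $F$ of $D$ without elements of order $2$ (the same for $j=1$ and $j=2$), such that $$\mu_j=\gamma_j*\rho_j*m_F*E_{g_j},\qquad j=1,2.$$ Moreover, $\delta(F)=F$.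
   Context: $\mathrm{Aut}(X)$ is the group of topological automorphisms of the locally compact Abelian group $X$ (written additively), and $I$ is the identity automorphism. The groups $\mathbb{R}^n$ and $D$ are identified with the subgroups $\mathbb{R}^n\times\{0\}$ and $\{0\}\times D$ of $X$, and distributions on these subgroups are regarded as distributions on $X$. $D_2$ is the $2$-component of $D$, i.e. the subgroup of all elements of $D$ whose order is a power of $2$. "Distribution" means Borel probability measure; $\sigma(\mu)$ is the support of $\mu$; $*$ is convolution; $E_x$ is the degenerate distribution concentrated at $x$; $m_F$ is the Haar distribution (normalized Haar measure) of the compact subgroup $F$. $\Gamma(\mathbb{R}^n)$ is the set of Gaussian distributions on $\mathbb{R}^n$, possibly degenerate, i.e. those with characteristic function $\exp\{-\langle As,s\rangle+i\langle t,s\rangle\}$, $s\in\mathbb{R}^n$, where $A$ is a positive semidefinite symmetric matrix and $t\in\mathbb{R}^n$. The conditional distribution of $L_2$ given $L_1$ being symmetric means that the conditional distributions of $L_2$ and $-L_2$ given $L_1$ coincide, equivalently that $(L_1,L_2)$ and $(L_1,-L_2)$ are identically distributed. *)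

theory Defs
  imports "HOL-Probability.Probability"
begin

text \<open>Distributions are probability measures on the Borel sets.\<close>

definition distribution :: "'a::topological_space measure \<Rightarrow> bool" where
  "distribution \<mu> \<longleftrightarrow> prob_space \<mu> \<and> sets \<mu> = sets borel"

text \<open>The convolution of the library is restricted to ordered Euclidean spaces.\<close>

definition convol :: "'a::{topological_space, ab_group_add} measure \<Rightarrow> 'a measure \<Rightarrow> 'a measure"
    (infixl \<open>\<circledast>\<close> 65) where
  "\<mu> \<circledast> \<nu> = distr (\<mu> \<Otimes>\<^sub>M \<nu>) borel (\<lambda>(x, y). x + y)"

definition msupport :: "'a::topological_space measure \<Rightarrow> 'a set" where
  "msupport \<mu> = {x. \<forall>U. open U \<and> x \<in> U \<longrightarrow> emeasure \<mu> U > 0}"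

definition add_subgroup :: "'a::ab_group_add set \<Rightarrow> bool" where
  "add_subgroup F \<longleftrightarrow> 0 \<in> F \<and> (\<forall>x\<in>F. \<forall>y\<in>F. x + y \<in> F) \<and> (\<forall>x\<in>F. - x \<in> F)"

text \<open>The description is unique when \<^term>\<open>F\<close> is a compact (in particular, a finite) subgroup
  of a second countable Hausdorff group.\<close>

definition haar_distr :: "'a::{topological_space, ab_group_add} set \<Rightarrow> 'a measure" where
  "haar_distr F = (THE m. distribution m \<and> emeasure m F = 1 \<and>
     (\<forall>x\<in>F. distr m borel (\<lambda>y. x + y) = m))"

definition has_order :: "'a::ab_group_add \<Rightarrow> nat \<Rightarrow> bool" where
  "has_order d m \<longleftrightarrow>
     0 < m \<and> (\<Sum>i<m. d) = 0 \<and> (\<forall>k. 0 < k \<and> k < m \<longrightarrow> (\<Sum>i<k. d) \<noteq> 0)"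

definition two_component :: "'a::ab_group_add set" where
  "two_component = {d. \<exists>k. has_order d (2 ^ k)}"

definition top_automorphism :: "('a::{topological_space, ab_group_add} \<Rightarrow> 'a) \<Rightarrow> bool" where
  "top_automorphism \<delta> \<longleftrightarrow> Modules.additive \<delta> \<and> (\<exists>\<delta>'. homeomorphism UNIV UNIV \<delta> \<delta>')"

text \<open>Gaussian distributions on \<open>\<real>\<^sup>n\<close>, degenerate ones included; there is no factor \<open>1/2\<close> in the
  exponent, so the covariance matrix is \<^term>\<open>2 *\<^sub>R A\<close>.\<close>

definition gaussian :: "(real^'n) measure \<Rightarrow> bool" where
  "gaussian \<gamma> \<longleftrightarrow> distribution \<gamma> \<and>
     (\<exists>(A :: real^'n^'n) (t :: real^'n). transpose A = A \<and> (\<forall>s. (A *v s) \<bullet> s \<ge> 0) \<and>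
       (\<forall>s. (\<integral>x. cis (s \<bullet> x) \<partial>\<gamma>) =
            exp (- complex_of_real ((A *v s) \<bullet> s) + \<i> * complex_of_real (t \<bullet> s))))"

text \<open>The conditional distributions of \<^term>\<open>L\<^sub>2\<close> and \<^term>\<open>\<lambda>\<omega>. - L\<^sub>2 \<omega>\<close> given the
  \<open>\<sigma>\<close>-algebra generated by \<^term>\<open>L\<^sub>1\<close> coincide.\<close>

definition cond_symmetric ::
    "'w measure \<Rightarrow> ('w \<Rightarrow> 'a::{topological_space, ab_group_add}) \<Rightarrow> ('w \<Rightarrow> 'a) \<Rightarrow> bool" where
  "cond_symmetric M L\<^sub>1 L\<^sub>2 \<longleftrightarrow>
     (\<forall>B\<in>sets borel. AE \<omega> in M.
        real_cond_exp M (vimage_algebra (space M) L\<^sub>1 borel) (\<lambda>\<omega>. indicator B (L\<^sub>2 \<omega>)) \<omega> =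
        real_cond_exp M (vimage_algebra (space M) L\<^sub>1 borel) (\<lambda>\<omega>. indicator B (- L\<^sub>2 \<omega>)) \<omega>)"

text \<open>Distributions on the factors, regarded as distributions on the product.\<close>

definition on_fst ::
    "'a::topological_space measure \<Rightarrow> ('a \<times> 'b::{topological_space, zero}) measure" where
  "on_fst \<mu> = distr \<mu> borel (\<lambda>x. (x, 0))"

definition on_snd ::
    "'b::topological_space measure \<Rightarrow> ('a::{topological_space, zero} \<times> 'b) measure" where
  "on_snd \<mu> = distr \<mu> borel (\<lambda>y. (0, y))"

end

theory Submission
  imports Defs
begin

text \<open>
  Write \<open>\<delta> (t, d) = (\<alpha> t + h d, \<beta> d)\<close>. On the discrete component, symmetry makes
  \<open>(I + \<beta>) \<xi>\<^sub>1 + 2 \<beta> \<xi>\<^sub>2\<close> distributed like \<open>(\<beta> - I) \<xi>\<^sub>1\<close>, and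
  \<open>(I + \<beta>) \<xi>\<^sub>2 + 2 \<xi>\<^sub>1\<close> like \<open>(I - \<beta>) \<xi>\<^sub>2\<close>. As \<open>I + \<beta>\<close> is injective, comparing
  the largest atoms shows that the doubled supports are finite. After enough doublings to remove the
  2-torsion between support points, counting forces both laws to be uniform on cosets of one finite
  subgroup \<open>F\<close> of odd order; invariance under \<open>F\<close> is then carried back through the
  doublings.

  On the real component, the conditional characteristic functions given the discrete parts satisfy a
  functional equation without a nonvanishing hypothesis. Near \<open>0\<close> logarithms exist, and a third
  difference of the equation makes them quadratic polynomials on every line. A distribution that is
  locally Gaussian in this sense is globally Gaussian: its moments are finite by Fatou's lemma and
  determine it. Finally the equation relates conditional laws whose discrete parts differ by elements
  of decreasing 2-power order modulo \<open>F\<close>, so that all conditional laws coincide; hence the real and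
  discrete parts are independent.
\<close>

section \<open>Laws on a discrete group\<close>

text \<open>The kernel hypothesis has a second use. If \<open>\<beta> z = z\<close> and
  \<open>z + z = 0\<close>, then \<open>z + \<beta> z = 0\<close>, so \<open>z = 0\<close>. Hence I
  - \<beta>, about whose kernel nothing is assumed, is injective on 2-power torsion and, once
  \<beta> is known to have no nonzero fixed point in \<open>F\<close>, on differences of support
  points. This injectivity lets invariance return through the doublings, and it makes the discrete
  part of the pair of statistics determine the discrete parts of both variables. Changing the sign
  of the second statistic therefore sends each support pair (x, y) to exactly one support pair (x',
  y') with x' + y' = x + y and x' + \<beta> y' = - (x + \<beta> y). The functional equation links
  the conditional laws at these two pairs, so four a priori different laws occur in it; they have to
  be recognised as Gaussian before any independence is available. The off-diagonal part
  \<open>h\<close> of \<delta> vanishes on the finite group \<open>F\<close>, hence is constant on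
  the relevant support and contributes only a phase.\<close>

lemma add_subgroup_diff: "add_subgroup F \<Longrightarrow> x \<in> F \<Longrightarrow> y \<in> F \<Longrightarrow> x - y \<in> F"
proof -
  assume "add_subgroup F" "x \<in> F" "y \<in> F"
  then have "x + - y \<in> F" unfolding add_subgroup_def by blast
  then show "x - y \<in> F" by simp
qed

lemma finite_large_atoms:
  fixes p :: "'a pmf"
  assumes "0 < c"
  shows "finite {x. c \<le> pmf p x}"
proof (rule ccontr)
  assume inf: "infinite {x. c \<le> pmf p x}"
  obtain n where n: "1 / c < real n" using reals_Archimedean2 by blast
  obtain T where T: "T \<subseteq> {x. c \<le> pmf p x}" "finite T" "card T = n"
    using infinite_arbitrarily_large[OF inf] by blast
  have "real n * c = (\<Sum>x\<in>T. c)" using T by simp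
  also have "\<dots> \<le> (\<Sum>x\<in>T. pmf p x)" using T by (intro sum_mono) auto
  also have "\<dots> = measure p T" using T by (simp add: measure_measure_pmf_finite)
  also have "\<dots> \<le> 1" by simp
  finally show False using n assms by (simp add: field_simps)
qed

text \<open>Atoms at least as heavy as a given one are finitely many, so the supremum is attained
  even on an infinite support.\<close>

lemma pmf_has_max:
  fixes p :: "'a pmf"
  obtains x where "x \<in> set_pmf p" "\<And>y. pmf p y \<le> pmf p x"
proof -
  obtain z where z: "z \<in> set_pmf p" using set_pmf_not_empty[of p] by blast
  define S where "S = {x. pmf p z \<le> pmf p x}"
  have zpos: "0 < pmf p z" using z by (simp add: pmf_positive)
  have fin: "finite S" unfolding S_def by (rule finite_large_atoms[OF zpos])
  have ne: "S \<noteq> {}" by (auto simp: S_def)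
  have "Max (pmf p ` S) \<in> pmf p ` S" using fin ne by (intro Max_in) auto
  then obtain x where x: "x \<in> S" "pmf p x = Max (pmf p ` S)" by auto
  have x': "pmf p y \<le> pmf p x" if "y \<in> S" for y
    unfolding x(2) using fin that by (intro Max_ge) auto
  have "pmf p y \<le> pmf p x" for y
  proof (cases "y \<in> S")
    case False
    then have "pmf p y < pmf p z" by (simp add: S_def)
    also have "\<dots> \<le> pmf p x" using x(1) by (simp add: S_def)
    finally show ?thesis by simp
  qed (rule x')
  moreover have "x \<in> set_pmf p" using x(1) zpos by (auto simp: S_def set_pmf_iff)
  ultimately show ?thesis using that by blast
qed

lemma pmf_map_sum_pair:
  fixes p q :: "'a::ab_group_add pmf" and f g :: "'a \<Rightarrow> 'a"
  shows "pmf (map_pmf (\<lambda>(x, y). f x + g y) (pair_pmf p q)) a =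
    (\<integral>y. measure p {x. f x + g y = a} \<partial>q)"
proof -
  have "map_pmf (\<lambda>(x, y). f x + g y) (pair_pmf p q) =
      bind_pmf q (\<lambda>y. map_pmf (\<lambda>x. f x + g y) p)"
    by (subst pair_commute_pmf)
      (simp add: pair_pmf_def map_pmf_def bind_assoc_pmf bind_return_pmf)
  then show ?thesis by (simp add: pmf_bind pmf_map vimage_def)
qed

text \<open>An atom of \<^term>\<open>f x + g y\<close> is an average over \<open>y\<close> of atoms of \<open>p\<close>, so it attains the
  maximal atom of \<open>p\<close> only if every \<open>y\<close> contributes a maximal atom.\<close>

lemma max_atom_spread:
  fixes p q :: "'a::ab_group_add pmf" and f g h :: "'a \<Rightarrow> 'a"
  assumes law: "map_pmf (\<lambda>(x, y). f x + g y) (pair_pmf p q) = map_pmf h p"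
    and inj: "inj f" and mx: "\<And>x. pmf p x \<le> pmf p x\<^sub>0"
  shows "y \<in> set_pmf q \<Longrightarrow> \<exists>x. f x + g y = h x\<^sub>0 \<and> pmf p x = pmf p x\<^sub>0"
    and "x \<in> set_pmf p \<Longrightarrow> h x = h x\<^sub>0 \<Longrightarrow> x\<^sub>0 \<in> set_pmf p \<Longrightarrow> x = x\<^sub>0"
proof -
  define w where "w y = measure p {x. f x + g y = h x\<^sub>0}" for y
  have w: "w y \<le> pmf p x\<^sub>0 \<and> (w y = pmf p x\<^sub>0 \<longrightarrow> pmf p x\<^sub>0 = 0 \<or> (\<exists>x. f x + g y = h x\<^sub>0 \<and> pmf p x = pmf p x\<^sub>0))" for y
  proof (cases "\<exists>x. f x + g y = h x\<^sub>0")
    case True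
    then obtain x where x: "f x + g y = h x\<^sub>0" by blast
    have "x' = x" if "f x' + g y = h x\<^sub>0" for x'
    proof -
      have "f x' + g y = f x + g y" using that x by simp
      then show ?thesis using injD[OF inj] by simp
    qed
    then have "{x. f x + g y = h x\<^sub>0} = {x}" using x by blast
    then have "w y = pmf p x" by (simp add: w_def measure_pmf_single)
    then show ?thesis using x mx by metis
  next
    case False
    then have "w y = 0" by (simp add: w_def)
    then show ?thesis by simp
  qed
  have int: "integrable q w"
    by (rule measure_pmf.integrable_const_bound[where B = 1]) (auto simp: w_def)
  have E: "(\<integral>y. w y \<partial>q) = measure p {x. h x = h x\<^sub>0}"
    unfolding w_def pmf_map_sum_pair[symmetric] law by (simp add: pmf_map vimage_def)
  have le: "(\<integral>y. w y \<partial>q) \<le> pmf p x\<^sub>0"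
    using integral_mono[OF int, of "\<lambda>_. pmf p x\<^sub>0"] w by simp
  have ge: "pmf p x\<^sub>0 \<le> measure p {x. h x = h x\<^sub>0}"
    unfolding measure_pmf_single[symmetric] by (intro measure_pmf.finite_measure_mono) auto
  have eq: "(\<integral>y. pmf p x\<^sub>0 - w y \<partial>q) = 0"
    using le ge E int by simp
  have "AE y in q. pmf p x\<^sub>0 - w y = 0"
    using integral_nonneg_eq_0_iff_AE[of q "\<lambda>y. pmf p x\<^sub>0 - w y"] eq int w by simp
  then have *: "y \<in> set_pmf q \<Longrightarrow> w y = pmf p x\<^sub>0" for y
    by (simp add: AE_measure_pmf_iff)
  have pos: "pmf p x\<^sub>0 > 0"
    using mx set_pmf_not_empty[of p] by (metis ex_in_conv pmf_positive order_less_le_trans)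
  show "y \<in> set_pmf q \<Longrightarrow> \<exists>x. f x + g y = h x\<^sub>0 \<and> pmf p x = pmf p x\<^sub>0"
    using * w pos by (metis less_irrefl)
  \<comment> \<open>Two support points in one fibre of \<open>h\<close> would give the law on the
    right an atom heavier than \<open>pmf p x\<^sub>0\<close>, while the left side bounds this atom
    by \<open>pmf p x\<^sub>0\<close>.\<close>
  assume x: "x \<in> set_pmf p" "h x = h x\<^sub>0"
  show "x = x\<^sub>0"
  proof (rule ccontr)
    assume ne: "x \<noteq> x\<^sub>0"
    have "pmf p x + pmf p x\<^sub>0 = measure p {x, x\<^sub>0}"
      using ne by (simp add: measure_measure_pmf_finite)
    also have "\<dots> \<le> measure p {x. h x = h x\<^sub>0}"
      using x by (intro measure_pmf.finite_measure_mono) auto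
    finally show False using E le pmf_positive[OF x(1)] by simp
  qed
qed

text \<open>A set \<open>U\<close> at least as large as \<open>S\<close> that translates
  \<open>S\<close> into itself must fill \<open>S\<close> from any base point, by counting. Closure
  under addition is then read off from \<open>S\<close>, and inverses exist because a translation is
  injective on the finite set \<open>U\<close>.\<close>

lemma finite_subgroup_translate:
  fixes S :: "'a::ab_group_add set"
  assumes fin: "finite S" and s: "s\<^sub>0 \<in> S" and U: "0 \<in> U" "card S \<le> card U"
    and st: "\<And>u s. u \<in> U \<Longrightarrow> s \<in> S \<Longrightarrow> u + s \<in> S"
  shows "add_subgroup U" and "S = (\<lambda>u. s\<^sub>0 + u) ` U" and "finite U"
proof -
  have sub: "(\<lambda>u. s\<^sub>0 + u) ` U \<subseteq> S" using st s by (auto simp: add.commute)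
  have cU: "card ((\<lambda>u. s\<^sub>0 + u) ` U) = card U" by (intro card_image) (auto simp: inj_on_def)
  then show S: "S = (\<lambda>u. s\<^sub>0 + u) ` U"
    using card_seteq[OF fin sub] U(2) by simp
  show finU: "finite U"
    using fin unfolding S by (rule finite_imageD) (auto simp: inj_on_def)
  have add: "u + v \<in> U" if "u \<in> U" "v \<in> U" for u v
  proof -
    have "u + (s\<^sub>0 + v) \<in> S" using that st S by blast
    then show ?thesis unfolding S by (auto simp: algebra_simps)
  qed
  have "- u \<in> U" if u: "u \<in> U" for u
  proof -
    have "(\<lambda>v. u + v) ` U = U"
      using add u by (intro card_seteq[OF finU]) (auto simp: card_image inj_on_def)
    then obtain v where "v \<in> U" "u + v = 0" using U(1) by (metis imageE)
    then show ?thesis by (metis minus_unique)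
  qed
  then show "add_subgroup U" using U(1) add by (auto simp: add_subgroup_def)
qed

text \<open>Spreading one maximal atom \<open>m\<close> over the support of \<open>q\<close> yields
  a maximal atom of \<open>p\<close> for each \<open>y\<close>, and injectivity of \<open>g\<close>
  keeps these distinct. Since only maximal atoms are counted, supports of equal size will force
  \<open>p\<close> to be uniform.\<close>

lemma card_support_le:
  fixes p q :: "'a::ab_group_add pmf" and f g h :: "'a \<Rightarrow> 'a"
  assumes law: "map_pmf (\<lambda>(x, y). f x + g y) (pair_pmf p q) = map_pmf h p"
    and inj: "inj f" and ginj: "inj_on g (set_pmf q)" and m: "\<And>x. pmf p x \<le> pmf p m"
  shows "card (set_pmf q) \<le> card {x \<in> set_pmf p. pmf p x = pmf p m}"
proof -
  let ?Am = "{x \<in> set_pmf p. pmf p x = pmf p m}"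
  have mpos: "pmf p m > 0"
    using m set_pmf_not_empty[of p] by (metis ex_in_conv pmf_positive order_less_le_trans)
  have Am: "(\<lambda>y. h m - g y) ` set_pmf q \<subseteq> f ` ?Am"
  proof
    fix z assume "z \<in> (\<lambda>y. h m - g y) ` set_pmf q"
    then obtain y where y: "y \<in> set_pmf q" "z = h m - g y" by blast
    from max_atom_spread(1)[OF law inj m y(1)]
    obtain x where x: "f x + g y = h m" "pmf p x = pmf p m" by blast
    have "f x = z" using x(1) y(2) by (metis add_diff_cancel_right')
    moreover have "x \<in> ?Am" using x(2) mpos by (simp add: set_pmf_iff)
    ultimately show "z \<in> f ` ?Am" by blast
  qed
  have fin: "finite ?Am"
    by (rule finite_subset[OF _ finite_large_atoms[OF mpos, of p]]) auto
  have "card (set_pmf q) = card ((\<lambda>y. h m - g y) ` set_pmf q)"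
    using ginj by (intro card_image[symmetric]) (auto simp: inj_on_def)
  also have "\<dots> \<le> card (f ` ?Am)" using Am fin by (intro card_mono) auto
  also have "\<dots> = card ?Am" using inj by (intro card_image) (auto simp: inj_def inj_on_def)
  finally show ?thesis .
qed

text \<open>The set \<open>g ` B\<close> is stable under the differences of \<open>h ` A\<close>, and counting shows that these
  differences form its whole stabiliser.\<close>

lemma equal_supports_structure:
  fixes p q :: "'a::ab_group_add pmf" and f g h :: "'a \<Rightarrow> 'a"
  assumes law: "map_pmf (\<lambda>(x, y). f x + g y) (pair_pmf p q) = map_pmf h p"
    and inj: "inj f" and ginj: "inj_on g (set_pmf q)"
    and fin: "finite (set_pmf p)" "finite (set_pmf q)"
    and card: "card (set_pmf p) \<le> card (set_pmf q)"
    and x: "x\<^sub>0 \<in> set_pmf p" and y: "y\<^sub>0 \<in> set_pmf q"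
  defines "U \<equiv> (\<lambda>x. h x - h x\<^sub>0) ` set_pmf p"
  shows "add_subgroup U" "finite U" "card U = card (set_pmf p)"
    "g ` set_pmf q = (\<lambda>u. g y\<^sub>0 + u) ` U" "f ` set_pmf p = (\<lambda>u. f x\<^sub>0 + u) ` U"
    "\<And>x x'. x \<in> set_pmf p \<Longrightarrow> x' \<in> set_pmf p \<Longrightarrow> pmf p x = pmf p x'"
proof -
  let ?A = "set_pmf p" and ?B = "set_pmf q"
  obtain m where m: "m \<in> ?A" "\<And>x. pmf p x \<le> pmf p m" using pmf_has_max by blast
  define Am where "Am = {x \<in> ?A. pmf p x = pmf p m}"
  have le: "card ?B \<le> card Am"
    unfolding Am_def using law inj ginj m(2) by (rule card_support_le)
  have "card ?A \<le> card Am" using card le by simp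
  then have AmA: "Am = ?A" using fin by (intro card_seteq) (auto simp: Am_def)
  then have const: "x \<in> ?A \<Longrightarrow> pmf p x = pmf p m" for x by (auto simp: Am_def)
  then show "\<And>x x'. x \<in> ?A \<Longrightarrow> x' \<in> ?A \<Longrightarrow> pmf p x = pmf p x'" by simp
  have mx: "pmf p x' \<le> pmf p x" if "x \<in> ?A" for x x' using m(2) const[OF that] by simp
  have hinj: "inj_on h ?A"
    by (rule inj_onI) (use max_atom_spread(2)[OF law inj mx] in blast)
  show cU: "card U = card ?A" unfolding U_def
    using hinj by (intro card_image) (auto simp: inj_on_def)
  have cB: "card ?B \<le> card ?A"
    using le AmA by simp
  \<comment> \<open>Every \<open>x\<close> in \<open>?A\<close> is now a maximal atom, so reflecting
    the image of \<open>?B\<close> under \<open>g\<close> in the point \<open>h x\<close> gives the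
    same set for each such \<open>x\<close>. Comparing two choices of \<open>x\<close> produces the
    invariance \<open>st\<close>.\<close>
  have fA: "f ` ?A = (\<lambda>y. h x - g y) ` ?B" if x: "x \<in> ?A" for x
  proof -
    have "(\<lambda>y. h x - g y) ` ?B \<subseteq> f ` ?A"
    proof
      fix z assume "z \<in> (\<lambda>y. h x - g y) ` ?B"
      then obtain y where y: "y \<in> ?B" "z = h x - g y" by blast
      from max_atom_spread(1)[OF law inj mx[OF x] y(1)] obtain x' where x': "f x' + g y = h x" "pmf p x' = pmf p x" by blast
      have "f x' = z" using x'(1) y(2) by (metis add_diff_cancel_right')
      moreover have "x' \<in> ?A" using x x'(2) by (simp add: set_pmf_iff)
      ultimately show "z \<in> f ` ?A" by blast
    qed
    moreover have "card ((\<lambda>y. h x - g y) ` ?B) = card ?B"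
      using ginj by (intro card_image) (auto simp: inj_on_def)
    moreover have "card (f ` ?A) \<le> card ?A" using fin by (simp add: card_image_le)
    ultimately show ?thesis using card fin by (intro card_seteq[symmetric]) auto
  qed
  have st: "u + s \<in> g ` ?B" if "u \<in> U" "s \<in> g ` ?B" for u s
  proof -
    obtain x where x': "x \<in> ?A" "u = h x - h x\<^sub>0" using \<open>u \<in> U\<close> by (auto simp: U_def)
    have "h x\<^sub>0 - s \<in> f ` ?A" using fA[OF x] that by auto
    then obtain y where "y \<in> ?B" "h x\<^sub>0 - s = h x - g y" using fA[OF x'(1)] by auto
    moreover have "u + s = h x - (h x\<^sub>0 - s)" unfolding x'(2) by simp
    ultimately have "u + s = g y" by simp
    then show ?thesis using \<open>y \<in> ?B\<close> by blast
  qed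
  have U0: "0 \<in> U" using x by (auto simp: U_def)
  have cgB: "card (g ` ?B) \<le> card U" using cB cU card_image[OF ginj] by simp
  have fgB: "finite (g ` ?B)" using fin by simp
  note fst = finite_subgroup_translate[OF fgB imageI[OF y] U0 cgB st]
  show sg: "add_subgroup U" and "finite U" and gB: "g ` ?B = (\<lambda>u. g y\<^sub>0 + u) ` U"
    using fst by blast+
  have "f ` ?A = (\<lambda>u. h x\<^sub>0 - g y\<^sub>0 - u) ` U"
    unfolding fA[OF x] using gB by (simp add: image_image[symmetric, of "\<lambda>z. h x\<^sub>0 - z" g] image_image algebra_simps)
  moreover have "f x\<^sub>0 \<in> f ` ?A" using x by simp
  ultimately obtain u\<^sub>0 where u0: "u\<^sub>0 \<in> U" "f x\<^sub>0 = h x\<^sub>0 - g y\<^sub>0 - u\<^sub>0" and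
    fA': "f ` ?A = (\<lambda>u. h x\<^sub>0 - g y\<^sub>0 - u) ` U" by auto
  show "f ` ?A = (\<lambda>u. f x\<^sub>0 + u) ` U" unfolding fA' u0(2)
  proof (intro equalityI subsetI)
    fix z assume "z \<in> (\<lambda>u. h x\<^sub>0 - g y\<^sub>0 - u) ` U"
    then obtain u where "u \<in> U" "z = h x\<^sub>0 - g y\<^sub>0 - u" by blast
    then show "z \<in> (\<lambda>u. h x\<^sub>0 - g y\<^sub>0 - u\<^sub>0 + u) ` U" using u0(1) sg
      by (intro image_eqI[of _ _ "u\<^sub>0 - u"]) (auto intro: add_subgroup_diff)
  next
    fix z assume "z \<in> (\<lambda>u. h x\<^sub>0 - g y\<^sub>0 - u\<^sub>0 + u) ` U"
    then obtain u where "u \<in> U" "z = h x\<^sub>0 - g y\<^sub>0 - u\<^sub>0 + u" by blast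
    then show "z \<in> (\<lambda>u. h x\<^sub>0 - g y\<^sub>0 - u) ` U" using u0(1) sg
      by (intro image_eqI[of _ _ "u\<^sub>0 - u"]) (auto intro: add_subgroup_diff)
  qed
qed

section \<open>Multiplication by powers of two\<close>

definition dbl :: "nat \<Rightarrow> 'a::ab_group_add \<Rightarrow> 'a" where
  "dbl k x = ((\<lambda>x. x + x) ^^ k) x"

lemma dbl_0 [simp]: "dbl 0 x = x" and dbl_Suc: "dbl (Suc k) x = dbl k x + dbl k x"
  by (simp_all add: dbl_def)

lemma dbl_add: "dbl k (x + y) = dbl k x + dbl k y"
  by (induction k) (simp_all add: dbl_Suc algebra_simps)

lemma dbl_zero [simp]: "dbl k 0 = 0"
  by (induction k) (simp_all add: dbl_Suc)

lemma dbl_minus: "dbl k (- x) = - dbl k x"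
  by (rule minus_unique[symmetric]) (simp add: dbl_add[symmetric])

lemma dbl_diff: "dbl k (x - y) = dbl k x - dbl k y"
  using dbl_add[of k x "- y"] by (simp add: dbl_minus)

lemma dbl_dbl: "dbl j (dbl k x) = dbl (j + k) x"
  by (simp add: dbl_def funpow_add)

lemma dbl_additive: "Modules.additive f \<Longrightarrow> f (dbl k x) = dbl k (f x)"
  by (induction k) (simp_all add: dbl_Suc additive.add)

lemma dbl_subgroup: "add_subgroup F \<Longrightarrow> x \<in> F \<Longrightarrow> dbl k x \<in> F"
  by (induction k) (auto simp: dbl_Suc add_subgroup_def)

lemma dbl_eq_0_mono: "dbl j x = 0 \<Longrightarrow> j \<le> k \<Longrightarrow> dbl k x = 0"
  using dbl_dbl[of "k - j" j x] by simp

lemma finite_dbl_exponent: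
  assumes "finite S"
  obtains k where "\<And>z j. z \<in> S \<Longrightarrow> dbl j z = 0 \<Longrightarrow> dbl k z = 0"
proof -
  \<comment> \<open>For a \<open>z\<close> without 2-power torsion the choice is arbitrary, which
    can only enlarge the maximum.\<close>
  define e where "e z = (SOME j. dbl j z = 0)" for z :: 'a
  have "dbl (Max (insert 0 (e ` S))) z = 0" if "z \<in> S" "dbl j z = 0" for z j
  proof (rule dbl_eq_0_mono)
    show "dbl (e z) z = 0" unfolding e_def using that(2) by (rule someI)
    show "e z \<le> Max (insert 0 (e ` S))" using that assms by simp
  qed
  then show ?thesis using that by blast
qed

section \<open>Laws invariant under a subgroup\<close>

definition shift_inv :: "'a::ab_group_add set \<Rightarrow> 'a pmf \<Rightarrow> bool" where
  "shift_inv F p \<longleftrightarrow> (\<forall>\<phi>\<in>F. \<forall>x. pmf p (x + \<phi>) = pmf p x)"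

text \<open>An atom of the sum is an average of translated atoms of the law of \<open>g y\<close>,
  so the invariance of one independent summand passes to the sum whatever the other summand
  is.\<close>

lemma shift_inv_sum:
  fixes f g :: "'a::ab_group_add \<Rightarrow> 'a"
  assumes "shift_inv F (map_pmf g q)"
  shows "shift_inv F (map_pmf (\<lambda>(x, y). f x + g y) (pair_pmf p q))"
proof -
  have *: "pmf (map_pmf (\<lambda>(x, y). f x + g y) (pair_pmf p q)) a = (\<integral>x. pmf (map_pmf g q) (a - f x) \<partial>p)" for a
  proof -
    have "map_pmf (\<lambda>(x, y). f x + g y) (pair_pmf p q) = map_pmf (\<lambda>(y, x). g y + f x) (pair_pmf q p)"
      by (subst pair_commute_pmf) (simp add: pmf.map_comp o_def split_def add.commute)
    then have "pmf (map_pmf (\<lambda>(x, y). f x + g y) (pair_pmf p q)) a = (\<integral>x. measure q {y. g y + f x = a} \<partial>p)"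
      by (simp only: pmf_map_sum_pair)
    moreover have "measure q {y. g y + f x = a} = pmf (map_pmf g q) (a - f x)" for x
      by (simp add: pmf_map vimage_def eq_diff_eq)
    ultimately show ?thesis by simp
  qed
  have "pmf (map_pmf g q) (a + \<phi> - f x) = pmf (map_pmf g q) (a - f x)" if "\<phi> \<in> F" for a \<phi> x
  proof -
    have "a + \<phi> - f x = (a - f x) + \<phi>" by simp
    then show ?thesis using assms that unfolding shift_inv_def by presburger
  qed
  then show ?thesis unfolding shift_inv_def * by simp
qed

text \<open>The maps used here, such as \<open>b - I\<close>, may have a kernel, so injectivity is
  asked only on a set \<open>C\<close> carrying \<open>p\<close>, where atoms of \<open>p\<close>
  are atoms of its image. As \<open>C\<close> is a union of cosets of \<open>F\<close>, a point
  outside \<open>C\<close> and its translates all have mass 0.\<close>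

lemma shift_inv_of_map:
  assumes inv: "shift_inv F (map_pmf h p)" and h: "Modules.additive h"
    and hF: "h ` F \<subseteq> F" and sub: "set_pmf p \<subseteq> C" and inj: "inj_on h C"
    and CF: "\<And>x \<phi>. \<phi> \<in> F \<Longrightarrow> x + \<phi> \<in> C \<longleftrightarrow> x \<in> C"
  shows "shift_inv F p"
  unfolding shift_inv_def
proof (intro ballI allI)
  fix \<phi> x assume \<phi>: "\<phi> \<in> F"
  have *: "pmf (map_pmf h p) (h x) = pmf p x" if "x \<in> C" for x
  proof -
    have "pmf (map_pmf h p) (h x) = measure p {x'. h x' = h x}" by (simp add: pmf_map vimage_def)
    also have "\<dots> = measure p {x}"
      using sub inj that by (intro measure_pmf.finite_measure_eq_AE) (auto simp: AE_measure_pmf_iff inj_on_def)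
    finally show ?thesis by (simp add: measure_pmf_single)
  qed
  show "pmf p (x + \<phi>) = pmf p x"
  proof (cases "x \<in> C")
    case True
    then have "pmf p (x + \<phi>) = pmf (map_pmf h p) (h x + h \<phi>)"
      using * CF[OF \<phi>] additive.add[OF h] by metis
    also have "\<dots> = pmf p x" using inv hF \<phi> * True by (auto simp: shift_inv_def)
    finally show ?thesis .
  next
    case False
    then show ?thesis using sub CF[OF \<phi>, of x] by (metis subsetD set_pmf_iff)
  qed
qed

text \<open>Surjectivity of \<open>h\<close> on \<open>F\<close> lifts every shift, and it also
  makes the range of \<open>h\<close> invariant under \<open>F\<close>, which settles the points
  outside the range.\<close>

lemma shift_inv_map:
  assumes inv: "shift_inv F p" and h: "Modules.additive h" and inj: "inj h" and hF: "h ` F = F"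
  shows "shift_inv F (map_pmf h p)"
  unfolding shift_inv_def
proof (intro ballI allI)
  fix \<phi> w assume "\<phi> \<in> F"
  then obtain \<psi> where \<psi>: "\<psi> \<in> F" "\<phi> = h \<psi>" using hF by blast
  show "pmf (map_pmf h p) (w + \<phi>) = pmf (map_pmf h p) w"
  proof (cases "w \<in> range h")
    case True
    then obtain y where y: "w = h y" by blast
    then have "w + \<phi> = h (y + \<psi>)" by (simp add: \<psi> additive.add[OF h])
    then show ?thesis using inv \<psi>(1) inj by (simp add: y pmf_map_inj' shift_inv_def)
  next
    case False
    have "w + \<phi> \<notin> range h"
    proof
      assume "w + \<phi> \<in> range h"
      then obtain y where "w + \<phi> = h y" by blast
      then have "w = h (y - \<psi>)" by (simp add: \<psi> additive.diff[OF h] algebra_simps)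
      then show False using False by blast
    qed
    moreover have "pmf (map_pmf h p) v = 0" if "v \<notin> range h" for v
      using that by (auto simp: pmf_eq_0_set_pmf)
    ultimately show ?thesis using False by simp
  qed
qed

section \<open>The two identities for the discrete parts\<close>

text \<open>With L1 = x + y and L2 = x + b y, symmetry gives \<open>b L1 + L2\<close> the law of
  \<open>b L1 - L2\<close>, and \<open>L1 + L2\<close> the law of \<open>L1 - L2\<close>. In each
  difference one variable cancels, and what remains is \<open>law1\<close> and \<open>law2\<close>.
  Only these two consequences of symmetry are needed to describe the discrete laws.\<close>

locale heyde_pair =
  fixes p q :: "'a::ab_group_add pmf" and b :: "'a \<Rightarrow> 'a"
  assumes additive_b: "Modules.additive b"
    and ker_b: "b x = 0 \<Longrightarrow> x = 0"
    and ker_Ib: "x + b x = 0 \<Longrightarrow> x = 0"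
    and law1: "map_pmf (\<lambda>(x, y). (x + b x) + (b y + b y)) (pair_pmf p q) = map_pmf (\<lambda>x. b x - x) p"
    and law2: "map_pmf (\<lambda>(y, x). (y + b y) + (x + x)) (pair_pmf q p) = map_pmf (\<lambda>y. y - b y) q"
begin

lemmas b_simps = additive.add[OF additive_b] additive.diff[OF additive_b] additive.minus[OF additive_b]
  additive.zero[OF additive_b]

lemma inj_b: "inj b"
proof (rule injI)
  fix x y assume "b x = b y"
  then have "b (x - y) = 0" by (simp add: b_simps)
  then show "x = y" using ker_b[of "x - y"] by simp
qed

lemma inj_Ib: "inj (\<lambda>x. x + b x)"
proof (rule injI)
  fix x y assume "x + b x = y + b y"
  moreover have "(x - y) + b (x - y) = (x + b x) - (y + b y)" by (simp add: b_simps)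
  ultimately show "x = y" using ker_Ib[of "x - y"] by simp
qed

text \<open>All maps in the identities are additive and commute with doubling. This allows the
  problem to be solved for sufficiently doubled laws and the solution to be carried back one
  doubling at a time, with the same \<open>b\<close> throughout.\<close>

lemma heyde_pair_dbl: "heyde_pair (map_pmf (dbl k) p) (map_pmf (dbl k) q) b"
proof
  have "map_pmf (\<lambda>(x, y). (x + b x) + (b y + b y)) (pair_pmf (map_pmf (dbl k) p) (map_pmf (dbl k) q)) =
      map_pmf (dbl k) (map_pmf (\<lambda>(x, y). (x + b x) + (b y + b y)) (pair_pmf p q))"
    by (simp add: map_pair[symmetric] pmf.map_comp o_def split_def dbl_additive[OF additive_b] dbl_add)
  also have "\<dots> = map_pmf (\<lambda>x. b x - x) (map_pmf (dbl k) p)"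
    by (simp add: law1 pmf.map_comp o_def dbl_additive[OF additive_b] dbl_diff)
  finally show "map_pmf (\<lambda>(x, y). (x + b x) + (b y + b y)) (pair_pmf (map_pmf (dbl k) p) (map_pmf (dbl k) q))
    = map_pmf (\<lambda>x. b x - x) (map_pmf (dbl k) p)" .
  have "map_pmf (\<lambda>(y, x). (y + b y) + (x + x)) (pair_pmf (map_pmf (dbl k) q) (map_pmf (dbl k) p)) =
      map_pmf (dbl k) (map_pmf (\<lambda>(y, x). (y + b y) + (x + x)) (pair_pmf q p))"
    by (simp add: map_pair[symmetric] pmf.map_comp o_def split_def dbl_additive[OF additive_b] dbl_add)
  also have "\<dots> = map_pmf (\<lambda>y. y - b y) (map_pmf (dbl k) q)"
    by (simp add: law2 pmf.map_comp o_def dbl_additive[OF additive_b] dbl_diff)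
  finally show "map_pmf (\<lambda>(y, x). (y + b y) + (x + x)) (pair_pmf (map_pmf (dbl k) q) (map_pmf (dbl k) p))
    = map_pmf (\<lambda>y. y - b y) (map_pmf (dbl k) q)" .
  show "b (x + y) = b x + b y" for x y by (simp add: b_simps)
qed (fact ker_b ker_Ib)+

text \<open>Spreading a maximal atom expresses \<open>x + x\<close> through one of the finitely many
  maximal atoms of the other law. The supports themselves can be infinite: among elements of order 2
  the symmetry carries no information, since there the sign is invisible.\<close>

lemma finite_doubles:
  "finite ((\<lambda>x. x + x) ` set_pmf p)" "finite ((\<lambda>y. y + y) ` set_pmf q)"
proof -
  have fin: "finite {x. pmf r x = pmf r m}" if "m \<in> set_pmf r" for r :: "'a pmf" and m
    by (rule finite_subset[OF _ finite_large_atoms[of "pmf r m" r]]) (use that in \<open>auto simp: pmf_positive\<close>)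
  obtain m where m: "m \<in> set_pmf q" "\<And>x. pmf q x \<le> pmf q m" using pmf_has_max by blast
  have "(\<lambda>x. x + x) ` set_pmf p \<subseteq> (\<lambda>y. m - b m - (y + b y)) ` {y. pmf q y = pmf q m}"
  proof
    fix z assume "z \<in> (\<lambda>x. x + x) ` set_pmf p"
    then obtain x where x: "x \<in> set_pmf p" "z = x + x" by blast
    from max_atom_spread(1)[OF law2 inj_Ib m(2) x(1)]
    obtain y where y: "(y + b y) + (x + x) = m - b m" "pmf q y = pmf q m" by blast
    have "z = m - b m - (y + b y)" unfolding y(1)[symmetric] x(2) by simp
    then show "z \<in> (\<lambda>y. m - b m - (y + b y)) ` {y. pmf q y = pmf q m}" using y(2) by blast
  qed
  then show "finite ((\<lambda>x. x + x) ` set_pmf p)" using fin[OF m(1)] finite_surj by blast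
  obtain m where m: "m \<in> set_pmf p" "\<And>x. pmf p x \<le> pmf p m" using pmf_has_max by blast
  \<comment> \<open>The first identity controls only the doubled image under \<open>b\<close>; the
    injectivity of \<open>b\<close> removes it afterwards.\<close>
  have "b ` (\<lambda>y. y + y) ` set_pmf q \<subseteq> (\<lambda>x. b m - m - (x + b x)) ` {x. pmf p x = pmf p m}"
  proof
    fix z assume "z \<in> b ` (\<lambda>y. y + y) ` set_pmf q"
    then obtain y where y: "y \<in> set_pmf q" "z = b y + b y" by (auto simp: b_simps)
    from max_atom_spread(1)[OF law1 inj_Ib m(2) y(1)]
    obtain x where x: "(x + b x) + (b y + b y) = b m - m" "pmf p x = pmf p m" by blast
    have "z = b m - m - (x + b x)" unfolding x(1)[symmetric] y(2) by simp
    then show "z \<in> (\<lambda>x. b m - m - (x + b x)) ` {x. pmf p x = pmf p m}" using x(2) by blast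
  qed
  then have "finite (b ` (\<lambda>y. y + y) ` set_pmf q)" using fin[OF m(1)] finite_surj by blast
  then show "finite ((\<lambda>y. y + y) ` set_pmf q)"
    by (rule finite_imageD) (use inj_b in \<open>auto simp: inj_on_def inj_def\<close>)
qed

text \<open>Each identity bounds one support by the other, so both have the same size and
  \<open>equal_supports_structure\<close> applies in both directions. It yields a subgroup
  \<open>U1\<close> from differences under \<open>b - I\<close> on the first support and a subgroup
  \<open>F\<close> from differences under \<open>I - b\<close> on the second. Since twice
  \<open>x\<close> is \<open>(x + b x) - (b x - x)\<close>, the two subgroups can be compared
  through the doubled first support.\<close>

lemma structure_odd:
  assumes finA: "finite (set_pmf p)" and finB: "finite (set_pmf q)"
    and injA: "inj_on (\<lambda>x. x + x) (set_pmf p)" and injB: "inj_on (\<lambda>x. x + x) (set_pmf q)"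
    and injAA: "inj_on (\<lambda>x. x + x) ((\<lambda>x. x + x) ` set_pmf p)"
    and x0: "x\<^sub>0 \<in> set_pmf p" and y0: "y\<^sub>0 \<in> set_pmf q"
  obtains F where "finite F" "add_subgroup F" "\<And>u. u \<in> F \<Longrightarrow> u + u = 0 \<Longrightarrow> u = 0" "b ` F = F"
    "\<And>u. u \<in> F \<Longrightarrow> b u = u \<Longrightarrow> u = 0"
    "\<And>x. x \<in> set_pmf p \<Longrightarrow> (x + x) - (x\<^sub>0 + x\<^sub>0) \<in> F" "\<And>y. y \<in> set_pmf q \<Longrightarrow> (y + y) - (y\<^sub>0 + y\<^sub>0) \<in> F"
    "shift_inv F (map_pmf (\<lambda>x. x + x) p)" "shift_inv F (map_pmf (\<lambda>x. x + x) q)"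
proof -
  let ?A = "set_pmf p" and ?B = "set_pmf q" and ?d = "\<lambda>x::'a. x + x"
  have injB': "inj_on (\<lambda>y. b y + b y) ?B"
  proof (rule inj_onI)
    fix x y assume xy: "x \<in> ?B" "y \<in> ?B" "b x + b x = b y + b y"
    then have "b (x + x) = b (y + y)" by (simp add: b_simps)
    then have "x + x = y + y" by (rule injD[OF inj_b])
    then show "x = y" using inj_onD[OF injB _ xy(1,2)] by simp
  qed
  obtain m where "m \<in> ?A" and m: "\<And>x. pmf p x \<le> pmf p m" using pmf_has_max by blast
  obtain m' where "m' \<in> ?B" and m': "\<And>x. pmf q x \<le> pmf q m'" using pmf_has_max by blast
  have BA: "card ?B \<le> card ?A"
    by (rule order.trans[OF card_support_le[OF law1 inj_Ib injB' m] card_mono[OF finA]]) auto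
  have AB: "card ?A \<le> card ?B"
    by (rule order.trans[OF card_support_le[OF law2 inj_Ib injA m'] card_mono[OF finB]]) auto
  define U1 where "U1 = (\<lambda>x. (b x - x) - (b x\<^sub>0 - x\<^sub>0)) ` ?A"
  define F where "F = (\<lambda>y. (y - b y) - (y\<^sub>0 - b y\<^sub>0)) ` ?B"
  note E1 = equal_supports_structure[OF law1 inj_Ib injB' finA finB AB x0 y0, folded U1_def]
  note E2 = equal_supports_structure[OF law2 inj_Ib injA finB finA BA y0 x0, folded F_def]
  have dA: "(x + x) - (x\<^sub>0 + x\<^sub>0) \<in> F" if "x \<in> ?A" for x
  proof -
    have "x + x \<in> (\<lambda>u. x\<^sub>0 + x\<^sub>0 + u) ` F" unfolding E2(4)[symmetric] using that by (rule imageI)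
    then show ?thesis by (auto simp: algebra_simps)
  qed
  have FA: "\<exists>x\<in>?A. u = (x + x) - (x\<^sub>0 + x\<^sub>0)" if "u \<in> F" for u
  proof -
    have "x\<^sub>0 + x\<^sub>0 + u \<in> ?d ` ?A" using E2(4) that by auto
    then obtain x where "x \<in> ?A" "x + x = x\<^sub>0 + x\<^sub>0 + u" by auto
    then show ?thesis by (intro bexI[of _ x]) simp_all
  qed
  have U1A: "(x + x) - (x\<^sub>0 + x\<^sub>0) \<in> U1" if "x \<in> ?A" for x
  proof -
    have "x + b x \<in> (\<lambda>u. x\<^sub>0 + b x\<^sub>0 + u) ` U1" unfolding E1(5)[symmetric] using that by (rule imageI)
    then have 1: "(x + b x) - (x\<^sub>0 + b x\<^sub>0) \<in> U1" by (auto simp: algebra_simps)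
    have 2: "(b x - x) - (b x\<^sub>0 - x\<^sub>0) \<in> U1" using that by (auto simp: U1_def)
    have e: "(x + x) - (x\<^sub>0 + x\<^sub>0) = ((x + b x) - (x\<^sub>0 + b x\<^sub>0)) - ((b x - x) - (b x\<^sub>0 - x\<^sub>0))" by simp
    show ?thesis by (subst e) (rule add_subgroup_diff[OF E1(1) 1 2])
  qed
  \<comment> \<open>\<open>F\<close> consists of the differences of doubled points of
    \<open>?A\<close>, all of which lie in \<open>U1\<close>; equal cardinalities do the
    rest.\<close>
  have "F \<subseteq> U1" using FA U1A by blast
  then have FU1: "F = U1" using E1(2,3) E2(3) AB by (intro card_seteq) auto
  have dB: "(y + y) - (y\<^sub>0 + y\<^sub>0) \<in> F" if "y \<in> ?B" for y
  proof -
    have "y + b y \<in> (\<lambda>u. y\<^sub>0 + b y\<^sub>0 + u) ` F" unfolding E2(5)[symmetric] using that by (rule imageI)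
    then have 1: "(y + b y) - (y\<^sub>0 + b y\<^sub>0) \<in> F" by (auto simp: algebra_simps)
    have 2: "(y - b y) - (y\<^sub>0 - b y\<^sub>0) \<in> F" using that by (auto simp: F_def)
    have e: "(y + y) - (y\<^sub>0 + y\<^sub>0) = ((y + b y) - (y\<^sub>0 + b y\<^sub>0)) + ((y - b y) - (y\<^sub>0 - b y\<^sub>0))" by simp
    show ?thesis by (subst e) (use E2(1) 1 2 in \<open>unfold add_subgroup_def, blast\<close>)
  qed
  have finF: "finite F" and sgF: "add_subgroup F" using E2 by auto
  have "(\<lambda>y. y + y - (y\<^sub>0 + y\<^sub>0)) ` ?B \<subseteq> F" using dB by auto
  moreover have "card ((\<lambda>y. y + y - (y\<^sub>0 + y\<^sub>0)) ` ?B) = card ?B"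
    using injB by (intro card_image) (auto simp: inj_on_def)
  ultimately have BF: "F = (\<lambda>y. y + y - (y\<^sub>0 + y\<^sub>0)) ` ?B"
    using card_seteq[OF finF, of "(\<lambda>y. y + y - (y\<^sub>0 + y\<^sub>0)) ` ?B"] E2(3) by simp
  \<comment> \<open>\<open>F\<close> is also the set of differences of doubled points of
    \<open>?B\<close>, and the first identity places the images of these under \<open>b\<close> in
    \<open>U1\<close>, which equals \<open>F\<close>.\<close>
  have "b ` F \<subseteq> F"
  proof
    fix v assume "v \<in> b ` F"
    then obtain y where y: "y \<in> ?B" "v = b (y + y - (y\<^sub>0 + y\<^sub>0))" using BF by blast
    have "b y + b y \<in> (\<lambda>u. b y\<^sub>0 + b y\<^sub>0 + u) ` F" unfolding E1(4)[folded FU1, symmetric] using y(1) by (rule imageI)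
    then show "v \<in> F" using y(2) by (auto simp: b_simps algebra_simps)
  qed
  moreover have "card (b ` F) = card F" using inj_b by (intro card_image) (auto simp: inj_on_def inj_def)
  ultimately have bF: "b ` F = F" using card_seteq[OF finF] by simp
  \<comment> \<open>An element of order 2 in \<open>F\<close> would give two points of
    \<open>?A\<close> whose doubles differ but whose fourfold multiples agree, against
    \<open>injAA\<close>.\<close>
  have odd: "u = 0" if u: "u \<in> F" "u + u = 0" for u
  proof -
    obtain x where x: "x \<in> ?A" "u = (x + x) - (x\<^sub>0 + x\<^sub>0)" using FA[OF u(1)] by blast
    have "(x + x) + (x + x) = (x\<^sub>0 + x\<^sub>0) + (x\<^sub>0 + x\<^sub>0) + (u + u)" unfolding x(2) by (simp add: algebra_simps)
    then have "x + x = x\<^sub>0 + x\<^sub>0" using injAA x(1) x0 u(2) by (auto simp: inj_on_def)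
    then show ?thesis using x(2) by simp
  qed
  \<comment> \<open>Odd order makes every \<open>v\<close> a double \<open>w + w\<close> with
    \<open>w\<close> in \<open>F\<close>; as an element of \<open>U1\<close>, \<open>w\<close> is
    \<open>b - I\<close> of a difference of support points. That difference need not lie in
    \<open>F\<close>, but its double does. Surjectivity of \<open>b - I\<close> on the finite set
    \<open>F\<close> then gives injectivity.\<close>
  have "F \<subseteq> (\<lambda>u. b u - u) ` F"
  proof -
    have "inj_on ?d F"
    proof (rule inj_onI)
      fix u v assume uv: "u \<in> F" "v \<in> F" "u + u = v + v"
      have "(u - v) + (u - v) = (u + u) - (v + v)" by simp
      then show "u = v" using odd[OF add_subgroup_diff[OF sgF uv(1,2)]] uv(3) by simp
    qed
    then have "card (?d ` F) = card F" by (rule card_image)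
    moreover have "?d ` F \<subseteq> F" using sgF unfolding add_subgroup_def by blast
    ultimately have dF: "?d ` F = F" using card_seteq[OF finF] by simp
    show ?thesis
    proof
      fix v assume "v \<in> F"
      then obtain w where w: "w \<in> F" "v = w + w" using dF by blast
      then obtain x where x: "x \<in> ?A" "w = (b x - x) - (b x\<^sub>0 - x\<^sub>0)" using FU1 U1_def by auto
      have "v = b (x + x - (x\<^sub>0 + x\<^sub>0)) - (x + x - (x\<^sub>0 + x\<^sub>0))"
        by (simp add: w x(2) b_simps algebra_simps)
      then show "v \<in> (\<lambda>u. b u - u) ` F" using dA[OF x(1)] by blast
    qed
  qed
  then have "inj_on (\<lambda>u. b u - u) F"
    using finF by (intro eq_card_imp_inj_on) (auto intro!: antisym card_image_le card_mono)
  then have Ib: "u = 0" if "u \<in> F" "b u = u" for u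
    using inj_onD[of "\<lambda>u. b u - u" F u 0] that sgF by (simp add: b_simps add_subgroup_def)
  have inv: "shift_inv F (map_pmf ?d r)"
    if inj: "inj_on ?d (set_pmf r)" and im: "?d ` set_pmf r = (\<lambda>u. z + u) ` F"
      and const: "\<And>x x'. x \<in> set_pmf r \<Longrightarrow> x' \<in> set_pmf r \<Longrightarrow> pmf r x = pmf r x'" for r :: "'a pmf" and z
    unfolding shift_inv_def
  proof (intro ballI allI)
    fix \<phi> w assume \<phi>: "\<phi> \<in> F"
    have iff: "w + \<phi> \<in> (\<lambda>u. z + u) ` F \<longleftrightarrow> w \<in> (\<lambda>u. z + u) ` F"
    proof
      assume "w + \<phi> \<in> (\<lambda>u. z + u) ` F"
      then obtain u where "u \<in> F" "w + \<phi> = z + u" by blast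
      then have "w = z + (u - \<phi>)" "u - \<phi> \<in> F" using add_subgroup_diff[OF sgF] \<phi> by (auto simp: algebra_simps)
      then show "w \<in> (\<lambda>u. z + u) ` F" by blast
    next
      assume "w \<in> (\<lambda>u. z + u) ` F"
      then obtain u where "u \<in> F" "w = z + u" by blast
      then have "w + \<phi> = z + (u + \<phi>)" "u + \<phi> \<in> F" using sgF \<phi> by (auto simp: add_subgroup_def algebra_simps)
      then show "w + \<phi> \<in> (\<lambda>u. z + u) ` F" by blast
    qed
    show "pmf (map_pmf ?d r) (w + \<phi>) = pmf (map_pmf ?d r) w"
    proof (cases "w \<in> ?d ` set_pmf r")
      case True
      then obtain x where x: "x \<in> set_pmf r" "w = x + x" by blast
      obtain x' where x': "x' \<in> set_pmf r" "w + \<phi> = x' + x'" using iff True im by auto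
      show ?thesis using pmf_map_inj[OF inj x(1)] pmf_map_inj[OF inj x'(1)] const[OF x(1) x'(1)]
        by (simp add: x(2)[symmetric] x'(2)[symmetric])
    next
      case False
      then show ?thesis using iff im by (simp add: pmf_map_outside)
    qed
  qed
  have imB: "?d ` ?B = (\<lambda>u. y\<^sub>0 + y\<^sub>0 + u) ` F"
    unfolding BF by (simp add: image_image)
  show ?thesis
    using that[OF finF sgF odd bF Ib dA dB inv[OF injA E2(4) E1(6)] inv[OF injB imB E2(6)]] by blast
qed

text \<open>A fixed point of \<open>b\<close> of order at most 2 lies in the kernel of
  \<open>I + b\<close>, hence is 0; induction extends this to all 2-power torsion. Fixed points that
  enter \<open>F\<close> after doubling are handled by \<open>Ib\<close>.\<close>

lemma inj_Ib_torsion: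
  assumes Ib: "\<And>u. u \<in> F \<Longrightarrow> b u = u \<Longrightarrow> u = 0" and "dbl N z \<in> F" "b z = z"
  shows "z = 0"
proof -
  have *: "dbl N z = 0 \<Longrightarrow> b z = z \<Longrightarrow> z = 0" for z
  proof (induction N arbitrary: z)
    case (Suc N)
    have "dbl N (z + z) = 0" using Suc.prems(1) by (simp add: dbl_Suc dbl_add)
    then have "z + z = 0" using Suc.IH Suc.prems(2) by (simp add: b_simps)
    then show ?case using ker_Ib[of z] Suc.prems(2) by simp
  qed simp
  have "b (dbl N z) = dbl N z" using assms(3) by (simp add: dbl_additive[OF additive_b])
  then show ?thesis using Ib[OF assms(2)] * assms(3) by blast
qed

theorem heyde_structure:
  obtains F N x\<^sub>0 y\<^sub>0 where "finite F" "add_subgroup F" "\<And>u. u \<in> F \<Longrightarrow> u + u = 0 \<Longrightarrow> u = 0" "b ` F = F"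
    "\<And>u. u \<in> F \<Longrightarrow> b u = u \<Longrightarrow> u = 0"
    "x\<^sub>0 \<in> set_pmf p" "y\<^sub>0 \<in> set_pmf q"
    "\<And>x. x \<in> set_pmf p \<Longrightarrow> dbl N (x - x\<^sub>0) \<in> F" "\<And>y. y \<in> set_pmf q \<Longrightarrow> dbl N (y - y\<^sub>0) \<in> F"
    "shift_inv F p" "shift_inv F q"
proof -
  let ?A = "set_pmf p" and ?B = "set_pmf q" and ?d = "\<lambda>x::'a. x + x"
  obtain x0 y0 where x0: "x0 \<in> ?A" and y0: "y0 \<in> ?B" using set_pmf_not_empty by (metis ex_in_conv)
  \<comment> \<open>Differences of doubled support points. They are finitely many, so one exponent
    \<open>k\<close> kills all their 2-power torsion; after \<open>k\<close> further doublings, any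
    additional doubling is injective on the supports.\<close>
  define S where "S = (\<lambda>(x, y). x - y) ` (?d ` ?A \<times> ?d ` ?A \<union> ?d ` ?B \<times> ?d ` ?B)"
  have "finite S" unfolding S_def using finite_doubles by blast
  then obtain k where k: "\<And>z j. z \<in> S \<Longrightarrow> dbl j z = 0 \<Longrightarrow> dbl k z = 0" using finite_dbl_exponent by blast
  define P where "P j = map_pmf (dbl j) p" for j
  define Q where "Q j = map_pmf (dbl j) q" for j
  have setP: "set_pmf (P (Suc k)) = dbl k ` ?d ` ?A" and setQ: "set_pmf (Q (Suc k)) = dbl k ` ?d ` ?B"
    by (simp_all add: P_def Q_def image_image dbl_Suc dbl_add)
  interpret K: heyde_pair "P (Suc k)" "Q (Suc k)" b unfolding P_def Q_def by (rule heyde_pair_dbl)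
  have inj: "inj_on (dbl j) (dbl k ` ?d ` ?A)" "inj_on (dbl j) (dbl k ` ?d ` ?B)" for j
  proof -
    have "dbl k u = dbl k v" if "u - v \<in> S" "dbl j (dbl k u) = dbl j (dbl k v)" for u v
      using k[OF that(1), of "j + k"] that(2) by (simp add: dbl_dbl dbl_diff)
    note * = this
    have S: "u - v \<in> S" if "u \<in> ?d ` ?A \<and> v \<in> ?d ` ?A \<or> u \<in> ?d ` ?B \<and> v \<in> ?d ` ?B" for u v
      unfolding S_def by (rule image_eqI[of _ _ "(u, v)"]) (use that in auto)
    show "inj_on (dbl j) (dbl k ` ?d ` ?A)" "inj_on (dbl j) (dbl k ` ?d ` ?B)"
      by (rule inj_onI, use *[OF S] in blast)+
  qed
  have d1: "?d = dbl 1" by (simp add: fun_eq_iff dbl_Suc)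
  have injdd: "inj_on (dbl 1) (dbl 1 ` dbl k ` ?d ` ?A)"
  proof (rule inj_onI)
    fix u v assume u: "u \<in> dbl 1 ` dbl k ` ?d ` ?A" and v: "v \<in> dbl 1 ` dbl k ` ?d ` ?A"
      and eq: "dbl 1 u = dbl 1 v"
    obtain u' where u': "u' \<in> dbl k ` ?d ` ?A" "u = dbl 1 u'" using u by blast
    obtain v' where v': "v' \<in> dbl k ` ?d ` ?A" "v = dbl 1 v'" using v by blast
    have "dbl (1 + 1) u' = dbl (1 + 1) v'" using eq by (simp only: u'(2) v'(2) dbl_dbl)
    then have "u' = v'" using inj_onD[OF inj(1) _ u'(1) v'(1)] by blast
    then show "u = v" using u'(2) v'(2) by simp
  qed
  have finA: "finite (set_pmf (P (Suc k)))" and finB: "finite (set_pmf (Q (Suc k)))"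
    unfolding setP setQ using finite_doubles by auto
  have x0': "dbl (Suc k) x0 \<in> set_pmf (P (Suc k))" "dbl (Suc k) y0 \<in> set_pmf (Q (Suc k))"
    using x0 y0 by (auto simp: P_def Q_def)
  obtain F where finF: "finite F" and sgF: "add_subgroup F"
    and odd: "\<And>u. u \<in> F \<Longrightarrow> u + u = 0 \<Longrightarrow> u = 0" and bF: "b ` F = F"
    and Ib: "\<And>u. u \<in> F \<Longrightarrow> b u = u \<Longrightarrow> u = 0"
    and A: "\<And>x. x \<in> set_pmf (P (Suc k)) \<Longrightarrow> (x + x) - (dbl (Suc k) x0 + dbl (Suc k) x0) \<in> F"
    and B: "\<And>y. y \<in> set_pmf (Q (Suc k)) \<Longrightarrow> (y + y) - (dbl (Suc k) y0 + dbl (Suc k) y0) \<in> F"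
    and inv: "shift_inv F (map_pmf ?d (P (Suc k)))" "shift_inv F (map_pmf ?d (Q (Suc k)))"
    using K.structure_odd[OF finA finB _ _ _ x0'] inj[of 1] injdd unfolding setP setQ d1 by metis
  \<comment> \<open>One more than the \<open>Suc k\<close> doublings performed, because
    \<open>structure_odd\<close> speaks about the doubles of the points it is given.\<close>
  define N where "N = Suc (Suc k)"
  have A': "dbl N (x - x0) \<in> F" if "x \<in> ?A" for x
    using A[of "dbl (Suc k) x"] that by (simp add: P_def N_def dbl_Suc dbl_diff)
  have B': "dbl N (y - y0) \<in> F" if "y \<in> ?B" for y
    using B[of "dbl (Suc k) y"] that by (simp add: Q_def N_def dbl_Suc dbl_diff)
  have PS: "P (Suc j) = map_pmf ?d (P j)" and QS: "Q (Suc j) = map_pmf ?d (Q j)" for j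
    by (simp_all add: P_def Q_def pmf.map_comp o_def dbl_Suc[abs_def])
  \<comment> \<open>A union of cosets of \<open>F\<close> that carries the \<open>j\<close>-fold
    doubled law and on which \<open>I - b\<close> is injective, as \<open>shift_inv_of_map\<close>
    requires.\<close>
  define C where "C j z = {x. dbl N (x - dbl j z) \<in> F}" for j z
  have CF: "x + \<phi> \<in> C j z \<longleftrightarrow> x \<in> C j z" if "\<phi> \<in> F" for x \<phi> j z
  proof -
    have e: "dbl N (x + \<phi> - dbl j z) = dbl N (x - dbl j z) + dbl N \<phi>" by (simp add: dbl_add dbl_diff)
    have "dbl N \<phi> \<in> F" using dbl_subgroup[OF sgF that] .
    then show ?thesis unfolding C_def mem_Collect_eq e
      using sgF add_subgroup_diff[OF sgF, of "dbl N (x - dbl j z) + dbl N \<phi>" "dbl N \<phi>"]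
      by (auto simp: add_subgroup_def)
  qed
  have inj_C: "x = y" if "x \<in> C j z" "y \<in> C j z" "b (x - y) = x - y" for x y j z
  proof -
    have "dbl N (x - y) = dbl N (x - dbl j z) - dbl N (y - dbl j z)" by (simp add: dbl_diff)
    then have "dbl N (x - y) \<in> F" using that(1,2) add_subgroup_diff[OF sgF] by (simp add: C_def)
    then show ?thesis using inj_Ib_torsion[OF Ib _ that(3)] by simp
  qed
  \<comment> \<open>In \<open>law1\<close> the summand \<open>b y + b y\<close> is the image under
    \<open>b\<close> of the next doubled law, so it is invariant and makes the whole sum invariant.
    Hence the law of \<open>b x - x\<close> is invariant, and injectivity of \<open>b - I\<close> on
    \<open>C\<close> transfers this to \<open>P j\<close>. In \<open>law2\<close> the summand
    \<open>x + x\<close> plays the same part for \<open>Q j\<close>.\<close>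
  have step: "shift_inv F (P j) \<and> shift_inv F (Q j)" if "shift_inv F (P (Suc j))" "shift_inv F (Q (Suc j))" for j
  proof -
    interpret J: heyde_pair "P j" "Q j" b unfolding P_def Q_def by (rule heyde_pair_dbl)
    have sub: "set_pmf (P j) \<subseteq> C j x0" "set_pmf (Q j) \<subseteq> C j y0"
    proof -
      have "dbl N (dbl j x - dbl j z) \<in> F" if "dbl N (x - z) \<in> F" for x z
      proof -
        have "dbl N (dbl j x - dbl j z) = dbl j (dbl N (x - z))"
          by (simp add: dbl_diff dbl_dbl add.commute)
        then show ?thesis using dbl_subgroup[OF sgF that] by simp
      qed
      then show "set_pmf (P j) \<subseteq> C j x0" "set_pmf (Q j) \<subseteq> C j y0"
        using A' B' by (auto simp: P_def Q_def C_def)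
    qed
    have "map_pmf (\<lambda>y. b y + b y) (Q j) = map_pmf b (Q (Suc j))"
      by (simp add: QS pmf.map_comp o_def b_simps)
    then have "shift_inv F (map_pmf (\<lambda>y. b y + b y) (Q j))"
      using shift_inv_map[OF that(2) additive_b inj_b bF] by simp
    from shift_inv_sum[OF this, of "\<lambda>x. x + b x" "P j"] have 1: "shift_inv F (map_pmf (\<lambda>x. b x - x) (P j))"
      by (simp only: J.law1)
    have P: "shift_inv F (P j)"
    proof (rule shift_inv_of_map[OF 1 _ _ sub(1) _ CF])
      show "Modules.additive (\<lambda>x. b x - x)" by standard (simp add: b_simps)
      show "(\<lambda>x. b x - x) ` F \<subseteq> F" using bF add_subgroup_diff[OF sgF] by blast
      show "inj_on (\<lambda>x. b x - x) (C j x0)"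
      proof (rule inj_onI)
        fix x y assume xy: "x \<in> C j x0" "y \<in> C j x0" "b x - x = b y - y"
        have "b (x - y) - (x - y) = (b x - x) - (b y - y)" by (simp add: b_simps)
        then have "b (x - y) = x - y" using xy(3) by simp
        then show "x = y" by (rule inj_C[OF xy(1,2)])
      qed
    qed
    have "shift_inv F (map_pmf (\<lambda>x. x + x) (P j))" using that(1) by (simp add: PS)
    from shift_inv_sum[OF this, of "\<lambda>y. y + b y" "Q j"] have 2: "shift_inv F (map_pmf (\<lambda>y. y - b y) (Q j))"
      by (simp only: J.law2)
    have "shift_inv F (Q j)"
    proof (rule shift_inv_of_map[OF 2 _ _ sub(2) _ CF])
      show "Modules.additive (\<lambda>x. x - b x)" by standard (simp add: b_simps)
      show "(\<lambda>x. x - b x) ` F \<subseteq> F" using bF add_subgroup_diff[OF sgF] by blast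
      show "inj_on (\<lambda>x. x - b x) (C j y0)"
      proof (rule inj_onI)
        fix x y assume xy: "x \<in> C j y0" "y \<in> C j y0" "x - b x = y - b y"
        have "(x - y) - b (x - y) = (x - b x) - (y - b y)" by (simp add: b_simps)
        then have "b (x - y) = x - y" using xy(3) by simp
        then show "x = y" by (rule inj_C[OF xy(1,2)])
      qed
    qed
    with P show ?thesis ..
  qed
  have "shift_inv F (P 0) \<and> shift_inv F (Q 0)"
  proof (rule inc_induct[of 0 N])
    show "shift_inv F (P N) \<and> shift_inv F (Q N)" using inv by (simp add: N_def PS QS)
  qed (use step in auto)
  moreover have "dbl 0 = (\<lambda>x::'a. x)" by (simp add: fun_eq_iff)
  ultimately have "shift_inv F p" "shift_inv F q" by (simp_all add: P_def Q_def map_pmf_ident)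
  then show ?thesis using that[OF finF sgF odd bF Ib x0 y0 A' B'] by blast
qed

end

section \<open>Uniqueness of characteristic functions\<close>

lemma iexp_diff_tendsto:
  assumes h: "h \<longlonglongrightarrow> 0" "\<And>m. h m \<noteq> 0"
  shows "(\<lambda>m. (iexp (h m * x) - 1) / (\<i> * h m)) \<longlonglongrightarrow> of_real x"
proof (cases "x = 0")
  case False
  have "(\<lambda>m. \<i> * of_real (h m * x)) \<longlonglongrightarrow> \<i> * of_real (0 * x)" by (intro tendsto_intros h(1))
  then have "filterlim (\<lambda>m. \<i> * of_real (h m * x)) (at 0) sequentially"
    using h(2) False by (simp add: filterlim_at)
  from filterlim_compose[OF lim_exp_minus_1 this]
  have "(\<lambda>m. of_real x * ((iexp (h m * x) - 1) / (\<i> * of_real (h m * x)))) \<longlonglongrightarrow> of_real x * 1"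
    by (intro tendsto_mult_left)
  then show ?thesis using False by simp
qed simp

lemma norm_iexp_minus_1: "cmod (iexp y - 1) \<le> \<bar>y\<bar>"
  using iexp_approx1[of y 0] by simp

lemma (in real_distribution) integrable_trig:
  "integrable M (\<lambda>x. iexp (a * x) * (iexp (h * x) - 1) ^ n)"
proof (rule integrable_const_bound[where B = "2 ^ n"])
  have "cmod (iexp (h * x) - 1) ^ n \<le> 2 ^ n" for x
    using norm_triangle_ineq4[of "iexp (h * x)" 1] by (intro power_mono) auto
  then show "AE x in M. cmod (iexp (a * x) * (iexp (h * x) - 1) ^ n) \<le> 2 ^ n"
    by (simp add: norm_mult norm_power)
qed simp

text \<open>The integrand is a trigonometric polynomial with frequencies between \<open>a\<close>
  and \<open>a + n h\<close>, all inside the window where the characteristic functions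
  agree.\<close>

lemma trig_moment_eq:
  assumes "real_distribution \<mu>" "real_distribution \<nu>"
    and eq: "\<And>t. \<bar>t\<bar> < r \<Longrightarrow> char \<mu> t = char \<nu> t"
    and "\<bar>a\<bar> + real n * \<bar>h\<bar> < r"
  shows "(CLINT x|\<mu>. iexp (a * x) * (iexp (h * x) - 1) ^ n) = (CLINT x|\<nu>. iexp (a * x) * (iexp (h * x) - 1) ^ n)"
  using assms(4)
proof (induction n arbitrary: a)
  case 0
  then show ?case using eq[of a] by (simp add: char_def)
next
  case (Suc n)
  interpret \<mu>: real_distribution \<mu> by fact
  interpret \<nu>: real_distribution \<nu> by fact
  have *: "iexp (a * x) * (iexp (h * x) - 1) ^ Suc n =
      iexp ((a + h) * x) * (iexp (h * x) - 1) ^ n - iexp (a * x) * (iexp (h * x) - 1) ^ n" for x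
    by (simp add: algebra_simps exp_add)
  have "\<bar>a + h\<bar> + real n * \<bar>h\<bar> \<le> \<bar>a\<bar> + real (Suc n) * \<bar>h\<bar>"
    by (simp add: algebra_simps)
  then have 1: "\<bar>a + h\<bar> + real n * \<bar>h\<bar> < r" using Suc.prems by linarith
  have "real n * \<bar>h\<bar> \<le> real (Suc n) * \<bar>h\<bar>" by (intro mult_right_mono) auto
  then have 2: "\<bar>a\<bar> + real n * \<bar>h\<bar> < r" using Suc.prems by linarith
  show ?case unfolding *
    by (subst Bochner_Integration.integral_diff, rule \<mu>.integrable_trig, rule \<mu>.integrable_trig,
        subst Bochner_Integration.integral_diff, rule \<nu>.integrable_trig, rule \<nu>.integrable_trig)
      (simp only: Suc.IH[OF 1] Suc.IH[OF 2])
qed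

text \<open>A distribution whose characteristic function agrees near \<open>0\<close> with that of a distribution with
  rapidly bounded moments: Fatou's lemma applied to \<open>|(exp (i h x) - 1) / h|\<^sup>2\<^sup>k\<close>, a
  trigonometric polynomial with frequencies near \<open>0\<close>, transfers the moments.\<close>

lemma char_local_determines:
  assumes \<mu>: "real_distribution \<mu>" and \<nu>: "real_distribution \<nu>"
    and int: "\<And>k. integrable \<nu> (\<lambda>x. x ^ k)"
    and growth: "\<And>t. (\<lambda>k. 2 * \<bar>t\<bar> ^ (2 * k) / fact (2 * k) * (\<integral>x. x ^ (2 * k) \<partial>\<nu>)) \<longlonglongrightarrow> 0"
    and r: "r > 0" and eq: "\<And>t. \<bar>t\<bar> < r \<Longrightarrow> char \<mu> t = char \<nu> t"
  shows "\<mu> = \<nu>"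
proof -
  interpret \<mu>: real_distribution \<mu> by fact
  interpret \<nu>: real_distribution \<nu> by fact
  \<comment> \<open>The step tends to 0 in \<open>m\<close> while \<open>n * h n m\<close> stays
    below \<open>r / 2\<close>. The factor 2 leaves room for the shift by \<open>- k h\<close> in
    \<open>w2_eq\<close>, which needs \<open>3 k h < r\<close> for the power
    \<open>2 k\<close>.\<close>
  define h where "h n m = r / (2 * real (n + 1) * real (m + 1))" for n m
  have hpos: "h n m > 0" for n m using r by (simp add: h_def)
  have h0: "h n \<longlonglongrightarrow> 0" for n
  proof -
    have "(\<lambda>m. (r / (2 * real (n + 1))) * inverse (real (Suc m))) \<longlonglongrightarrow> (r / (2 * real (n + 1))) * 0"
      by (intro tendsto_intros LIMSEQ_inverse_real_of_nat)
    then show ?thesis by (simp add: h_def[abs_def] field_simps)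
  qed
  have hsmall: "real n * h n m < r / 2" for n m
  proof -
    have "real n < real (n + 1) * 1" by simp
    also have "\<dots> \<le> real (n + 1) * real (m + 1)" by (intro mult_left_mono) auto
    finally have "real n / (real (n + 1) * real (m + 1)) < 1" by (simp add: divide_less_eq_1)
    then have "r / 2 * (real n / (real (n + 1) * real (m + 1))) < r / 2 * 1"
      using r by (intro mult_strict_left_mono) auto
    moreover have "real n * (r / (2 * a * b)) = r / 2 * (real n / (a * b))" for a b :: real by (simp add: ac_simps)
    ultimately show ?thesis by (simp only: h_def mult_1_right)
  qed
  \<comment> \<open>A difference quotient of the exponential: it tends to \<open>x\<close> and is
    bounded by \<open>\<bar>x\<bar>\<close>, so its powers approximate those of \<open>x\<close> and
    the latter dominate them.\<close>
  define w where "w n m x = (iexp (h n m * x) - 1) / (\<i> * h n m)" for n m x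
  have w_lim: "(\<lambda>m. w n m x) \<longlonglongrightarrow> of_real x" for n x
    unfolding w_def using hpos by (intro iexp_diff_tendsto[OF h0]) (metis less_irrefl)
  have w_le: "cmod (w n m x) \<le> \<bar>x\<bar>" for n m x
    using norm_iexp_minus_1[of "h n m * x"] hpos[of n m]
    by (simp add: w_def norm_divide norm_mult abs_mult field_simps)
  have w_meas: "(\<lambda>x. w n m x) \<in> borel_measurable borel" for n m
    unfolding w_def by measurable
  have w_eq: "(CLINT x|\<mu>. w n m x ^ n) = (CLINT x|\<nu>. w n m x ^ n)" for n m
  proof -
    have e: "w n m x ^ n = (1 / (\<i> * h n m) ^ n) * (iexp (0 * x) * (iexp (h n m * x) - 1) ^ n)" for x
      by (simp add: w_def power_divide)
    have "(CLINT x|\<mu>. iexp (0 * x) * (iexp (h n m * x) - 1) ^ n) = (CLINT x|\<nu>. iexp (0 * x) * (iexp (h n m * x) - 1) ^ n)"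
      by (rule trig_moment_eq[OF \<mu> \<nu> eq]) (use hsmall[of n m] hpos[of n m] r in auto)
    then show ?thesis unfolding e by simp
  qed
  have w2_eq: "(\<integral>x. cmod (w (2 * k) m x) ^ (2 * k) \<partial>\<mu>) = (\<integral>x. cmod (w (2 * k) m x) ^ (2 * k) \<partial>\<nu>)" for k m
  proof -
    let ?h = "h (2 * k) m"
    \<comment> \<open>The squared modulus of \<open>iexp (h x) - 1\<close> is minus its square times
      \<open>iexp (- h x)\<close>, so even powers of the modulus are again trigonometric
      polynomials, with frequencies centred at 0.\<close>
    have e: "complex_of_real (cmod (w (2 * k) m x) ^ (2 * k)) =
      ((-1) ^ k / complex_of_real (?h ^ (2 * k))) * (iexp (- real k * ?h * x) * (iexp (?h * x) - 1) ^ (2 * k))" for x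
    proof -
      have "complex_of_real (cmod (iexp (?h * x) - 1) ^ 2) = (iexp (?h * x) - 1) * cnj (iexp (?h * x) - 1)"
        by (rule complex_norm_square)
      also have "\<dots> = - (iexp (- ?h * x) * (iexp (?h * x) - 1) ^ 2)"
        by (simp add: exp_cnj power2_eq_square algebra_simps exp_minus field_simps)
      finally have sq: "complex_of_real (cmod (iexp (?h * x) - 1) ^ 2) = - (iexp (- ?h * x) * (iexp (?h * x) - 1) ^ 2)" .
      have "complex_of_real (cmod (w (2 * k) m x) ^ (2 * k)) = complex_of_real (cmod (iexp (?h * x) - 1) ^ 2) ^ k / complex_of_real (?h ^ (2 * k))"
        using hpos[of "2 * k" m] by (simp add: w_def norm_divide norm_mult power_divide power_mult)
      also have "\<dots> = ((-1) ^ k * (iexp (- ?h * x) ^ k * ((iexp (?h * x) - 1) ^ 2) ^ k)) / complex_of_real (?h ^ (2 * k))"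
        unfolding sq by (simp only: power_mult_distrib[symmetric] mult_minus_left mult_1_left)
      also have "iexp (- ?h * x) ^ k = iexp (- real k * ?h * x)"
        by (simp add: exp_of_nat_mult[symmetric] algebra_simps)
      finally show ?thesis by (simp add: power_mult)
    qed
    have "(CLINT x|\<mu>. iexp (- real k * ?h * x) * (iexp (?h * x) - 1) ^ (2 * k)) =
        (CLINT x|\<nu>. iexp (- real k * ?h * x) * (iexp (?h * x) - 1) ^ (2 * k))"
    proof (rule trig_moment_eq[OF \<mu> \<nu> eq])
      have A: "0 \<le> real k * ?h" using hpos[of "2 * k" m] by simp
      have "\<bar>- real k * ?h\<bar> + real (2 * k) * \<bar>?h\<bar> = 3 * (real k * ?h)"
        using hpos[of "2 * k" m] by (simp add: abs_mult)
      moreover have "4 * (real k * ?h) < r" using hsmall[of "2 * k" m] by simp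
      ultimately show "\<bar>- real k * ?h\<bar> + real (2 * k) * \<bar>?h\<bar> < r" using A by linarith
    qed
    then have "(CLINT x|\<mu>. complex_of_real (cmod (w (2 * k) m x) ^ (2 * k))) = (CLINT x|\<nu>. complex_of_real (cmod (w (2 * k) m x) ^ (2 * k)))"
      unfolding e by simp
    then show ?thesis by (simp only: integral_complex_of_real of_real_eq_iff)
  qed
  have even_int: "integrable \<mu> (\<lambda>x. x ^ (2 * k))" for k
  proof -
    have "(\<integral>\<^sup>+x. ennreal (x ^ (2 * k)) \<partial>\<mu>) = (\<integral>\<^sup>+x. liminf (\<lambda>m. ennreal (cmod (w (2 * k) m x) ^ (2 * k))) \<partial>\<mu>)"
    proof (intro nn_integral_cong)
      fix x
      have "(\<lambda>m. cmod (w (2 * k) m x) ^ (2 * k)) \<longlonglongrightarrow> cmod (of_real x) ^ (2 * k)"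
        by (intro tendsto_intros w_lim)
      then have "(\<lambda>m. ennreal (cmod (w (2 * k) m x) ^ (2 * k))) \<longlonglongrightarrow> ennreal (x ^ (2 * k))"
        by (simp add: power_even_abs)
      then show "ennreal (x ^ (2 * k)) = liminf (\<lambda>m. ennreal (cmod (w (2 * k) m x) ^ (2 * k)))"
        by (intro lim_imp_Liminf[symmetric]) auto
    qed
    also have "\<dots> \<le> liminf (\<lambda>m. \<integral>\<^sup>+x. ennreal (cmod (w (2 * k) m x) ^ (2 * k)) \<partial>\<mu>)"
      using w_meas by (intro nn_integral_liminf) simp
    also have "\<dots> \<le> liminf (\<lambda>m. ennreal (\<integral>x. x ^ (2 * k) \<partial>\<nu>))"
    proof (intro Liminf_mono always_eventually allI)
      fix m
      have bnd: "cmod (w (2 * k) m x) ^ (2 * k) \<le> x ^ (2 * k)" for x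
        using power_mono[OF w_le[of "2 * k" m x] norm_ge_zero, of "2 * k"] by (simp add: power_even_abs)
      have "cmod (w (2 * k) m x) \<le> 2 / h (2 * k) m" for x
        using norm_triangle_ineq4[of "iexp (h (2 * k) m * x)" 1] hpos[of "2 * k" m]
        by (simp add: w_def norm_divide norm_mult divide_right_mono)
      then have "cmod (w (2 * k) m x) ^ (2 * k) \<le> (2 / h (2 * k) m) ^ (2 * k)" for x
        by (intro power_mono) auto
      then have "integrable \<mu> (\<lambda>x. cmod (w (2 * k) m x) ^ (2 * k))" and i\<nu>: "integrable \<nu> (\<lambda>x. cmod (w (2 * k) m x) ^ (2 * k))"
        using w_meas
        by (auto intro!: \<mu>.integrable_const_bound[where B = "(2 / h (2 * k) m) ^ (2 * k)"]
          \<nu>.integrable_const_bound[where B = "(2 / h (2 * k) m) ^ (2 * k)"])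
      then have "(\<integral>\<^sup>+x. ennreal (cmod (w (2 * k) m x) ^ (2 * k)) \<partial>\<mu>) = ennreal (\<integral>x. cmod (w (2 * k) m x) ^ (2 * k) \<partial>\<nu>)"
        by (simp add: nn_integral_eq_integral w2_eq)
      also have "\<dots> \<le> ennreal (\<integral>x. x ^ (2 * k) \<partial>\<nu>)"
        by (intro ennreal_leI integral_mono i\<nu> int bnd)
      finally show "(\<integral>\<^sup>+x. ennreal (cmod (w (2 * k) m x) ^ (2 * k)) \<partial>\<mu>) \<le> ennreal (\<integral>x. x ^ (2 * k) \<partial>\<nu>)" .
    qed
    also have "\<dots> < \<infinity>" by (simp add: Liminf_const)
    finally show ?thesis
      by (intro integrableI_bounded) (auto simp: abs_mult power_even_abs)
  qed
  have int\<mu>: "integrable \<mu> (\<lambda>x. x ^ k)" for k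
  proof (rule Bochner_Integration.integrable_bound[of _ "\<lambda>x. 1 + x ^ (2 * k)"])
    show "integrable \<mu> (\<lambda>x. 1 + x ^ (2 * k))" using even_int[of k] by simp
    have "\<bar>x ^ k\<bar> \<le> 1 + x ^ (2 * k)" for x :: real
    proof -
      have "2 * \<bar>x ^ k\<bar> \<le> 1 + \<bar>x ^ k\<bar>\<^sup>2" using sum_squares_bound[of 1 "\<bar>x ^ k\<bar>"] by simp
      moreover have "\<bar>x ^ k\<bar>\<^sup>2 = x ^ (2 * k)" by (simp add: power_mult[symmetric] mult.commute)
      ultimately show ?thesis using abs_ge_zero[of "x ^ k"] by linarith
    qed
    then show "AE x in \<mu>. norm (x ^ k) \<le> norm (1 + x ^ (2 * k))"
      by (intro always_eventually allI) (simp add: abs_le_iff order_trans[OF _ abs_ge_self])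
  qed simp
  \<comment> \<open>With the moments now finite on both sides, dominated convergence replaces
    Fatou's lemma and gives equality instead of a bound.\<close>
  have mom: "(\<integral>x. x ^ n \<partial>\<mu>) = (\<integral>x. x ^ n \<partial>\<nu>)" for n
  proof -
    have lim: "(\<lambda>m. CLINT x|M. w n m x ^ n) \<longlonglongrightarrow> (CLINT x|M. of_real (x ^ n))"
      if M: "real_distribution M" "integrable M (\<lambda>x. x ^ n)" for M
    proof (rule integral_dominated_convergence[where w = "\<lambda>x. \<bar>x\<bar> ^ n"])
      interpret real_distribution M by fact
      show "(\<lambda>x. complex_of_real (x ^ n)) \<in> borel_measurable M" by simp
      show "(\<lambda>x. w n m x ^ n) \<in> borel_measurable M" for m using w_meas by simp
      show "integrable M (\<lambda>x. \<bar>x\<bar> ^ n)" using integrable_abs[OF M(2)] by (simp add: power_abs)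
      show "AE x in M. (\<lambda>m. w n m x ^ n) \<longlonglongrightarrow> complex_of_real (x ^ n)"
        unfolding of_real_power by (intro always_eventually allI tendsto_intros w_lim)
      show "AE x in M. norm (w n m x ^ n) \<le> \<bar>x\<bar> ^ n" for m
        unfolding norm_power by (intro always_eventually allI power_mono w_le) simp
    qed
    have "(CLINT x|\<mu>. of_real (x ^ n)) = (CLINT x|\<nu>. of_real (x ^ n))"
      using LIMSEQ_unique[OF lim[OF \<mu> int\<mu>, unfolded w_eq] lim[OF \<nu> int]] .
    then show ?thesis by (simp only: integral_complex_of_real of_real_eq_iff)
  qed
  have "char \<mu> t = char \<nu> t" for t
  proof -
    \<comment> \<open>Equal moments give both characteristic functions the same Taylor polynomials,
      and the remainders are bounded by the same \<open>e k\<close>, which tends to 0 by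
      \<open>growth\<close>.\<close>
    define S where "S k = (\<Sum>j\<le>2 * k. ((\<i> * t) ^ j / fact j) * complex_of_real (\<integral>x. x ^ j \<partial>\<nu>))" for k
    define e where "e k = 2 * \<bar>t\<bar> ^ (2 * k) / fact (2 * k) * (\<integral>x. x ^ (2 * k) \<partial>\<nu>)" for k
    have "cmod (char \<mu> t - char \<nu> t) \<le> 2 * e k" for k
    proof -
      have 1: "cmod (char \<mu> t - S k) \<le> e k"
        using \<mu>.char_approx1[of "2 * k" t] int\<mu> unfolding S_def e_def mom[symmetric] by (simp add: power_even_abs)
      have 2: "cmod (char \<nu> t - S k) \<le> e k"
        using \<nu>.char_approx1[of "2 * k" t] int unfolding S_def e_def by (simp add: power_even_abs)
      show ?thesis using norm_triangle_ineq4[of "char \<mu> t - S k" "char \<nu> t - S k"] 1 2 by simp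
    qed
    moreover have "(\<lambda>k. 2 * e k) \<longlonglongrightarrow> 2 * 0" unfolding e_def by (intro tendsto_mult_left growth)
    ultimately have "cmod (char \<mu> t - char \<nu> t) \<le> 2 * 0"
      using LIMSEQ_le_const[of "\<lambda>k. 2 * e k" "2 * 0"] by blast
    then show ?thesis by simp
  qed
  then show ?thesis by (intro Levy_uniqueness \<mu> \<nu>) auto
qed

section \<open>Characteristic functions in several dimensions\<close>

definition chf :: "'a::euclidean_space measure \<Rightarrow> 'a \<Rightarrow> complex" where
  "chf \<mu> s = (CLINT x|\<mu>. cis (s \<bullet> x))"

lemma chf_line: "sets \<mu> = sets borel \<Longrightarrow> chf \<mu> (t *\<^sub>R s) = char (distr \<mu> borel (\<lambda>x. s \<bullet> x)) t"
  by (simp add: chf_def char_def integral_distr cis_conv_exp cong: measurable_cong_sets)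

locale distr_space =
  fixes \<mu> :: "'a::euclidean_space measure"
  assumes distribution: "distribution \<mu>"
begin

sublocale prob_space \<mu> using distribution by (simp add: distribution_def)

lemma sets_eq [simp, measurable_cong]: "sets \<mu> = sets borel"
  using distribution by (simp add: distribution_def)

lemma space_eq [simp]: "space \<mu> = UNIV"
  using sets_eq_imp_space_eq[OF sets_eq] by simp

lemma prob_UNIV [simp]: "prob UNIV = 1"
  using prob_space by simp

lemma cis_measurable [measurable]: "(\<lambda>x. cis (s \<bullet> x)) \<in> borel_measurable \<mu>"
  unfolding cis_conv_exp by measurable

lemma integrable_cis: "integrable \<mu> (\<lambda>x. cis (s \<bullet> x))"
  by (rule integrable_const_bound[where B = 1]) auto

lemma chf_0 [simp]: "chf \<mu> 0 = 1"
  by (simp add: chf_def prob_space)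

lemma norm_chf_le: "cmod (chf \<mu> s) \<le> 1"
  unfolding chf_def using integral_norm_bound[of \<mu> "\<lambda>x. cis (s \<bullet> x)"] by (simp add: prob_space)

lemma chf_uminus: "chf \<mu> (- s) = cnj (chf \<mu> s)"
  by (simp add: chf_def cis_cnj[symmetric] del: cis_cnj flip: integral_cnj)

lemma continuous_chf: "continuous_on UNIV (chf \<mu>)"
  unfolding continuous_on_sequentially comp_def chf_def
proof (intro allI ballI impI)
  fix X :: "nat \<Rightarrow> 'a" and s assume X: "(\<forall>n. X n \<in> UNIV) \<and> X \<longlonglongrightarrow> s"
  show "(\<lambda>n. CLINT x|\<mu>. cis (X n \<bullet> x)) \<longlonglongrightarrow> (CLINT x|\<mu>. cis (s \<bullet> x))"
  proof (rule integral_dominated_convergence[where w = "\<lambda>_. 1"])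
    show "AE x in \<mu>. (\<lambda>n. cis (X n \<bullet> x)) \<longlonglongrightarrow> cis (s \<bullet> x)"
      unfolding cis_conv_exp using X by (intro always_eventually allI tendsto_intros) auto
  qed auto
qed

lemma real_distribution_line: "real_distribution (distr \<mu> borel (\<lambda>x. s \<bullet> x))"
  by (rule real_distribution_distr) measurable

text \<open>Modulus 1 is the equality case of the triangle inequality for integrals:
  \<open>cis (w \<bullet> x)\<close> equals its mean almost everywhere and therefore factors out of
  every other integral.\<close>

lemma chf_unimodular:
  assumes "cmod (chf \<mu> w) = 1"
  shows "chf \<mu> (s + w) = chf \<mu> s * chf \<mu> w"
proof -
  define c where "c = chf \<mu> w"
  have c: "cnj c * c = 1" using assms complex_norm_square[of c] by (simp add: c_def mult.commute)
  have int: "integrable \<mu> (\<lambda>x. cnj c * cis (w \<bullet> x))" by (intro integrable_mult_right integrable_cis)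
  have "(CLINT x|\<mu>. cnj c * cis (w \<bullet> x)) = 1"
    using c by (simp add: c_def chf_def)
  then have "(\<integral>x. Re (cnj c * cis (w \<bullet> x)) \<partial>\<mu>) = 1"
    using integral_Re[OF int] by simp
  then have "(\<integral>x. 1 - Re (cnj c * cis (w \<bullet> x)) \<partial>\<mu>) = 0"
    using integrable_Re[OF int] by (simp add: prob_space)
  moreover have le: "Re (cnj c * cis (w \<bullet> x)) \<le> 1" for x
    using complex_Re_le_cmod[of "cnj c * cis (w \<bullet> x)"] assms by (simp add: norm_mult c_def)
  ultimately have "AE x in \<mu>. 1 - Re (cnj c * cis (w \<bullet> x)) = 0"
    using integrable_Re[OF int] by (subst (asm) integral_nonneg_eq_0_iff_AE) auto
  then have "AE x in \<mu>. cis (w \<bullet> x) = c"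
  proof eventually_elim
    fix x assume "1 - Re (cnj c * cis (w \<bullet> x)) = 0"
    then have re: "Re (cnj c * cis (w \<bullet> x)) = 1" by simp
    have "cmod (cnj c * cis (w \<bullet> x)) = 1" using assms by (simp add: norm_mult c_def)
    then have "(Re (cnj c * cis (w \<bullet> x)))\<^sup>2 + (Im (cnj c * cis (w \<bullet> x)))\<^sup>2 = 1"
      by (metis cmod_power2 one_power2)
    then have "Im (cnj c * cis (w \<bullet> x)) = 0" using re by simp
    then have "cnj c * cis (w \<bullet> x) = 1" using re by (simp add: complex_eq_iff)
    then have "c * (cnj c * cis (w \<bullet> x)) = c" by simp
    moreover have "c * (cnj c * cis (w \<bullet> x)) = (cnj c * c) * cis (w \<bullet> x)" by (simp only: mult_ac)
    ultimately show "cis (w \<bullet> x) = c" unfolding c by simp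
  qed
  then have "(CLINT x|\<mu>. cis ((s + w) \<bullet> x)) = (CLINT x|\<mu>. c * cis (s \<bullet> x))"
    by (intro integral_cong_AE) (auto simp: inner_add_left cis_mult[symmetric] elim!: eventually_mono)
  then show ?thesis by (simp add: chf_def c_def mult.commute)
qed

end

text \<open>Levy's uniqueness theorem on the line, applied to the image under \<open>X\<close> of
  the measure with density \<phi>, normalised by its total mass \<open>c\<close>. The hypothesis at
  \<open>t = 0\<close> shows that the mass is the same for both measures. The bound 2 accommodates
  weights of the form \<open>1 + f\<close> with \<open>f\<close> bounded by 1.\<close>

lemma tilted_eq:
  fixes \<mu> \<nu> :: "'a::euclidean_space measure"
  assumes "distribution \<mu>" "distribution \<nu>"
    and X [measurable]: "X \<in> borel_measurable borel" and \<phi>[measurable]: "\<phi> \<in> borel_measurable borel"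
    and b: "\<And>x. 0 \<le> \<phi> x" "\<And>x. \<phi> x \<le> (2::real)"
    and eq: "\<And>t. (CLINT x|\<mu>. iexp (t * X x) * \<phi> x) = (CLINT x|\<nu>. iexp (t * X x) * \<phi> x)"
    and B[measurable]: "B \<in> sets borel"
  shows "(\<integral>x. indicator B (X x) * \<phi> x \<partial>\<mu>) = (\<integral>x. indicator B (X x) * \<phi> x \<partial>\<nu>)"
proof -
  interpret \<mu>: distr_space \<mu> by standard fact
  interpret \<nu>: distr_space \<nu> by standard fact
  have int: "integrable M \<phi>" if "distr_space M" for M
  proof -
    interpret distr_space M by fact
    show ?thesis using b by (intro integrable_const_bound[where B = 2]) auto
  qed
  define c where "c = (\<integral>x. \<phi> x \<partial>\<mu>)"
  have "complex_of_real c = complex_of_real (\<integral>x. \<phi> x \<partial>\<nu>)"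
    using eq[of 0] by (simp add: c_def)
  then have c2: "c = (\<integral>x. \<phi> x \<partial>\<nu>)" by (simp only: of_real_eq_iff)
  have c0: "c \<ge> 0" unfolding c_def using b by simp
  show ?thesis
  proof (cases "c = 0")
    case True
    have "(\<integral>x. indicator B (X x) * \<phi> x \<partial>M) = 0" if M: "distr_space M" "(\<integral>x. \<phi> x \<partial>M) = 0" for M
    proof -
      interpret distr_space M by fact
      have "AE x in M. \<phi> x = 0"
        using integral_nonneg_eq_0_iff_AE[OF int[OF M(1)]] M(2) b(1) by simp
      then have "(\<integral>x. indicator B (X x) * \<phi> x \<partial>M) = (\<integral>x. 0 \<partial>M)"
        by (intro integral_cong_AE) auto
      then show ?thesis by simp
    qed
    then show ?thesis using True c_def c2 \<mu>.distr_space_axioms \<nu>.distr_space_axioms by metis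
  next
    case False
    then have cpos: "c > 0" using c0 by simp
    define D where "D M = distr (density M (\<lambda>x. ennreal (\<phi> x / c))) borel X" for M :: "'a measure"
    have D: "real_distribution (D M)" "char (D M) t = (CLINT x|M. iexp (t * X x) * \<phi> x) / c"
      "measure (D M) B = (\<integral>x. indicator B (X x) * \<phi> x \<partial>M) / c"
      if M: "distr_space M" and cM: "c = (\<integral>x. \<phi> x \<partial>M)" for M t
    proof -
      interpret distr_space M by fact
      have nn: "0 \<le> \<phi> x / c" for x using b cpos by simp
      have "emeasure (density M (\<lambda>x. ennreal (\<phi> x / c))) (space M) = 1"
        using int[OF M] b cpos cM
        by (simp add: emeasure_density nn_integral_eq_integral nn)
      then interpret d: prob_space "density M (\<lambda>x. ennreal (\<phi> x / c))"
        by (intro prob_spaceI) simp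
      show "real_distribution (D M)" unfolding D_def
        by (rule d.real_distribution_distr) measurable
      show "char (D M) t = (CLINT x|M. iexp (t * X x) * \<phi> x) / c"
        unfolding D_def char_def
        by (subst integral_distr, measurable, subst integral_density, measurable)
          (auto simp: nn scaleR_conv_of_real mult.commute simp flip: integral_divide_zero)
      have [measurable]: "X -` B \<in> sets borel" using measurable_sets[OF X B] by simp
      have "emeasure (D M) B = (\<integral>\<^sup>+x. ennreal (\<phi> x / c) * indicator (X -` B) x \<partial>M)"
        unfolding D_def by (simp add: emeasure_distr emeasure_density)
      also have "\<dots> = (\<integral>\<^sup>+x. ennreal (indicator B (X x) * \<phi> x / c) \<partial>M)"
        by (intro nn_integral_cong) (auto simp: indicator_def)
      also have "\<dots> = ennreal ((\<integral>x. indicator B (X x) * \<phi> x / c \<partial>M))"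
      proof (rule nn_integral_eq_integral)
        show "integrable M (\<lambda>x. indicator B (X x) * \<phi> x / c)"
          using b cpos by (intro integrable_const_bound[where B = "2 / c"]) (auto simp: indicator_def field_simps)
        show "AE x in M. 0 \<le> indicator B (X x) * \<phi> x / c" using b cpos by simp
      qed
      finally have "measure (D M) B = (\<integral>x. indicator B (X x) * \<phi> x / c \<partial>M)"
        using b cpos by (simp add: measure_def)
      then show "measure (D M) B = (\<integral>x. indicator B (X x) * \<phi> x \<partial>M) / c" by simp
    qed
    note D\<mu> = D[OF \<mu>.distr_space_axioms c_def] and D\<nu> = D[OF \<nu>.distr_space_axioms c2]
    have "D \<mu> = D \<nu>"
    proof (rule Levy_uniqueness[OF D\<mu>(1) D\<nu>(1)], rule ext)
      show "char (D \<mu>) t = char (D \<nu>) t" for t unfolding D\<mu>(2) D\<nu>(2) eq ..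
    qed
    then show ?thesis using D\<mu>(3) D\<nu>(3) cpos by simp
  qed
qed

text \<open>Factors \<open>cis (s \<bullet> x)\<close> are traded for indicators one coordinate at a time; the complex
  weight collected so far is made nonnegative by adding \<open>1\<close> to its real or imaginary part.\<close>

theorem chf_uniqueness:
  fixes \<mu> \<nu> :: "'a::euclidean_space measure"
  assumes \<mu>: "distribution \<mu>" and \<nu>: "distribution \<nu>" and eq: "\<And>s. chf \<mu> s = chf \<nu> s"
  shows "\<mu> = \<nu>"
proof -
  interpret \<mu>: distr_space \<mu> by standard fact
  interpret \<nu>: distr_space \<nu> by standard fact
  \<comment> \<open>Interpolates between the characteristic function (\<open>I\<close> empty) and
    the indicator of a box (\<open>I = Basis\<close> and \<open>s = 0\<close>).\<close>
  define \<Phi> where "\<Phi> I B s x = (\<Prod>b\<in>I. indicator (B b) (x \<bullet> b)) * cis (s \<bullet> x)"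
    for I and B :: "'a \<Rightarrow> real set" and s x :: 'a
  have P01: "\<forall>B x. (\<Prod>b\<in>I. indicator (B b) (x \<bullet> b)) \<in> {0, 1::complex}" for I :: "'a set"
    by (induction I rule: infinite_finite_induct) (auto simp: indicator_def)
  have norm\<Phi>: "cmod (\<Phi> I B s x) \<le> 1" for I B s x
    using P01[rule_format, of B x I] by (auto simp: \<Phi>_def norm_mult)
  have meas: "\<Phi> I B s \<in> borel_measurable borel" if "\<And>b. B b \<in> sets borel" for I B s
  proof -
    have [measurable]: "B b \<in> sets borel" for b by fact
    show ?thesis unfolding \<Phi>_def cis_conv_exp by measurable
  qed
  have cnj\<Phi>: "cnj (\<Phi> I B s x) = \<Phi> I B (- s) x" for I B s x
  proof -
    define P where "P = (\<Prod>b\<in>I. indicator (B b) (x \<bullet> b) :: complex)"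
    have "P = 0 \<or> P = 1" using P01[rule_format, of B x I] by (simp add: P_def)
    then have "cnj (P * cis (s \<bullet> x)) = P * cis (- s \<bullet> x)" by (auto simp: cis_cnj)
    then show ?thesis by (simp only: \<Phi>_def P_def)
  qed
  have shift: "iexp (t * (x \<bullet> b)) * \<Phi> I B s x = \<Phi> I B (s + t *\<^sub>R b) x" for t b I B s x
  proof -
    have "cis ((s + t *\<^sub>R b) \<bullet> x) = cis (s \<bullet> x) * cis (t * (b \<bullet> x))"
      by (simp add: inner_add_left cis_mult)
    moreover have "iexp (t * (x \<bullet> b)) = cis (t * (b \<bullet> x))"
      by (simp add: cis_conv_exp inner_commute)
    ultimately show ?thesis by (simp only: \<Phi>_def mult_ac)
  qed
  have main: "(CLINT x|\<mu>. \<Phi> I B s x) = (CLINT x|\<nu>. \<Phi> I B s x)"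
    if "finite I" and B: "\<And>b. B b \<in> sets borel" for I B s
    using that(1)
  proof (induction I arbitrary: s rule: finite_induct)
    case empty
    then show ?case using eq[of s] by (simp add: \<Phi>_def chf_def)
  next
    case (insert b I)
    have [measurable]: "B b \<in> sets borel" for b by fact
    note [measurable] = meas[OF B]
    have int: "integrable M (\<lambda>x. \<Phi> I B s x)" if "distr_space M" for M s
    proof -
      interpret distr_space M by fact
      show ?thesis using norm\<Phi> by (intro integrable_const_bound[where B = 1]) auto
    qed
    have int': "integrable M (\<lambda>x. indicator (B b) (x \<bullet> b) * f x)"
      if "distr_space M" and [measurable]: "f \<in> borel_measurable borel" and "\<And>x. \<bar>f x\<bar> \<le> 2" for M and f :: "'a \<Rightarrow> real"
    proof -
      interpret distr_space M by fact
      show ?thesis using that(3) by (intro integrable_const_bound[where B = 2]) (auto simp: indicator_def)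
    qed
    have cl: "(\<integral>x. indicator (B b) (x \<bullet> b) * f x \<partial>\<mu>) = (\<integral>x. indicator (B b) (x \<bullet> b) * f x \<partial>\<nu>)"
      if f[measurable]: "f \<in> borel_measurable borel" and f1: "\<And>x. \<bar>f x\<bar> \<le> 1"
        and fe: "\<And>t. (CLINT x|\<mu>. iexp (t * (x \<bullet> b)) * f x) = (CLINT x|\<nu>. iexp (t * (x \<bullet> b)) * f x)" for f :: "'a \<Rightarrow> real"
    proof -
      have one: "(CLINT x|\<mu>. iexp (t * (x \<bullet> b))) = (CLINT x|\<nu>. iexp (t * (x \<bullet> b)))" for t
        using eq[of "t *\<^sub>R b"] by (simp add: chf_def cis_conv_exp inner_commute)
      have i1: "integrable M (\<lambda>x. iexp (t * (x \<bullet> b)) * f x)" "integrable M (\<lambda>x. iexp (t * (x \<bullet> b)))"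
        if "distr_space M" for M t
      proof -
        interpret distr_space M by fact
        show "integrable M (\<lambda>x. iexp (t * (x \<bullet> b)) * f x)" "integrable M (\<lambda>x. iexp (t * (x \<bullet> b)))"
          using f1 by (auto intro!: integrable_const_bound[where B = 1] simp: norm_mult)
      qed
      have "(CLINT x|\<mu>. iexp (t * (x \<bullet> b)) * (1 + f x)) = (CLINT x|\<nu>. iexp (t * (x \<bullet> b)) * (1 + f x))" for t
        using i1[OF \<mu>.distr_space_axioms, of t] i1[OF \<nu>.distr_space_axioms, of t] one fe
        by (simp add: distrib_left)
      moreover have "0 \<le> 1 + f x" "1 + f x \<le> 2" for x using f1[of x] by linarith+
      ultimately have A: "(\<integral>x. indicator (B b) (x \<bullet> b) * (1 + f x) \<partial>\<mu>) = (\<integral>x. indicator (B b) (x \<bullet> b) * (1 + f x) \<partial>\<nu>)"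
        by (intro tilted_eq[OF \<mu> \<nu>]) auto
      have "(\<integral>x. indicator (B b) (x \<bullet> b) * (1::real) \<partial>\<mu>) = (\<integral>x. indicator (B b) (x \<bullet> b) * (1::real) \<partial>\<nu>)"
        by (rule tilted_eq[OF \<mu> \<nu>, where X = "\<lambda>x. x \<bullet> b" and \<phi> = "\<lambda>_. 1"]) (use one in simp_all)
      moreover have "integrable M (\<lambda>x. indicator (B b) (x \<bullet> b) * f x)"
        "integrable M (\<lambda>x. indicator (B b) (x \<bullet> b) * (1::real))" if "distr_space M" for M
      proof -
        have "\<bar>f x\<bar> \<le> 2" for x using f1[of x] by linarith
        then show "integrable M (\<lambda>x. indicator (B b) (x \<bullet> b) * f x)" by (rule int'[OF that f])
        show "integrable M (\<lambda>x. indicator (B b) (x \<bullet> b) * (1::real))" by (rule int'[OF that]) auto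
      qed
      ultimately show ?thesis
        using A \<mu>.distr_space_axioms \<nu>.distr_space_axioms by (simp add: distrib_left)
    qed
    have sh: "(CLINT x|\<mu>. iexp (t * (x \<bullet> b)) * \<Phi> I B s x) = (CLINT x|\<nu>. iexp (t * (x \<bullet> b)) * \<Phi> I B s x)" for t s
      unfolding shift by (rule insert.IH)
    have ish: "integrable M (\<lambda>x. iexp (t * (x \<bullet> b)) * \<Phi> I B s x)" if "distr_space M" for M t s
      unfolding shift by (rule int[OF that])
    \<comment> \<open>Conjugation replaces \<open>s\<close> by \<open>- s\<close>, so the induction
      hypothesis at both frequencies covers the real and the imaginary part of the weight.\<close>
    have Re: "(\<integral>x. indicator (B b) (x \<bullet> b) * Re (\<Phi> I B s x) \<partial>\<mu>) = (\<integral>x. indicator (B b) (x \<bullet> b) * Re (\<Phi> I B s x) \<partial>\<nu>)"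
    proof (rule cl)
      fix t
      have e: "iexp (t * (x \<bullet> b)) * complex_of_real (Re (\<Phi> I B s x)) =
        (iexp (t * (x \<bullet> b)) * \<Phi> I B s x + iexp (t * (x \<bullet> b)) * \<Phi> I B (- s) x) / 2" for x
        unfolding cnj\<Phi>[symmetric] by (simp add: complex_add_cnj distrib_left[symmetric])
      show "(CLINT x|\<mu>. iexp (t * (x \<bullet> b)) * complex_of_real (Re (\<Phi> I B s x))) = (CLINT x|\<nu>. iexp (t * (x \<bullet> b)) * complex_of_real (Re (\<Phi> I B s x)))"
        unfolding e using ish[OF \<mu>.distr_space_axioms] ish[OF \<nu>.distr_space_axioms] sh by simp
      show "\<bar>Re (\<Phi> I B s x)\<bar> \<le> 1" for x using abs_Re_le_cmod[of "\<Phi> I B s x"] norm\<Phi>[of I B s x] by linarith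
    qed measurable
    have Im: "(\<integral>x. indicator (B b) (x \<bullet> b) * Im (\<Phi> I B s x) \<partial>\<mu>) = (\<integral>x. indicator (B b) (x \<bullet> b) * Im (\<Phi> I B s x) \<partial>\<nu>)"
    proof (rule cl)
      fix t
      have e: "iexp (t * (x \<bullet> b)) * complex_of_real (Im (\<Phi> I B s x)) =
        (iexp (t * (x \<bullet> b)) * \<Phi> I B s x - iexp (t * (x \<bullet> b)) * \<Phi> I B (- s) x) / (2 * \<i>)" for x
      proof -
        have "w * \<i> / (2 * \<i>) = w / 2" for w :: complex
          by (metis mult_divide_mult_cancel_right complex_i_not_zero)
        then have "complex_of_real (Im z) = (z - cnj z) / (2 * \<i>)" for z
          unfolding complex_diff_cnj by simp
        then show ?thesis unfolding cnj\<Phi>[symmetric]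
          by (simp only: right_diff_distrib[symmetric] times_divide_eq_right)
      qed
      show "(CLINT x|\<mu>. iexp (t * (x \<bullet> b)) * complex_of_real (Im (\<Phi> I B s x))) = (CLINT x|\<nu>. iexp (t * (x \<bullet> b)) * complex_of_real (Im (\<Phi> I B s x)))"
        unfolding e using ish[OF \<mu>.distr_space_axioms] ish[OF \<nu>.distr_space_axioms] sh by simp
      show "\<bar>Im (\<Phi> I B s x)\<bar> \<le> 1" for x using abs_Im_le_cmod[of "\<Phi> I B s x"] norm\<Phi>[of I B s x] by linarith
    qed measurable
    have e: "\<Phi> (insert b I) B s x = complex_of_real (indicator (B b) (x \<bullet> b) * Re (\<Phi> I B s x)) +
      \<i> * complex_of_real (indicator (B b) (x \<bullet> b) * Im (\<Phi> I B s x))" for x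
    proof -
      have "\<Phi> (insert b I) B s x = indicator (B b) (x \<bullet> b) * \<Phi> I B s x"
        using insert.hyps by (simp add: \<Phi>_def mult.assoc)
      then show ?thesis by (simp add: indicator_def complex_eq_iff)
    qed
    have bd: "\<bar>Re (\<Phi> I B s x)\<bar> \<le> 2" "\<bar>Im (\<Phi> I B s x)\<bar> \<le> 2" for x
      using abs_Re_le_cmod[of "\<Phi> I B s x"] abs_Im_le_cmod[of "\<Phi> I B s x"] norm\<Phi>[of I B s x] by linarith+
    have "(CLINT x|M. \<Phi> (insert b I) B s x) = complex_of_real (\<integral>x. indicator (B b) (x \<bullet> b) * Re (\<Phi> I B s x) \<partial>M) +
      \<i> * complex_of_real (\<integral>x. indicator (B b) (x \<bullet> b) * Im (\<Phi> I B s x) \<partial>M)" if M: "distr_space M" for M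
    proof -
      have 1: "integrable M (\<lambda>x. indicator (B b) (x \<bullet> b) * Re (\<Phi> I B s x))" by (rule int'[OF M _ bd(1)]) measurable
      have 2: "integrable M (\<lambda>x. indicator (B b) (x \<bullet> b) * Im (\<Phi> I B s x))" by (rule int'[OF M _ bd(2)]) measurable
      show ?thesis unfolding e
        by (subst Bochner_Integration.integral_add, rule integrable_of_real[OF 1],
            rule integrable_mult_right[OF integrable_of_real[OF 2]])
          (simp only: integral_mult_right_zero integral_complex_of_real)
    qed
    from this[OF \<mu>.distr_space_axioms] this[OF \<nu>.distr_space_axioms] show ?case by (simp add: Re Im)
  qed
  have box: "measure \<mu> (box c d) = measure \<nu> (box c d)" for c d :: 'a
  proof -
    define B where "B b = {c \<bullet> b<..<d \<bullet> b}" for b :: 'a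
    have e: "\<Phi> Basis B 0 x = complex_of_real (indicator (box c d) x)" for x
    proof -
      have "(\<Prod>b\<in>Basis. indicator (B b) (x \<bullet> b)) = (indicator (box c d) x :: complex)"
        by (auto simp: indicator_def B_def mem_box prod.neutral prod_zero_iff)
      then show ?thesis by (simp add: \<Phi>_def indicator_def)
    qed
    have "(CLINT x|\<mu>. \<Phi> Basis B 0 x) = (CLINT x|\<nu>. \<Phi> Basis B 0 x)"
      by (rule main) (auto simp: B_def)
    then have "(\<integral>x. indicat_real (box c d) x \<partial>\<mu>) = (\<integral>x. indicat_real (box c d) x \<partial>\<nu>)"
      unfolding e by (simp only: integral_complex_of_real of_real_eq_iff)
    then show ?thesis by simp
  qed
  show "\<mu> = \<nu>"
  proof (rule measure_eqI_generator_eq[where E = "range (\<lambda>(a, b). box a b)" and \<Omega> = UNIV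
      and A = "\<lambda>n. box (- real n *\<^sub>R One) (real n *\<^sub>R One)"])
    show "Int_stable (range (\<lambda>(a, b). box a b :: 'a set))"
      by (auto simp: Int_stable_def box_Int_box)
    show "(\<Union>n. box (- real n *\<^sub>R One) (real n *\<^sub>R One)) = (UNIV :: 'a set)"
    proof safe
      fix x :: 'a
      obtain n where n: "norm x < real n" using reals_Archimedean2 by blast
      have "\<bar>x \<bullet> i\<bar> < real n" if "i \<in> Basis" for i using Basis_le_norm[OF that, of x] n by linarith
      then have "x \<in> box (- real n *\<^sub>R One) (real n *\<^sub>R One)"
        by (auto simp: mem_box abs_less_iff minus_less_iff)
      then show "x \<in> (\<Union>n. box (- real n *\<^sub>R One) (real n *\<^sub>R One))" by blast
    qed simp
    show "sets \<mu> = sigma_sets UNIV (range (\<lambda>(a, b). box a b))"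
      "sets \<nu> = sigma_sets UNIV (range (\<lambda>(a, b). box a b))"
      by (simp_all add: borel_eq_box)
    show "emeasure \<mu> X = emeasure \<nu> X" if "X \<in> range (\<lambda>(a, b). box a b)" for X
      using that box by (auto simp: \<mu>.emeasure_eq_measure \<nu>.emeasure_eq_measure)
  qed auto
qed

section \<open>Distributions that are locally Gaussian on lines\<close>

text \<open>An affine image of the standard normal law instead of a density, so that the point mass
  \<open>\<sigma> = 0\<close> is included.\<close>

abbreviation normal1 :: "real \<Rightarrow> real \<Rightarrow> real measure" where
  "normal1 m \<sigma> \<equiv> distr std_normal_distribution borel (\<lambda>x. m + \<sigma> * x)"

lemma real_distribution_normal1: "real_distribution (normal1 m \<sigma>)"
proof -
  interpret real_distribution std_normal_distribution by (rule real_dist_normal_dist)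
  show ?thesis by (rule real_distribution_distr) measurable
qed

lemma char_normal1: "char (normal1 m \<sigma>) t = exp (- of_real (\<sigma>\<^sup>2 * t\<^sup>2 / 2) + \<i> * of_real (m * t))"
proof -
  interpret real_distribution std_normal_distribution by (rule real_dist_normal_dist)
  have "char (normal1 m \<sigma>) t = (CLINT x|std_normal_distribution. iexp (t * (m + \<sigma> * x)))"
    unfolding char_def by (subst integral_distr) auto
  also have "\<dots> = (CLINT x|std_normal_distribution. iexp (t * m) * iexp ((t * \<sigma>) * x))"
    by (intro Bochner_Integration.integral_cong) (simp_all add: exp_add[symmetric] algebra_simps)
  also have "\<dots> = iexp (t * m) * char std_normal_distribution (t * \<sigma>)" by (simp add: char_def)
  also have "\<dots> = exp (\<i> * of_real (t * m) + of_real (- ((t * \<sigma>)\<^sup>2) / 2))"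
    by (simp only: char_std_normal_distribution exp_add exp_of_real)
  finally show ?thesis by (simp add: power_mult_distrib mult_ac)
qed

lemma integrable_affine_moment: "integrable std_normal_distribution (\<lambda>x. (m + \<sigma> * x) ^ k)"
  unfolding binomial_ring power_mult_distrib
  by (intro Bochner_Integration.integrable_sum integrable_mult_right integrable_mult_left
      integrable_std_normal_distribution_moment)

lemma integrable_normal1: "integrable (normal1 m \<sigma>) (\<lambda>x. x ^ k)"
  using integrable_affine_moment by (subst integrable_distr_eq) auto

lemma even_power_sum_le: "(x + y) ^ (2 * k) \<le> 2 ^ (2 * k) * (x ^ (2 * k) + y ^ (2 * k))" for x y :: real
proof -
  define m where "m = max \<bar>x\<bar> \<bar>y\<bar>"
  have "(x + y) ^ (2 * k) = \<bar>x + y\<bar> ^ (2 * k)" by (simp add: power_even_abs)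
  also have "\<dots> \<le> (2 * m) ^ (2 * k)" by (intro power_mono) (auto simp: m_def)
  also have "\<dots> = 2 ^ (2 * k) * m ^ (2 * k)" by (simp add: power_mult_distrib)
  also have "m ^ (2 * k) \<le> \<bar>x\<bar> ^ (2 * k) + \<bar>y\<bar> ^ (2 * k)"
    by (cases "\<bar>x\<bar> \<le> \<bar>y\<bar>") (auto simp: m_def max_def)
  finally show ?thesis by (simp add: power_even_abs)
qed

text \<open>The standard normal moment of order \<open>2 k\<close> is the factorial of
  \<open>2 k\<close> divided by \<open>2 ^ k * fact k\<close>. Its numerator cancels the factorial
  in the remainder, and both the contribution of the mean and that of the deviation become general
  terms of exponential series.\<close>

lemma moment_growth_normal1:
  "(\<lambda>k. 2 * \<bar>t\<bar> ^ (2 * k) / fact (2 * k) * (\<integral>x. x ^ (2 * k) \<partial>normal1 m \<sigma>)) \<longlonglongrightarrow> 0"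
proof -
  interpret real_distribution std_normal_distribution by (rule real_dist_normal_dist)
  define B where "B k = 2 * ((2 * t * m) ^ (2 * k) / fact (2 * k)) + 2 * (((2 * t * \<sigma>)\<^sup>2 / 2) ^ k / fact k)" for k
  have z: "(\<lambda>k. x ^ k / fact k) \<longlonglongrightarrow> 0" for x :: real
    using summable_LIMSEQ_zero[OF summable_exp[of x]] by (simp add: field_simps)
  have "(\<lambda>k. (2 * t * m) ^ (2 * k) / fact (2 * k)) \<longlonglongrightarrow> 0"
    using LIMSEQ_subseq_LIMSEQ[OF z[of "2 * t * m"], of "\<lambda>k. 2 * k"] by (simp add: o_def strict_mono_def)
  then have "B \<longlonglongrightarrow> 2 * 0 + 2 * 0" unfolding B_def by (intro tendsto_intros z)
  then have B0: "B \<longlonglongrightarrow> 0" by simp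
  have hi: "\<forall>\<^sub>F k in sequentially. 2 * \<bar>t\<bar> ^ (2 * k) / fact (2 * k) * (\<integral>x. x ^ (2 * k) \<partial>normal1 m \<sigma>) \<le> B k"
  proof (intro always_eventually allI)
    fix k
    have "(\<integral>x. x ^ (2 * k) \<partial>normal1 m \<sigma>) = (\<integral>x. (m + \<sigma> * x) ^ (2 * k) \<partial>std_normal_distribution)"
      by (subst integral_distr) auto
    also have "\<dots> \<le> (\<integral>x. 2 ^ (2 * k) * (m ^ (2 * k) + \<sigma> ^ (2 * k) * x ^ (2 * k)) \<partial>std_normal_distribution)"
      using integrable_std_normal_distribution_moment[of "2 * k"]
      by (intro integral_mono integrable_affine_moment)
        (auto simp: even_power_sum_le[where y = "\<sigma> * _", unfolded power_mult_distrib])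
    also have "\<dots> = 2 ^ (2 * k) * (m ^ (2 * k) + \<sigma> ^ (2 * k) * (fact (2 * k) / (2 ^ k * fact k)))"
      using integrable_std_normal_distribution_moment[of "2 * k"] prob_space
      by (simp add: std_normal_distribution_even_moments)
    finally have le: "(\<integral>x. x ^ (2 * k) \<partial>normal1 m \<sigma>) \<le> 2 ^ (2 * k) * (m ^ (2 * k) + \<sigma> ^ (2 * k) * (fact (2 * k) / (2 ^ k * fact k)))" .
    have "2 * \<bar>t\<bar> ^ (2 * k) / fact (2 * k) * (\<integral>x. x ^ (2 * k) \<partial>normal1 m \<sigma>) \<le>
        2 * \<bar>t\<bar> ^ (2 * k) / fact (2 * k) * (2 ^ (2 * k) * (m ^ (2 * k) + \<sigma> ^ (2 * k) * (fact (2 * k) / (2 ^ k * fact k))))"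
      by (intro mult_left_mono le) auto
    also have "\<dots> = B k"
    proof -
      define f where "f = (fact (2 * k) :: real)"
      have f: "f \<noteq> 0" by (simp add: f_def)
      have "2 * T / f * (P * (Q + S * (f / (R * G)))) = 2 * ((P * T * Q) / f) + 2 * ((P * T * S / R) / G)"
        for T P Q S R G :: real using f by (simp add: field_simps)
      moreover have "(2 * t * m) ^ (2 * k) = 2 ^ (2 * k) * t ^ (2 * k) * m ^ (2 * k)"
        by (simp only: power_mult_distrib)
      moreover have "((2 * t * \<sigma>)\<^sup>2 / 2) ^ k = 2 ^ (2 * k) * t ^ (2 * k) * \<sigma> ^ (2 * k) / 2 ^ k"
        by (simp only: power_divide power_mult[symmetric] power_mult_distrib)
      moreover have "\<bar>t\<bar> ^ (2 * k) = t ^ (2 * k)" by (simp add: power_even_abs)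
      ultimately show ?thesis unfolding B_def f_def[symmetric] by (simp only:)
    qed
    finally show "2 * \<bar>t\<bar> ^ (2 * k) / fact (2 * k) * (\<integral>x. x ^ (2 * k) \<partial>normal1 m \<sigma>) \<le> B k" .
  qed
  have lo: "\<forall>\<^sub>F k in sequentially. 0 \<le> 2 * \<bar>t\<bar> ^ (2 * k) / fact (2 * k) * (\<integral>x. x ^ (2 * k) \<partial>normal1 m \<sigma>)"
    by (intro always_eventually allI mult_nonneg_nonneg integral_nonneg) auto
  show ?thesis by (rule tendsto_sandwich[OF lo hi tendsto_const B0])
qed

lemma mean_variance_normal1:
  "(\<integral>x. x \<partial>normal1 m \<sigma>) = m" "(\<integral>x. (x - m)\<^sup>2 \<partial>normal1 m \<sigma>) = \<sigma>\<^sup>2"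
proof -
  interpret real_distribution std_normal_distribution by (rule real_dist_normal_dist)
  have 1: "integrable std_normal_distribution (\<lambda>x. x)"
    using integrable_std_normal_distribution_moment[of 1] by simp
  have "(\<integral>x. x \<partial>normal1 m \<sigma>) = (\<integral>x. m + \<sigma> * x \<partial>std_normal_distribution)" by (subst integral_distr) auto
  then show "(\<integral>x. x \<partial>normal1 m \<sigma>) = m"
    using 1 integral_std_normal_distribution_moment_odd[of 1] prob_space by simp
  have "(\<integral>x. (x - m)\<^sup>2 \<partial>normal1 m \<sigma>) = (\<integral>x. \<sigma>\<^sup>2 * x ^ (2 * 1) \<partial>std_normal_distribution)"
    by (subst integral_distr) (auto simp: power_mult_distrib)
  then show "(\<integral>x. (x - m)\<^sup>2 \<partial>normal1 m \<sigma>) = \<sigma>\<^sup>2"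
    unfolding integral_mult_right_zero std_normal_distribution_even_moments by simp
qed

text \<open>Radius and coefficients may depend on the line; this is what the functional equation
  delivers. Consistency between lines is recovered from the moments in
  \<open>line_gauss_gaussian\<close>.\<close>

definition line_gauss :: "'a::euclidean_space measure \<Rightarrow> bool" where
  "line_gauss \<mu> \<longleftrightarrow> (\<forall>s. \<exists>m q r. 0 < r \<and> 0 \<le> q \<and>
     (\<forall>t. \<bar>t\<bar> < r \<longrightarrow> chf \<mu> (t *\<^sub>R s) = exp (- of_real (q * t\<^sup>2) + \<i> * of_real (m * t))))"

lemma line_gauss_normal1:
  assumes "distribution \<mu>" "line_gauss \<mu>"
  obtains m \<sigma> where "distr \<mu> borel (\<lambda>x. s \<bullet> x) = normal1 m \<sigma>"
proof -
  interpret distr_space \<mu> by standard fact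
  obtain m q r where r: "0 < r" "0 \<le> q"
    "\<And>t. \<bar>t\<bar> < r \<Longrightarrow> chf \<mu> (t *\<^sub>R s) = exp (- of_real (q * t\<^sup>2) + \<i> * of_real (m * t))"
    using assms(2) unfolding line_gauss_def by metis
  \<comment> \<open>The standard deviation is \<open>sqrt (2 * q)\<close> because the exponent
    \<open>q * t\<^sup>2\<close> carries no factor 1/2.\<close>
  have "distr \<mu> borel (\<lambda>x. s \<bullet> x) = normal1 m (sqrt (2 * q))"
  proof (rule char_local_determines[OF real_distribution_line real_distribution_normal1
        integrable_normal1 moment_growth_normal1 r(1)])
    fix t assume "\<bar>t\<bar> < r"
    then show "char (distr \<mu> borel (\<lambda>x. s \<bullet> x)) t = char (normal1 m (sqrt (2 * q))) t"
      unfolding char_normal1 chf_line[OF sets_eq, symmetric] using r by simp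
  qed
  then show ?thesis using that by blast
qed

text \<open>Agreement near 0 propagates because each one-dimensional projection of \<mu> is normal,
  hence determined by its characteristic function near 0. The projections in turn determine the
  whole law.\<close>

lemma line_gauss_determined:
  fixes \<mu> \<nu> :: "'a::euclidean_space measure"
  assumes \<mu>: "distribution \<mu>" "line_gauss \<mu>" and \<nu>: "distribution \<nu>"
    and r: "r > 0" and eq: "\<And>s. norm s < r \<Longrightarrow> chf \<nu> s = chf \<mu> s"
  shows "\<nu> = \<mu>"
proof (rule chf_uniqueness[OF \<nu> \<mu>(1)])
  fix s :: 'a
  interpret \<mu>: distr_space \<mu> by standard fact
  interpret \<nu>: distr_space \<nu> by standard fact
  obtain m \<sigma> where n: "distr \<mu> borel (\<lambda>x. s \<bullet> x) = normal1 m \<sigma>" using line_gauss_normal1[OF \<mu>] .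
  have "distr \<nu> borel (\<lambda>x. s \<bullet> x) = normal1 m \<sigma>"
  proof (rule char_local_determines[OF \<nu>.real_distribution_line real_distribution_normal1
        integrable_normal1 moment_growth_normal1])
    \<comment> \<open>The summand 1 keeps the radius meaningful for \<open>s = 0\<close>.\<close>
    show "0 < r / (norm s + 1)" using r by (simp add: add_nonneg_pos)
    fix t assume "\<bar>t\<bar> < r / (norm s + 1)"
    then have "\<bar>t\<bar> * (norm s + 1) < r" by (simp add: pos_less_divide_eq add_nonneg_pos)
    moreover have "\<bar>t\<bar> * norm s \<le> \<bar>t\<bar> * (norm s + 1)" by (intro mult_left_mono) auto
    ultimately have "norm (t *\<^sub>R s) < r" by simp
    then show "char (distr \<nu> borel (\<lambda>x. s \<bullet> x)) t = char (normal1 m \<sigma>) t"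
      unfolding n[symmetric] chf_line[OF \<mu>.sets_eq, symmetric] chf_line[OF \<nu>.sets_eq, symmetric] by (rule eq)
  qed
  then show "chf \<nu> s = chf \<mu> s"
    using chf_line[OF \<mu>.sets_eq, of 1 s] chf_line[OF \<nu>.sets_eq, of 1 s] n by simp
qed

text \<open>The mean vector and half the covariance matrix are the only candidates for the global
  parameters. On each line they reproduce the mean and the variance of the normal projection, and
  these two numbers determine it.\<close>

lemma line_gauss_gaussian:
  fixes \<mu> :: "(real^'n) measure"
  assumes \<mu>: "distribution \<mu>" and lg: "line_gauss \<mu>"
  shows "gaussian \<mu>"
proof -
  interpret distr_space \<mu> by standard fact
  define t where "t = (\<chi> i. \<integral>x. x $ i \<partial>\<mu>)"
  define A where "A = (\<chi> i j. (\<integral>x. (x $ i - t $ i) * (x $ j - t $ j) \<partial>\<mu>) / 2)"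
  have int1: "integrable \<mu> (\<lambda>x. s \<bullet> x)" and int2: "integrable \<mu> (\<lambda>x. (s \<bullet> x)\<^sup>2)" for s
  proof -
    obtain m \<sigma> where n: "distr \<mu> borel (\<lambda>x. s \<bullet> x) = normal1 m \<sigma>" using line_gauss_normal1[OF \<mu> lg] .
    have i: "integrable (distr \<mu> borel (\<lambda>x. s \<bullet> x)) (\<lambda>y. y ^ k)" for k unfolding n by (rule integrable_normal1)
    show "integrable \<mu> (\<lambda>x. s \<bullet> x)" using i[of 1] by (subst (asm) integrable_distr_eq) auto
    show "integrable \<mu> (\<lambda>x. (s \<bullet> x)\<^sup>2)" using i[of 2] by (subst (asm) integrable_distr_eq) auto
  qed
  have inti: "integrable \<mu> (\<lambda>x. x $ i)" for i using int1[of "axis i 1"] by (simp add: inner_axis')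
  have sq: "integrable \<mu> (\<lambda>x. (s \<bullet> (x - t))\<^sup>2)" for s
    unfolding inner_diff_right power2_diff
    by (intro Bochner_Integration.integrable_add Bochner_Integration.integrable_diff int2
        integrable_mult_left integrable_mult_right int1 integrable_const)
  have intij: "integrable \<mu> (\<lambda>x. (x $ i - t $ i) * (x $ j - t $ j))" for i j
  proof -
    \<comment> \<open>Polarisation: mixed second moments are integrable because squares of linear
      forms are.\<close>
    have "integrable \<mu> (\<lambda>x. ((axis i 1 + axis j 1) \<bullet> (x - t))\<^sup>2 - (axis i 1 \<bullet> (x - t))\<^sup>2 - (axis j 1 \<bullet> (x - t))\<^sup>2)"
      by (intro Bochner_Integration.integrable_diff sq)
    from integrable_mult_left[OF this, of "1 / 2"] show ?thesis
      by (simp add: inner_axis' inner_add_left power2_eq_square algebra_simps)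
  qed
  have mean: "(\<integral>x. s \<bullet> x \<partial>\<mu>) = t \<bullet> s" for s
    using inti by (simp add: inner_vec_def t_def mult.commute)
  have var: "(\<integral>x. (s \<bullet> x - t \<bullet> s)\<^sup>2 \<partial>\<mu>) = 2 * ((A *v s) \<bullet> s)" for s
  proof -
    have "(s \<bullet> x - t \<bullet> s)\<^sup>2 = (\<Sum>i\<in>UNIV. \<Sum>j\<in>UNIV. s $ i * s $ j * ((x $ i - t $ i) * (x $ j - t $ j)))" for x
    proof -
      have "s \<bullet> x - t \<bullet> s = (\<Sum>i\<in>UNIV. s $ i * (x $ i - t $ i))"
        by (simp add: inner_vec_def sum_subtractf right_diff_distrib mult.commute)
      then show ?thesis by (simp add: power2_eq_square sum_product mult_ac)
    qed
    then have "(\<integral>x. (s \<bullet> x - t \<bullet> s)\<^sup>2 \<partial>\<mu>) =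
      (\<Sum>i\<in>UNIV. \<Sum>j\<in>UNIV. s $ i * s $ j * (\<integral>x. (x $ i - t $ i) * (x $ j - t $ j) \<partial>\<mu>))"
      using intij by (simp add: Bochner_Integration.integral_sum)
    also have "\<dots> = 2 * ((A *v s) \<bullet> s)"
      by (simp add: inner_vec_def matrix_vector_mult_def A_def sum_distrib_left sum_distrib_right mult_ac)
    finally show ?thesis .
  qed
  have chf: "chf \<mu> s = exp (- complex_of_real ((A *v s) \<bullet> s) + \<i> * complex_of_real (t \<bullet> s))" for s
  proof -
    obtain m \<sigma> where n: "distr \<mu> borel (\<lambda>x. s \<bullet> x) = normal1 m \<sigma>" using line_gauss_normal1[OF \<mu> lg] .
    have m: "m = t \<bullet> s"
      using mean_variance_normal1(1)[of m \<sigma>] mean[of s] unfolding n[symmetric] by (simp add: integral_distr)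
    have "\<sigma>\<^sup>2 = 2 * ((A *v s) \<bullet> s)"
      using mean_variance_normal1(2)[of m \<sigma>] var[of s] unfolding n[symmetric] unfolding m by (simp add: integral_distr)
    then have "char (normal1 m \<sigma>) 1 = exp (- complex_of_real ((A *v s) \<bullet> s) + \<i> * complex_of_real (t \<bullet> s))"
      unfolding char_normal1 m by simp
    then show ?thesis using chf_line[OF sets_eq, of 1 s] n by simp
  qed
  have "transpose A = A" by (simp add: transpose_def A_def vec_eq_iff mult.commute)
  moreover have "(A *v s) \<bullet> s \<ge> 0" for s
  proof -
    have "0 \<le> (\<integral>x. (s \<bullet> x - t \<bullet> s)\<^sup>2 \<partial>\<mu>)" by (rule integral_nonneg_AE) auto
    then show ?thesis using var[of s] by simp
  qed
  ultimately show ?thesis unfolding gaussian_def using \<mu> chf unfolding chf_def by blast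
qed

section \<open>Quadratic functional equation on an interval, and a lemma on complements\<close>

text \<open>Scaling by integers gives scaling by rationals in the unit interval, by writing both
  points as multiples of a common \<open>h\<close>. Rationals \<open>q n\<close> approaching
  \<open>l\<close> from below keep every argument inside the interval, and continuity
  finishes.\<close>

lemma continuous_power_scaling:
  fixes f :: "real \<Rightarrow> real"
  assumes cont: "continuous_on {0..T} f" and T: "0 \<le> T"
    and scale: "\<And>j h. 0 \<le> h \<Longrightarrow> real j * h \<le> T \<Longrightarrow> f (real j * h) = real j ^ p * f h"
    and l: "0 \<le> l" "l \<le> 1"
  shows "f (l * T) = l ^ p * f T"
proof -
  define j where "j n = nat \<lfloor>l * real (Suc n)\<rfloor>" for n
  define q where "q n = real (j n) / real (Suc n)" for n
  have j: "real (j n) \<le> l * real (Suc n)" "l * real (Suc n) < real (j n) + 1" for n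
  proof -
    have "0 \<le> \<lfloor>l * real (Suc n)\<rfloor>" using l by (simp add: mult_nonneg_nonneg)
    then have "real (j n) = real_of_int \<lfloor>l * real (Suc n)\<rfloor>" by (simp add: j_def)
    then show "real (j n) \<le> l * real (Suc n)" "l * real (Suc n) < real (j n) + 1" by linarith+
  qed
  have q: "0 \<le> q n" "q n \<le> l" "l - inverse (real (Suc n)) \<le> q n" for n
  proof -
    show "0 \<le> q n" by (simp add: q_def)
    show "q n \<le> l" using j(1)[of n] by (simp add: q_def pos_divide_le_eq del: of_nat_Suc)
    have "l < (real (j n) + 1) / real (Suc n)" using j(2)[of n] by (simp add: pos_less_divide_eq del: of_nat_Suc)
    then show "l - inverse (real (Suc n)) \<le> q n" by (simp add: q_def add_divide_distrib inverse_eq_divide)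
  qed
  have "q \<longlonglongrightarrow> l"
  proof (rule tendsto_sandwich[of "\<lambda>n. l - inverse (real (Suc n))" q _ "\<lambda>_. l"])
    have "(\<lambda>n. l - inverse (real (Suc n))) \<longlonglongrightarrow> l - 0"
      by (intro tendsto_intros LIMSEQ_inverse_real_of_nat)
    then show "(\<lambda>n. l - inverse (real (Suc n))) \<longlonglongrightarrow> l" by simp
  qed (use q in auto)
  have fq: "f (q n * T) = q n ^ p * f T" for n
  proof -
    define h where "h = T / real (Suc n)"
    have h: "0 \<le> h" "real (Suc n) * h = T" using T by (auto simp: h_def)
    have "real (j n) * h = q n * T" by (simp add: h_def q_def)
    moreover have "q n * T \<le> T" using q[of n] l T mult_right_mono[of "q n" 1 T] by simp
    ultimately have "f (q n * T) = real (j n) ^ p * f h" using scale[OF h(1), of "j n"] by simp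
    moreover have "f T = real (Suc n) ^ p * f h" using scale[OF h(1), of "Suc n"] h(2) by simp
    ultimately show ?thesis by (simp add: q_def power_divide)
  qed
  have "(\<lambda>n. f (q n * T)) \<longlonglongrightarrow> f (l * T)"
  proof (rule continuous_on_tendsto_compose[OF cont])
    show "(\<lambda>n. q n * T) \<longlonglongrightarrow> l * T" by (intro tendsto_intros \<open>q \<longlonglongrightarrow> l\<close>)
    have "x * T \<in> {0..T}" if "0 \<le> x" "x \<le> 1" for x using that T mult_right_mono[of x 1 T] by simp
    then show "l * T \<in> {0..T}" "\<forall>\<^sub>F n in sequentially. q n * T \<in> {0..T}"
      using l q order_trans[OF q(2) l(2)] by auto
  qed
  moreover have "(\<lambda>n. q n ^ p * f T) \<longlonglongrightarrow> l ^ p * f T"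
    by (intro tendsto_intros \<open>q \<longlonglongrightarrow> l\<close>)
  ultimately show ?thesis unfolding fq by (rule LIMSEQ_unique)
qed

text \<open>By \<open>cnj\<close>, the sum \<open>\<omega> y + \<omega> (- y)\<close> is real. So
  the real part satisfies the parallelogram equation and the imaginary part Jensen's equation; their
  continuous solutions vanishing at 0 are multiples of the square and of the argument.\<close>

lemma local_quadratic:
  fixes \<omega> :: "real \<Rightarrow> complex"
  assumes r: "r > 0" and cont: "continuous_on {-r..r} \<omega>"
    and cnj: "\<And>t. \<bar>t\<bar> \<le> r \<Longrightarrow> \<omega> (- t) = cnj (\<omega> t)"
    and eq: "\<And>x y. \<bar>x\<bar> \<le> r \<Longrightarrow> \<bar>y\<bar> \<le> r \<Longrightarrow> \<bar>x + y\<bar> \<le> r \<Longrightarrow> \<bar>x - y\<bar> \<le> r \<Longrightarrow>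
      \<omega> (x + y) + \<omega> (x - y) = 2 * \<omega> x + \<omega> y + \<omega> (- y)"
    and neg: "\<And>t. \<bar>t\<bar> \<le> r \<Longrightarrow> Re (\<omega> t) \<le> 0"
  shows "\<exists>q m. 0 \<le> q \<and> (\<forall>t. \<bar>t\<bar> < r \<longrightarrow> \<omega> t = - of_real (q * t\<^sup>2) + \<i> * of_real (m * t))"
proof -
  define e where "e t = Re (\<omega> t)" for t
  define d where "d t = Im (\<omega> t)" for t
  have ee: "e (x + y) + e (x - y) = 2 * e x + 2 * e y" and dd: "d (x + y) + d (x - y) = 2 * d x"
    if "\<bar>x\<bar> \<le> r" "\<bar>y\<bar> \<le> r" "\<bar>x + y\<bar> \<le> r" "\<bar>x - y\<bar> \<le> r" for x y
    using arg_cong[OF eq[OF that], of Re] arg_cong[OF eq[OF that], of Im] cnj[OF that(2)]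
    by (simp_all add: e_def d_def)
  have e0: "e 0 = 0" using ee[of 0 0] r by simp
  have d0: "d 0 = 0" using cnj[of 0] r by (simp add: d_def complex_eq_iff)
  have sc: "e (real j * h) = real j ^ 2 * e h \<and> d (real j * h) = real j ^ 1 * d h"
    if "0 \<le> h" "real j * h \<le> r" for j h
    using that(2)
  proof (induction j rule: less_induct)
    case (less j)
    \<comment> \<open>With \<open>x\<close> and \<open>y\<close> specialised to consecutive
      multiples of \<open>h\<close>, both equations become three-term recurrences, hence the two
      base values.\<close>
    consider "j = 0" | "j = 1" | i where "j = Suc (Suc i)" by (metis One_nat_def not0_implies_Suc)
    then show ?case
    proof cases
      case (3 i)
      have b: "0 \<le> real i * h" "h \<le> real (Suc i) * h" "real (Suc i) * h \<le> real j * h" "real i * h \<le> real j * h"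
        using that(1) 3 by (auto simp: algebra_simps)
      have p: "real (Suc i) * h + h = real j * h" "real (Suc i) * h - h = real i * h"
        using 3 by (simp_all add: algebra_simps)
      have A: "\<bar>real (Suc i) * h\<bar> \<le> r" "\<bar>h\<bar> \<le> r" "\<bar>real (Suc i) * h + h\<bar> \<le> r" "\<bar>real (Suc i) * h - h\<bar> \<le> r"
        unfolding p by (intro abs_leI; use b less.prems that(1) in linarith)+
      have IH: "e (real i * h) = real i ^ 2 * e h" "e (real (Suc i) * h) = real (Suc i) ^ 2 * e h"
        "d (real i * h) = real i * d h" "d (real (Suc i) * h) = real (Suc i) * d h"
        using less.IH[of i] less.IH[of "Suc i"] 3 b less.prems by (auto simp del: of_nat_Suc)
      have "e (real j * h) = 2 * e (real (Suc i) * h) + 2 * e h - e (real i * h)"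
        using ee[OF A] unfolding p by linarith
      moreover have "d (real j * h) = 2 * d (real (Suc i) * h) - d (real i * h)"
        using dd[OF A] unfolding p by linarith
      ultimately show ?thesis unfolding IH 3 by (simp add: power2_eq_square algebra_simps)
    qed (use e0 d0 in auto)
  qed
  have cont0: "continuous_on {0..r} \<omega>" by (rule continuous_on_subset[OF cont]) (use r in auto)
  have ce: "continuous_on {0..r} e" and cd: "continuous_on {0..r} d"
    unfolding e_def d_def by (intro continuous_intros cont0)+
  define q where "q = - e r / r\<^sup>2"
  define m where "m = d r / r"
  have pos: "\<omega> t = - of_real (q * t\<^sup>2) + \<i> * of_real (m * t)" if "0 \<le> t" "t \<le> r" for t
  proof -
    have l: "0 \<le> t / r" "t / r \<le> 1" using that r by auto
    have "e (t / r * r) = (t / r) ^ 2 * e r"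
      by (rule continuous_power_scaling[OF ce _ _ l]) (use r sc in auto)
    moreover have "d (t / r * r) = (t / r) ^ 1 * d r"
      by (rule continuous_power_scaling[OF cd _ _ l]) (use r sc in auto)
    ultimately have "e t = - (q * t\<^sup>2)" "d t = m * t" using r by (simp_all add: q_def m_def power_divide)
    then show ?thesis by (simp add: complex_eq_iff e_def d_def)
  qed
  have "\<omega> t = - of_real (q * t\<^sup>2) + \<i> * of_real (m * t)" if "\<bar>t\<bar> < r" for t
  proof (cases "0 \<le> t")
    case True
    then show ?thesis using pos that by simp
  next
    case False
    then show ?thesis using pos[of "- t"] cnj[of "- t"] that by (simp add: complex_eq_iff)
  qed
  moreover have "0 \<le> q" using neg[of r] r by (simp add: q_def e_def divide_nonpos_pos)
  ultimately show ?thesis by blast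
qed

text \<open>The hypothesis \<open>TZ\<close> says that \<open>T\<close>, restricted to the
  orthogonal complement of \<open>Z\<close> and read modulo \<open>Z\<close>, is injective. By
  dimension it is then onto modulo \<open>Z\<close>.\<close>

lemma sum_subspace_range_UNIV:
  fixes T :: "'a::euclidean_space \<Rightarrow> 'a"
  assumes Z: "subspace Z" and T: "linear T" and TZ: "\<And>w. T w \<in> Z \<Longrightarrow> w \<in> Z"
  obtains z k where "z \<in> Z" "d = z + T k"
proof -
  obtain B where B: "B \<subseteq> Z" "pairwise orthogonal B" "\<And>x. x \<in> B \<Longrightarrow> norm x = 1" "independent B" "span B = Z"
    using orthonormal_basis_subspace[OF Z] by metis
  have finB: "finite B" using B(4) by (simp add: independent_imp_finite)
  define Q where "Q x = (\<Sum>b\<in>B. (x \<bullet> b) *\<^sub>R b)" for x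
  have Q: "linear Q" unfolding Q_def
    by (intro linear_compose_sum ballI) (auto intro!: linearI simp: inner_add_left scaleR_add_left)
  have QZ: "Q x \<in> Z" for x unfolding Q_def using B(1) Z by (intro subspace_sum subspace_mul) auto
  have Qb: "Q b = b" if "b \<in> B" for b
  proof -
    have "Q b = (\<Sum>b'\<in>B. if b' = b then b else 0)" unfolding Q_def
    proof (intro sum.cong refl)
      fix b' assume "b' \<in> B"
      then show "(b \<bullet> b') *\<^sub>R b' = (if b' = b then b else 0)"
        using B(2,3) that by (auto simp: pairwise_def orthogonal_def norm_eq_1)
    qed
    then show ?thesis using finB that by simp
  qed
  have Qz: "Q z = z" if "z \<in> Z" for z
  proof -
    have "z \<in> span B" using that B(5) by simp
    then show ?thesis using linear_eq_on_span[OF Q linear_id[unfolded id_def] Qb] by simp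
  qed
  \<comment> \<open>\<open>L\<close> is the compression of \<open>T\<close> to the complement of
    \<open>Z\<close> together with the identity on \<open>Z\<close>, an endomorphism to which
    injectivity implies surjectivity applies.\<close>
  define L where "L x = (let y = x - Q x in T y - Q (T y) + Q x)" for x
  have P: "linear (\<lambda>x. x - Q x)" by (intro linear_compose_sub linear_id[unfolded id_def] Q)
  have L: "linear L"
    unfolding L_def Let_def
    by (intro linear_compose_add linear_compose_sub Q linear_compose[OF P T, unfolded o_def]
        linear_compose[OF linear_compose[OF P T] Q, unfolded o_def])
  have "inj L"
  proof (rule linear_injective_0[THEN iffD2, OF L], intro allI impI)
    fix x assume L0: "L x = 0"
    define y where "y = x - Q x"
    have 0: "T y - Q (T y) + Q x = 0" using L0 by (simp add: L_def Let_def y_def)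
    have "Q (T y - Q (T y) + Q x) = Q x"
      using QZ by (simp add: linear_add[OF Q] linear_diff[OF Q] Qz)
    then have Qx: "Q x = 0" using 0 by (simp add: linear_0[OF Q])
    then have "T y = Q (T y)" using 0 by simp
    then have "y \<in> Z" using TZ QZ by metis
    then have "x \<in> Z" using Qx by (simp add: y_def)
    then show "x = 0" using Qz Qx by simp
  qed
  then have "surj L" using linear_injective_imp_surjective[OF L] by blast
  then obtain x where x: "d = L x" by blast
  define k where "k = x - Q x"
  have "d = (Q x - Q (T k)) + T k" by (simp add: x L_def Let_def k_def)
  moreover have "Q x - Q (T k) \<in> Z" using QZ Z by (intro subspace_diff) auto
  ultimately show ?thesis using that by blast
qed

lemma (in distr_space) Ln_chf_near_0:
  assumes "0 < \<epsilon>"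
  obtains \<rho> where "0 < \<rho>" "\<And>s. norm s < \<rho> \<Longrightarrow> chf \<mu> s \<notin> \<real>\<^sub>\<le>\<^sub>0 \<and> \<bar>Im (Ln (chf \<mu> s))\<bar> < \<epsilon>"
proof -
  have c: "isCont (chf \<mu>) 0" using continuous_chf by (simp add: continuous_on_eq_continuous_at)
  have "isCont (\<lambda>s. Im (Ln (chf \<mu> s))) 0"
    by (intro isCont_Im isCont_o2[OF c]) (simp add: continuous_at_Ln)
  then have "((\<lambda>s. Im (Ln (chf \<mu> s))) \<longlongrightarrow> 0) (at 0)" by (simp add: isCont_def)
  moreover have "((\<lambda>s. Re (chf \<mu> s)) \<longlongrightarrow> 1) (at 0)"
    using c tendsto_Re[of "chf \<mu>" "chf \<mu> 0" "at 0"] by (simp add: isCont_def)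
  ultimately have "\<forall>\<^sub>F s in at 0. \<bar>Im (Ln (chf \<mu> s))\<bar> < \<epsilon> \<and> 0 < Re (chf \<mu> s)"
    using assms by (intro eventually_conj) (auto dest!: tendstoD[of _ 0 _ \<epsilon>] order_tendstoD(1)[of _ 1 _ 0] simp: dist_real_def)
  then obtain \<rho> where \<rho>: "0 < \<rho>" "\<And>s. s \<noteq> 0 \<Longrightarrow> norm s < \<rho> \<Longrightarrow> \<bar>Im (Ln (chf \<mu> s))\<bar> < \<epsilon> \<and> 0 < Re (chf \<mu> s)"
    unfolding eventually_at by (auto simp: dist_norm)
  have "chf \<mu> s \<notin> \<real>\<^sub>\<le>\<^sub>0 \<and> \<bar>Im (Ln (chf \<mu> s))\<bar> < \<epsilon>" if "norm s < \<rho>" for s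
    using \<rho>(2)[of s] that assms by (cases "s = 0") (auto simp: complex_nonpos_Reals_iff)
  then show ?thesis using that \<rho>(1) by blast
qed

section \<open>The functional equation\<close>

text \<open>Alternating sum of the equation over the cube spanned by the shifts \<open>(a p, p)\<close>, \<open>(l, l)\<close> and
  \<open>(k, - k)\<close> of \<open>(u, v)\<close>: these leave \<open>u - a v\<close>, \<open>u - v\<close> and \<open>u + v\<close> unchanged, respectively.\<close>

lemma third_difference:
  fixes f1 f2 g1 g2 :: "'a::real_normed_vector \<Rightarrow> complex" and \<kappa> :: "'a \<Rightarrow> real"
  assumes a: "linear a" and \<kappa>: "linear \<kappa>"
    and E: "\<And>u v. norm u \<le> \<eta> \<Longrightarrow> norm v \<le> \<eta> \<Longrightarrow>
      f1 (u + v) + g1 (u + a v) = \<i> * of_real (\<kappa> v) + f2 (u - v) + g2 (u - a v)"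
    and small: "norm (a p) + norm p + norm l + norm k \<le> \<eta>"
  shows "g1 (2 *\<^sub>R a p + (l + a l) + (k - a k)) - g1 (2 *\<^sub>R a p + (l + a l)) - g1 (2 *\<^sub>R a p + (k - a k)) + g1 (2 *\<^sub>R a p)
    = g1 ((l + a l) + (k - a k)) - g1 (l + a l) - g1 (k - a k) + g1 0"
proof -
  note lin = linear_add[OF a] linear_diff[OF a] linear_0[OF a] linear_neg[OF a]
    linear_add[OF \<kappa>] linear_diff[OF \<kappa>] linear_0[OF \<kappa>] linear_neg[OF \<kappa>]
  have H: "g1 Q = \<i> * of_real V + f2 R + g2 S - f1 P"
    if "u + v = P" "u + a v = Q" "u - v = R" "u - a v = S" "\<kappa> v = V" "norm u \<le> \<eta>" "norm v \<le> \<eta>" for u v P Q R S V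
    using E[OF that(6,7)] unfolding that(1-5) by (simp add: eq_diff_eq add.commute)
  have n: "norm (a p + l + k) \<le> \<eta>" "norm (p + l - k) \<le> \<eta>" "norm (a p + l) \<le> \<eta>" "norm (p + l) \<le> \<eta>"
    "norm (a p + k) \<le> \<eta>" "norm (p - k) \<le> \<eta>" "norm (a p) \<le> \<eta>" "norm p \<le> \<eta>" "norm (l + k) \<le> \<eta>" "norm (l - k) \<le> \<eta>"
    "norm l \<le> \<eta>" "norm k \<le> \<eta>" "norm (- k) \<le> \<eta>" "norm (0::'a) \<le> \<eta>"
    using small by norm+
  \<comment> \<open>The three digits tell which of the shifts by \<open>p\<close>, \<open>l\<close>
    and \<open>k\<close> are applied. Each of \<open>f1\<close>, \<open>f2\<close>,
    \<open>g2\<close> is insensitive to one shift, and \<kappa> is linear, so all of them cancel in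
    the alternating sum.\<close>
  have e111: "g1 (2 *\<^sub>R a p + (l + a l) + (k - a k)) =
      \<i> * of_real (\<kappa> p + \<kappa> l - \<kappa> k) + f2 (a p - p + 2 *\<^sub>R k) + g2 ((l - a l) + (k + a k)) - f1 (a p + p + 2 *\<^sub>R l)"
    by (rule H[OF _ _ _ _ _ n(1,2)]) (simp_all add: lin scaleR_2)
  have e110: "g1 (2 *\<^sub>R a p + (l + a l)) =
      \<i> * of_real (\<kappa> p + \<kappa> l) + f2 (a p - p) + g2 (l - a l) - f1 (a p + p + 2 *\<^sub>R l)"
    by (rule H[OF _ _ _ _ _ n(3,4)]) (simp_all add: lin scaleR_2)
  have e101: "g1 (2 *\<^sub>R a p + (k - a k)) =
      \<i> * of_real (\<kappa> p - \<kappa> k) + f2 (a p - p + 2 *\<^sub>R k) + g2 (k + a k) - f1 (a p + p)"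
    by (rule H[OF _ _ _ _ _ n(5,6)]) (simp_all add: lin scaleR_2)
  have e100: "g1 (2 *\<^sub>R a p) = \<i> * of_real (\<kappa> p) + f2 (a p - p) + g2 0 - f1 (a p + p)"
    by (rule H[OF _ _ _ _ _ n(7,8)]) (simp_all add: lin scaleR_2)
  have e011: "g1 ((l + a l) + (k - a k)) =
      \<i> * of_real (\<kappa> l - \<kappa> k) + f2 (2 *\<^sub>R k) + g2 ((l - a l) + (k + a k)) - f1 (2 *\<^sub>R l)"
    by (rule H[OF _ _ _ _ _ n(9,10)]) (simp_all add: lin scaleR_2)
  have e010: "g1 (l + a l) = \<i> * of_real (\<kappa> l) + f2 0 + g2 (l - a l) - f1 (2 *\<^sub>R l)"
    by (rule H[OF _ _ _ _ _ n(11,11)]) (simp_all add: lin scaleR_2)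
  have e001: "g1 (k - a k) = \<i> * of_real (- \<kappa> k) + f2 (2 *\<^sub>R k) + g2 (k + a k) - f1 0"
    by (rule H[OF _ _ _ _ _ n(12,13)]) (simp_all add: lin scaleR_2)
  have e000: "g1 0 = \<i> * of_real 0 + f2 0 + g2 0 - f1 0"
    by (rule H[OF _ _ _ _ _ n(14,14)]) (simp_all add: lin)
  show ?thesis unfolding e111 e110 e101 e100 e011 e010 e001 e000 by (simp add: algebra_simps)
qed

lemma mult_eq_1_le_1:
  fixes x y :: real
  assumes "x * y = 1" "0 \<le> x" "x \<le> 1" "0 \<le> y" "y \<le> 1"
  shows "x = 1" "y = 1"
proof -
  have "x * y \<le> x" "x * y \<le> y"
    using mult_left_mono[of y 1 x] mult_right_mono[of x 1 y] assms by auto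
  then show "x = 1" "y = 1" using assms by auto
qed

text \<open>Intended reading: \<open>\<mu>\<^sub>1\<close> and \<open>\<nu>\<^sub>1\<close> are the
  conditional laws of the two real parts given a pair of discrete values,
  \<open>\<mu>\<^sub>2\<close> and \<open>\<nu>\<^sub>2\<close> those at the pair reflected by the
  sign change, \<open>a\<close> is the adjoint of the real part of \<delta>, and \<kappa> is the
  phase left by its off-diagonal part.\<close>

locale heyde_chf =
  M1: distr_space \<mu>\<^sub>1 + N1: distr_space \<nu>\<^sub>1 + M2: distr_space \<mu>\<^sub>2 + N2: distr_space \<nu>\<^sub>2
  for \<mu>\<^sub>1 \<nu>\<^sub>1 \<mu>\<^sub>2 \<nu>\<^sub>2 :: "'a::euclidean_space measure" +
  fixes a :: "'a \<Rightarrow> 'a" and \<kappa> :: "'a \<Rightarrow> real"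
  assumes a: "linear a" and ker_a: "a v = 0 \<Longrightarrow> v = 0" and ker_Ia: "v + a v = 0 \<Longrightarrow> v = 0"
    and \<kappa>: "linear \<kappa>"
    and eq: "chf \<mu>\<^sub>1 (u + v) * chf \<nu>\<^sub>1 (u + a v) = cis (\<kappa> v) * chf \<mu>\<^sub>2 (u - v) * chf \<nu>\<^sub>2 (u - a v)"
begin

text \<open>The third difference yields an equation only for shifts in the range of \<open>I - a\<close>. All four
  characteristic functions are multiplicative along \<open>Z\<close>, which complements this range.\<close>

definition Z :: "'a set" where
  "Z = {w. \<forall>t. cmod (chf \<mu>\<^sub>1 (t *\<^sub>R w)) = 1 \<and> cmod (chf \<nu>\<^sub>1 (t *\<^sub>R w)) = 1 \<and>
    cmod (chf \<mu>\<^sub>2 (t *\<^sub>R w)) = 1 \<and> cmod (chf \<nu>\<^sub>2 (t *\<^sub>R w)) = 1}"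

lemma subspace_Z: "subspace Z"
proof (rule subspaceI)
  show "0 \<in> Z" by (simp add: Z_def)
  show "x + y \<in> Z" if "x \<in> Z" "y \<in> Z" for x y
    using that unfolding Z_def mem_Collect_eq scaleR_add_right
    by (simp add: M1.chf_unimodular N1.chf_unimodular M2.chf_unimodular N2.chf_unimodular norm_mult)
  show "c *\<^sub>R x \<in> Z" if "x \<in> Z" for c x
    using that unfolding Z_def by simp
qed

text \<open>For \<open>u = v\<close> the right side of the equation is \<open>\<mu>\<^sub>2\<close>
  at 0 times \<open>\<nu>\<^sub>2\<close> at a multiple of \<open>w - a w\<close>, so it has modulus
  1 and both factors on the left must too. For \<open>v = - u\<close> the sides exchange roles.
  Halving \<open>t\<close> makes the remaining argument exactly \<open>t *\<^sub>R w\<close>, up to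
  an element of \<open>Z\<close> that does not change the modulus.\<close>

lemma Z_pullback:
  assumes "w - a w \<in> Z"
  shows "w \<in> Z"
  unfolding Z_def mem_Collect_eq
proof
  fix t :: real
  define s where "s = t / 2"
  have e1: "s *\<^sub>R w + s *\<^sub>R w = t *\<^sub>R w" by (simp add: s_def flip: scaleR_add_left)
  have e2: "s *\<^sub>R w + a (s *\<^sub>R w) = t *\<^sub>R w + (- s) *\<^sub>R (w - a w)"
    unfolding e1[symmetric] by (simp add: linear_scale[OF a] scaleR_diff_right)
  have e3: "s *\<^sub>R w - a (s *\<^sub>R w) = s *\<^sub>R (w - a w)" by (simp add: linear_scale[OF a] scaleR_diff_right)
  have Zw: "cmod (chf \<nu>\<^sub>1 (r *\<^sub>R (w - a w))) = 1" "cmod (chf \<nu>\<^sub>2 (r *\<^sub>R (w - a w))) = 1" for r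
    using assms by (auto simp: Z_def)
  have n1: "cmod (chf \<nu>\<^sub>1 (s *\<^sub>R w + a (s *\<^sub>R w))) = cmod (chf \<nu>\<^sub>1 (t *\<^sub>R w))"
    unfolding e2 N1.chf_unimodular[OF Zw(1)] by (simp only: norm_mult Zw mult_1_right)
  have n2: "cmod (chf \<nu>\<^sub>2 (s *\<^sub>R w + a (s *\<^sub>R w))) = cmod (chf \<nu>\<^sub>2 (t *\<^sub>R w))"
    unfolding e2 N2.chf_unimodular[OF Zw(2)] by (simp only: norm_mult Zw mult_1_right)
  have "cmod (chf \<mu>\<^sub>1 (t *\<^sub>R w)) * cmod (chf \<nu>\<^sub>1 (t *\<^sub>R w)) = 1"
    using arg_cong[OF eq[of "s *\<^sub>R w" "s *\<^sub>R w"], of cmod]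
    unfolding norm_mult n1 e1 e3 Zw by simp
  note 1 = mult_eq_1_le_1[OF this norm_ge_zero M1.norm_chf_le norm_ge_zero N1.norm_chf_le]
  have "cmod (chf \<mu>\<^sub>2 (t *\<^sub>R w)) * cmod (chf \<nu>\<^sub>2 (t *\<^sub>R w)) = 1"
    using arg_cong[OF eq[of "s *\<^sub>R w" "- (s *\<^sub>R w)"], of cmod]
    unfolding linear_neg[OF a] diff_minus_eq_add add_uminus_conv_diff norm_mult n2 e1 e3 Zw by simp
  note 2 = mult_eq_1_le_1[OF this norm_ge_zero M2.norm_chf_le norm_ge_zero N2.norm_chf_le]
  show "cmod (chf \<mu>\<^sub>1 (t *\<^sub>R w)) = 1 \<and> cmod (chf \<nu>\<^sub>1 (t *\<^sub>R w)) = 1 \<and>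
    cmod (chf \<mu>\<^sub>2 (t *\<^sub>R w)) = 1 \<and> cmod (chf \<nu>\<^sub>2 (t *\<^sub>R w)) = 1"
    using 1 2 by simp
qed

text \<open>The exponentials of both sides agree. The imaginary parts involved are five numbers
  below 1/4 in modulus, so the two sides differ by less than \<open>2 * pi\<close> in imaginary part
  and no period can intervene.\<close>

lemma log_eq:
  assumes \<rho>: "\<And>s. norm s < \<rho> \<Longrightarrow> chf \<mu>\<^sub>1 s \<notin> \<real>\<^sub>\<le>\<^sub>0 \<and> \<bar>Im (Ln (chf \<mu>\<^sub>1 s))\<bar> < 1 / 4"
      "\<And>s. norm s < \<rho> \<Longrightarrow> chf \<nu>\<^sub>1 s \<notin> \<real>\<^sub>\<le>\<^sub>0 \<and> \<bar>Im (Ln (chf \<nu>\<^sub>1 s))\<bar> < 1 / 4"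
      "\<And>s. norm s < \<rho> \<Longrightarrow> chf \<mu>\<^sub>2 s \<notin> \<real>\<^sub>\<le>\<^sub>0 \<and> \<bar>Im (Ln (chf \<mu>\<^sub>2 s))\<bar> < 1 / 4"
      "\<And>s. norm s < \<rho> \<Longrightarrow> chf \<nu>\<^sub>2 s \<notin> \<real>\<^sub>\<le>\<^sub>0 \<and> \<bar>Im (Ln (chf \<nu>\<^sub>2 s))\<bar> < 1 / 4"
    and n: "norm (u + v) < \<rho>" "norm (u + a v) < \<rho>" "norm (u - v) < \<rho>" "norm (u - a v) < \<rho>"
    and k: "\<bar>\<kappa> v\<bar> < 1 / 4"
  shows "Ln (chf \<mu>\<^sub>1 (u + v)) + Ln (chf \<nu>\<^sub>1 (u + a v)) =
    \<i> * of_real (\<kappa> v) + Ln (chf \<mu>\<^sub>2 (u - v)) + Ln (chf \<nu>\<^sub>2 (u - a v))"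
proof (rule exp_complex_eqI)
  have nz: "chf \<mu>\<^sub>1 (u + v) \<noteq> 0" "chf \<nu>\<^sub>1 (u + a v) \<noteq> 0" "chf \<mu>\<^sub>2 (u - v) \<noteq> 0" "chf \<nu>\<^sub>2 (u - a v) \<noteq> 0"
    using \<rho>(1)[OF n(1)] \<rho>(2)[OF n(2)] \<rho>(3)[OF n(3)] \<rho>(4)[OF n(4)] by auto
  then show "exp (Ln (chf \<mu>\<^sub>1 (u + v)) + Ln (chf \<nu>\<^sub>1 (u + a v))) =
      exp (\<i> * of_real (\<kappa> v) + Ln (chf \<mu>\<^sub>2 (u - v)) + Ln (chf \<nu>\<^sub>2 (u - a v)))"
    using eq[of u v] by (simp add: exp_add exp_Ln cis_conv_exp)
  have "2 < 2 * pi" using pi_gt3 by simp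
  then show "\<bar>Im (Ln (chf \<mu>\<^sub>1 (u + v)) + Ln (chf \<nu>\<^sub>1 (u + a v))) -
      Im (\<i> * of_real (\<kappa> v) + Ln (chf \<mu>\<^sub>2 (u - v)) + Ln (chf \<nu>\<^sub>2 (u - a v)))\<bar> < 2 * pi"
    using \<rho>(1)[OF n(1), THEN conjunct2] \<rho>(2)[OF n(2), THEN conjunct2]
      \<rho>(3)[OF n(3), THEN conjunct2] \<rho>(4)[OF n(4), THEN conjunct2] k
    unfolding plus_complex.sel Im_i_times Re_complex_of_real by linarith
qed

text \<open>On the line through \<open>s\<close>, the shifts of \<open>third_difference\<close> are
  chosen so that \<open>2 a p\<close>, \<open>l + a l\<close> and \<open>k - a k\<close> become
  \<open>x s\<close>, \<open>- y s\<close> and \<open>y s - y z\<close>. The first two are possible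
  because \<open>a\<close> and \<open>I + a\<close> are onto. The range of \<open>I - a\<close> may
  miss \<open>s\<close>, whence the correction \<open>z\<close> in \<open>Z\<close>, along which the
  logarithm is additive. The result is the hypothesis of \<open>local_quadratic\<close>.\<close>

lemma line_gauss_second: "line_gauss \<nu>\<^sub>1"
  unfolding line_gauss_def
proof
  fix s :: 'a
  have inj_a: "inj a" using linear_injective_0[OF a] ker_a by blast
  have Ia: "linear (\<lambda>v. v + a v)" by (intro linear_compose_add linear_id[unfolded id_def] a)
  have inj_Ia: "inj (\<lambda>v. v + a v)" using linear_injective_0[OF Ia] ker_Ia by blast
  obtain m where m: "2 *\<^sub>R a m = s"
  proof -
    obtain m' where "a m' = s" using linear_injective_imp_surjective[OF a inj_a] by (metis surjD)
    then have "2 *\<^sub>R a ((1 / 2) *\<^sub>R m') = s" by (simp add: linear_scale[OF a])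
    then show ?thesis using that by blast
  qed
  obtain l where l: "l + a l = s" using linear_injective_imp_surjective[OF Ia inj_Ia] by (metis surjD)
  have lT: "linear (\<lambda>k. k - a k)" by (intro linear_compose_sub linear_id[unfolded id_def] a)
  obtain z k where zk: "z \<in> Z" "s = z + (k - a k)"
    using sum_subspace_range_UNIV[OF subspace_Z lT Z_pullback] by blast
  obtain \<rho>1 where \<rho>1: "0 < \<rho>1" "\<And>s. norm s < \<rho>1 \<Longrightarrow> chf \<mu>\<^sub>1 s \<notin> \<real>\<^sub>\<le>\<^sub>0 \<and> \<bar>Im (Ln (chf \<mu>\<^sub>1 s))\<bar> < 1 / 4"
    using M1.Ln_chf_near_0[of "1 / 4"] by auto
  obtain \<rho>2 where \<rho>2: "0 < \<rho>2" "\<And>s. norm s < \<rho>2 \<Longrightarrow> chf \<nu>\<^sub>1 s \<notin> \<real>\<^sub>\<le>\<^sub>0 \<and> \<bar>Im (Ln (chf \<nu>\<^sub>1 s))\<bar> < 1 / 4"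
    using N1.Ln_chf_near_0[of "1 / 4"] by auto
  obtain \<rho>3 where \<rho>3: "0 < \<rho>3" "\<And>s. norm s < \<rho>3 \<Longrightarrow> chf \<mu>\<^sub>2 s \<notin> \<real>\<^sub>\<le>\<^sub>0 \<and> \<bar>Im (Ln (chf \<mu>\<^sub>2 s))\<bar> < 1 / 4"
    using M2.Ln_chf_near_0[of "1 / 4"] by auto
  obtain \<rho>4 where \<rho>4: "0 < \<rho>4" "\<And>s. norm s < \<rho>4 \<Longrightarrow> chf \<nu>\<^sub>2 s \<notin> \<real>\<^sub>\<le>\<^sub>0 \<and> \<bar>Im (Ln (chf \<nu>\<^sub>2 s))\<bar> < 1 / 4"
    using N2.Ln_chf_near_0[of "1 / 4"] by auto
  define \<rho> where "\<rho> = min (min \<rho>1 \<rho>2) (min \<rho>3 \<rho>4)"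
  have \<rho>: "0 < \<rho>" using \<rho>1 \<rho>2 \<rho>3 \<rho>4 by (simp add: \<rho>_def)
  obtain K where K: "K > 0" "\<And>v. norm (a v) \<le> K * norm v" using linear_bounded_pos[OF a] by blast
  obtain K' where K': "K' > 0" "\<And>v. norm (\<kappa> v) \<le> K' * norm v" using linear_bounded_pos[OF \<kappa>] by blast
  \<comment> \<open>Small enough that \<open>u + v\<close>, \<open>u - v\<close>,
    \<open>u + a v\<close> and \<open>u - a v\<close> stay in the ball where the logarithms are
    controlled, and that the phase stays below 1/4.\<close>
  define \<eta> where "\<eta> = min (\<rho> / (2 * (2 + K))) (1 / (8 * K'))"
  have \<eta>: "0 < \<eta>" "(2 + K) * \<eta> < \<rho>" "K' * \<eta> < 1 / 4"
  proof -
    show "0 < \<eta>" using \<rho> K K' by (simp add: \<eta>_def)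
    have "\<eta> \<le> \<rho> / (2 * (2 + K))" "\<eta> \<le> 1 / (8 * K')" by (simp_all add: \<eta>_def)
    then have "(2 + K) * \<eta> \<le> (2 + K) * (\<rho> / (2 * (2 + K)))" "K' * \<eta> \<le> K' * (1 / (8 * K'))"
      using K(1) K'(1) by (intro mult_left_mono; simp)+
    moreover have half: "x * (\<rho> / (2 * x)) = \<rho> / 2" if "x \<noteq> 0" for x using that by simp
    have "(2 + K) * (\<rho> / (2 * (2 + K))) = \<rho> / 2" by (rule half) (use K(1) in simp)
    moreover have "K' * (1 / (8 * K')) = 1 / 8" using K'(1) by simp
    ultimately show "(2 + K) * \<eta> < \<rho>" "K' * \<eta> < 1 / 4" using \<rho> by linarith+
  qed
  define G where "G w = Ln (chf \<nu>\<^sub>1 w)" for w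
  have E: "Ln (chf \<mu>\<^sub>1 (u + v)) + G (u + a v) =
      \<i> * of_real (\<kappa> v) + Ln (chf \<mu>\<^sub>2 (u - v)) + Ln (chf \<nu>\<^sub>2 (u - a v))"
    if "norm u \<le> \<eta>" "norm v \<le> \<eta>" for u v
    unfolding G_def
  proof (rule log_eq[where \<rho> = \<rho>])
    have av: "norm (a v) \<le> K * \<eta>" using K(2)[of v] mult_left_mono[OF that(2), of K] K(1) by linarith
    have b: "2 * \<eta> + K * \<eta> < \<rho>" "0 \<le> K * \<eta>" using \<eta> K by (simp_all add: algebra_simps)
    show "norm (u + v) < \<rho>" "norm (u - v) < \<rho>"
      using norm_triangle_ineq[of u v] norm_triangle_ineq4[of u v] that b by linarith+
    show "norm (u + a v) < \<rho>" "norm (u - a v) < \<rho>"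
      using norm_triangle_ineq[of u "a v"] norm_triangle_ineq4[of u "a v"] that av b \<eta>(1) by linarith+
    show "\<bar>\<kappa> v\<bar> < 1 / 4"
      using K'(2)[of v] mult_left_mono[OF that(2), of K'] K'(1) \<eta>(3) by (simp only: real_norm_def) linarith
  qed (use \<rho>1(2) \<rho>2(2) \<rho>3(2) \<rho>4(2) in \<open>simp_all add: \<rho>_def\<close>)
  \<comment> \<open>Collects the norms of all vectors that will be scaled by \<open>x\<close> or
    \<open>y\<close>, so that the single radius \<open>r\<close> keeps every argument within \<eta>;
    the 1 makes it positive.\<close>
  define C where "C = norm (a m) + norm m + norm l + norm k + norm s + norm z + 1"
  have C: "C \<ge> 1" by (simp add: C_def)
  define r where "r = \<eta> / (2 * C)"
  have r: "0 < r" using \<eta> C by (simp add: r_def)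
  have rC: "2 * (r * C) = \<eta>" using C by (simp add: r_def)
  have \<eta>\<rho>: "\<eta> < \<rho>"
  proof -
    have "1 * \<eta> \<le> (2 + K) * \<eta>" using K \<eta>(1) by (intro mult_right_mono) auto
    then show ?thesis using \<eta>(2) by simp
  qed
  have good: "chf \<nu>\<^sub>1 w \<notin> \<real>\<^sub>\<le>\<^sub>0" "\<bar>Im (G w)\<bar> < 1 / 4" "chf \<nu>\<^sub>1 w = exp (G w)" if "norm w \<le> \<eta>" for w
  proof -
    have *: "chf \<nu>\<^sub>1 w \<notin> \<real>\<^sub>\<le>\<^sub>0 \<and> \<bar>Im (Ln (chf \<nu>\<^sub>1 w))\<bar> < 1 / 4"
      using \<rho>2(2)[of w] that \<eta>\<rho> by (simp add: \<rho>_def)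
    then show "chf \<nu>\<^sub>1 w \<notin> \<real>\<^sub>\<le>\<^sub>0" "\<bar>Im (G w)\<bar> < 1 / 4" by (simp_all add: G_def)
    have "chf \<nu>\<^sub>1 w \<noteq> 0" using * by auto
    then show "chf \<nu>\<^sub>1 w = exp (G w)" by (simp add: G_def)
  qed
  have addZ: "G (w + c *\<^sub>R z) = G w + G (c *\<^sub>R z)"
    if "norm w \<le> \<eta>" "norm (c *\<^sub>R z) \<le> \<eta>" "norm (w + c *\<^sub>R z) \<le> \<eta>" for w c
  proof (rule exp_complex_eqI)
    have "cmod (chf \<nu>\<^sub>1 (c *\<^sub>R z)) = 1" using zk(1) by (simp add: Z_def)
    from N1.chf_unimodular[OF this, of w] show "exp (G (w + c *\<^sub>R z)) = exp (G w + G (c *\<^sub>R z))"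
      using good(3)[OF that(1)] good(3)[OF that(2)] good(3)[OF that(3)] by (simp add: exp_add)
    have "2 < 2 * pi" using pi_gt3 by simp
    then show "\<bar>Im (G (w + c *\<^sub>R z)) - Im (G w + G (c *\<^sub>R z))\<bar> < 2 * pi"
      using good(2)[OF that(1)] good(2)[OF that(2)] good(2)[OF that(3)] by simp
  qed
  define \<omega> where "\<omega> t = G (t *\<^sub>R s)" for t
  have bnd: "norm (c *\<^sub>R w) \<le> r * norm w" if "\<bar>c\<bar> \<le> r" for c and w :: 'a
    using that by (simp add: mult_right_mono)
  have ns: "norm (t *\<^sub>R s) \<le> \<eta>" if "\<bar>t\<bar> \<le> 2 * r" for t
  proof -
    have "norm (t *\<^sub>R s) \<le> 2 * r * C"
      unfolding norm_scaleR using that r by (intro mult_mono) (auto simp: C_def)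
    then show ?thesis using rC by simp
  qed
  have "\<exists>q m. 0 \<le> q \<and> (\<forall>t. \<bar>t\<bar> < r \<longrightarrow> \<omega> t = - of_real (q * t\<^sup>2) + \<i> * of_real (m * t))"
  proof (rule local_quadratic[OF r])
    have "continuous_on {-r..r} (\<lambda>t. chf \<nu>\<^sub>1 (t *\<^sub>R s))"
      by (intro continuous_on_compose2[OF N1.continuous_chf] continuous_intros) auto
    then show "continuous_on {-r..r} \<omega>"
      unfolding \<omega>_def G_def using good(1)[OF ns] r by (intro continuous_on_Ln') auto
    fix t assume t: "\<bar>t\<bar> \<le> r"
    have g: "chf \<nu>\<^sub>1 (t *\<^sub>R s) \<notin> \<real>\<^sub>\<le>\<^sub>0" using good(1)[OF ns[of t]] t r by simp
    show "\<omega> (- t) = cnj (\<omega> t)" using g by (simp add: \<omega>_def G_def N1.chf_uminus cnj_Ln)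
    have "chf \<nu>\<^sub>1 (t *\<^sub>R s) \<noteq> 0" using g by auto
    then show "Re (\<omega> t) \<le> 0"
      using N1.norm_chf_le[of "t *\<^sub>R s"] by (simp add: \<omega>_def G_def)
  next
    fix x y assume x: "\<bar>x\<bar> \<le> r" and y: "\<bar>y\<bar> \<le> r"
    have "norm (a (x *\<^sub>R m)) + norm (x *\<^sub>R m) + norm ((- y) *\<^sub>R l) + norm (y *\<^sub>R k) \<le>
        r * norm (a m) + r * norm m + r * norm l + r * norm k"
      unfolding linear_scale[OF a] using bnd[OF x] bnd[OF y] bnd[of "- y"] y by (intro add_mono) auto
    also have "\<dots> \<le> r * C" using r by (simp add: C_def algebra_simps)
    also have "\<dots> \<le> \<eta>" using rC mult_nonneg_nonneg[of r C] r C by linarith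
    finally have small: "norm (a (x *\<^sub>R m)) + norm (x *\<^sub>R m) + norm ((- y) *\<^sub>R l) + norm (y *\<^sub>R k) \<le> \<eta>" .
    have p: "2 *\<^sub>R a (x *\<^sub>R m) = x *\<^sub>R s" unfolding m[symmetric] by (simp add: linear_scale[OF a])
    have L: "(- y) *\<^sub>R l + a ((- y) *\<^sub>R l) = (- y) *\<^sub>R s" unfolding l[symmetric] by (simp add: linear_scale[OF a] linear_neg[OF a] scaleR_add_right)
    have kz: "y *\<^sub>R k - a (y *\<^sub>R k) = y *\<^sub>R s + (- y) *\<^sub>R z"
    proof -
      have "k - a k = s - z" using zk(2) by simp
      then have "y *\<^sub>R (k - a k) = y *\<^sub>R (s - z)" by simp
      then show ?thesis by (simp add: linear_scale[OF a] scaleR_diff_right)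
    qed
    have T: "G (x *\<^sub>R s + (- y) *\<^sub>R s + (y *\<^sub>R s + (- y) *\<^sub>R z)) - G (x *\<^sub>R s + (- y) *\<^sub>R s) - G (x *\<^sub>R s + (y *\<^sub>R s + (- y) *\<^sub>R z)) + G (x *\<^sub>R s)
      = G ((- y) *\<^sub>R s + (y *\<^sub>R s + (- y) *\<^sub>R z)) - G ((- y) *\<^sub>R s) - G (y *\<^sub>R s + (- y) *\<^sub>R z) + G 0"
      using third_difference[OF a \<kappa> E small] unfolding p L kz .
    have nz: "norm ((- y) *\<^sub>R z) \<le> r * norm z" using bnd[of "- y" z] y by simp
    have nsz: "norm (c *\<^sub>R s + (- y) *\<^sub>R z) \<le> \<eta>" if "\<bar>c\<bar> \<le> 2 * r" for c
    proof -
      have "norm (c *\<^sub>R s) \<le> 2 * r * norm s" using that by (simp add: mult_right_mono)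
      then have "norm (c *\<^sub>R s + (- y) *\<^sub>R z) \<le> 2 * r * norm s + r * norm z"
        using norm_triangle_ineq[of "c *\<^sub>R s" "(- y) *\<^sub>R z"] nz by linarith
      also have "\<dots> \<le> 2 * r * norm s + 2 * r * norm z" using r by (intro add_mono mult_right_mono) auto
      also have "\<dots> = 2 * (r * (norm s + norm z))" by (simp add: algebra_simps)
      also have "\<dots> \<le> 2 * (r * C)" using r by (intro mult_left_mono) (auto simp: C_def)
      finally show ?thesis using rC by simp
    qed
    have nz': "norm ((- y) *\<^sub>R z) \<le> \<eta>" using nsz[of 0] r by simp
    \<comment> \<open>Splits off the multiple of \<open>z\<close>. Its contribution occurs twice on
      each side of \<open>T\<close> with opposite signs and disappears.\<close>
    have A: "G (c *\<^sub>R s + (- y) *\<^sub>R z) = \<omega> c + G ((- y) *\<^sub>R z)" if "\<bar>c\<bar> \<le> 2 * r" for c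
      unfolding \<omega>_def by (rule addZ[OF ns[OF that] nz' nsz[OF that]])
    have i1: "x *\<^sub>R s + (- y) *\<^sub>R s + (y *\<^sub>R s + (- y) *\<^sub>R z) = x *\<^sub>R s + (- y) *\<^sub>R z"
      and i2: "x *\<^sub>R s + (y *\<^sub>R s + (- y) *\<^sub>R z) = (x + y) *\<^sub>R s + (- y) *\<^sub>R z"
      and i3: "(- y) *\<^sub>R s + (y *\<^sub>R s + (- y) *\<^sub>R z) = 0 *\<^sub>R s + (- y) *\<^sub>R z"
      and i4: "x *\<^sub>R s + (- y) *\<^sub>R s = (x - y) *\<^sub>R s"
      by (simp_all add: algebra_simps)
    have G0: "G 0 = 0" by (simp add: G_def)
    have w0: "\<omega> 0 = 0" by (simp add: \<omega>_def G0)
    have "\<bar>x\<bar> \<le> 2 * r" "\<bar>y\<bar> \<le> 2 * r" "\<bar>x + y\<bar> \<le> 2 * r" "\<bar>0::real\<bar> \<le> 2 * r" using x y r by linarith+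
    note A = this[THEN A]
    show "\<omega> (x + y) + \<omega> (x - y) = 2 * \<omega> x + \<omega> y + \<omega> (- y)"
      using T unfolding i1 i2 i3 unfolding i4 A G0 w0 \<omega>_def[symmetric] by (simp add: algebra_simps)
  qed
  then obtain q m where q: "0 \<le> q" "\<And>t. \<bar>t\<bar> < r \<Longrightarrow> \<omega> t = - of_real (q * t\<^sup>2) + \<i> * of_real (m * t)" by blast
  have "chf \<nu>\<^sub>1 (t *\<^sub>R s) = exp (- of_real (q * t\<^sup>2) + \<i> * of_real (m * t))" if "\<bar>t\<bar> < r" for t
    using good(3)[OF ns[of t]] that r q(2)[OF that] by (simp add: \<omega>_def)
  then show "\<exists>m q r. 0 < r \<and> 0 \<le> q \<and>
     (\<forall>t. \<bar>t\<bar> < r \<longrightarrow> chf \<nu>\<^sub>1 (t *\<^sub>R s) = exp (- of_real (q * t\<^sup>2) + \<i> * of_real (m * t)))"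
    using r q(1) by blast
qed

end

text \<open>Replacing \<open>v\<close> by its preimage under \<open>a\<close> exchanges the two laws
  of each pair and turns \<open>a\<close> into its inverse, for which the kernel conditions
  persist.\<close>

theorem (in heyde_chf) line_gauss_both: "line_gauss \<mu>\<^sub>1" "line_gauss \<nu>\<^sub>1"
proof -
  have "inj a" using linear_injective_0[OF a] ker_a by blast
  then obtain a' where a': "linear a'" "\<And>x. a' (a x) = x" "\<And>x. a (a' x) = x"
    using linear_injective_isomorphism[OF a] by metis
  interpret inv: heyde_chf \<nu>\<^sub>1 \<mu>\<^sub>1 \<nu>\<^sub>2 \<mu>\<^sub>2 a' "\<lambda>v. \<kappa> (a' v)"
  proof (rule heyde_chf.intro[OF N1.distr_space_axioms M1.distr_space_axioms
        N2.distr_space_axioms M2.distr_space_axioms], rule heyde_chf_axioms.intro)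
    show "linear a'" by (rule a')
    show "linear (\<lambda>v. \<kappa> (a' v))" using linear_compose[OF a'(1) \<kappa>] by (simp add: o_def)
    show "v = 0" if "a' v = 0" for v using a'(3)[of v] that linear_0[OF a] by simp
    show "v = 0" if "v + a' v = 0" for v
    proof -
      have "a' v + a (a' v) = 0" using that by (simp add: a'(3) add.commute)
      then show ?thesis using ker_Ia a'(3)[of v] linear_0[OF a] by metis
    qed
    show "chf \<nu>\<^sub>1 (u + v) * chf \<mu>\<^sub>1 (u + a' v) = cis (\<kappa> (a' v)) * chf \<nu>\<^sub>2 (u - v) * chf \<mu>\<^sub>2 (u - a' v)" for u v
      using eq[of u "a' v"] by (simp add: a'(3) mult_ac)
  qed
  show "line_gauss \<mu>\<^sub>1" by (rule inv.line_gauss_second)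
  show "line_gauss \<nu>\<^sub>1" by (rule line_gauss_second)
qed

section \<open>Equality of the conditional laws\<close>

lemma eventually_nhds_linear:
  fixes S :: "'a::euclidean_space \<Rightarrow> 'a"
  assumes S: "linear S" "inj S" and ev: "\<forall>\<^sub>F s in nhds 0. P (S s)"
  shows "\<forall>\<^sub>F s in nhds 0. P s"
proof -
  obtain S' where S': "linear S'" "\<And>x. S (S' x) = x"
    using linear_injective_isomorphism[OF S] by metis
  have "continuous (at 0) S'" using S'(1) by (simp add: linear_continuous_at linear_linear)
  then have "filterlim S' (nhds 0) (nhds 0)"
    using linear_0[OF S'(1)] by (metis continuous_at tendsto_at_iff_tendsto_nhds)
  from eventually_compose_filterlim[OF ev this] show ?thesis by (simp add: S'(2))
qed

lemma eventually_nhds_nonzero: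
  fixes S :: "'a::euclidean_space \<Rightarrow> 'a" and g :: "'a \<Rightarrow> complex"
  assumes "linear S" "continuous_on UNIV g" "g 0 \<noteq> 0"
  shows "\<forall>\<^sub>F s in nhds 0. g (S s) \<noteq> 0"
proof -
  have "continuous_on UNIV S" by (simp add: linear_continuous_on linear_linear assms(1))
  then have "continuous_on UNIV (\<lambda>s. g (S s))" by (rule continuous_on_compose2[OF assms(2)]) auto
  then have "open {s. g (S s) \<noteq> 0}" by (intro open_Collect_neq continuous_on_const)
  from eventually_nhds_in_open[OF this] show ?thesis using assms(1,3) by (simp add: linear_0)
qed

text \<open>One half of the descent, abstract enough for both variables to play the role of
  \<open>p\<close>. Here \<open>f\<close> and \<open>g\<close> are characteristic functions on
  events, not divided by their mass, and the three linear maps select pairs (u, v) for which the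
  factor at \<open>x'\<close> is evaluated at 0 and shrinks to an atom. The map \<open>m\<close> is
  a multiple of 2, which \<open>m_dbl\<close> expresses: it trades one doubling of a difference in
  \<open>p\<close> for one less in \<open>q\<close>. The map \<open>c\<close> is I -
  \<beta>.\<close>

locale descent_half =
  fixes p q :: "'d::ab_group_add pmf" and f g :: "'d \<Rightarrow> 'a::euclidean_space \<Rightarrow> complex"
    and F :: "'d set" and c m n :: "'d \<Rightarrow> 'd" and N :: nat and S1 S2 S3 :: "'a \<Rightarrow> 'a" and \<theta> :: "'a \<Rightarrow> complex"
  assumes finF: "finite F" and sgF: "add_subgroup F"
    and invp: "shift_inv F p" and invq: "shift_inv F q"
    and add_c: "Modules.additive c" and add_m: "Modules.additive m" and add_n: "Modules.additive n"
    and cF: "c ` F = F" and nF: "n ` F = F" and mF: "m ` F \<subseteq> F"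
    and ker_c: "dbl N z \<in> F \<Longrightarrow> c z = 0 \<Longrightarrow> z = 0"
    and m_dbl: "dbl (Suc k) z \<in> F \<Longrightarrow> dbl k (m z) \<in> F"
    and suppq: "y \<in> set_pmf q \<Longrightarrow> y' \<in> set_pmf q \<Longrightarrow> dbl N (y - y') \<in> F"
    and S1: "linear S1" "inj S1" and S2: "linear S2" and S3: "linear S3" and \<theta>0: "\<theta> 0 = 1"
    and f0: "f x 0 = of_real (pmf p x)" and g0: "g y 0 = of_real (pmf q y)"
    and cont_g: "continuous_on UNIV (g y)"
    and partner: "x \<in> set_pmf p \<Longrightarrow> y \<in> set_pmf q \<Longrightarrow>
      \<exists>x'\<in>set_pmf p. \<exists>y'\<in>set_pmf q. x' + y' = x + y \<and> c y' = m x + n y \<and>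
        (\<forall>s. f x (S1 s) * g y (S2 s) = \<theta> s * of_real (pmf p x') * g y' (S3 s))"
begin

lemma F_add: "u \<in> F \<Longrightarrow> v \<in> F \<Longrightarrow> u + v \<in> F"
  using sgF by (auto simp: add_subgroup_def)

lemma set_pmf_shift: "x \<in> set_pmf p \<Longrightarrow> \<phi> \<in> F \<Longrightarrow> x + \<phi> \<in> set_pmf p"
    "y \<in> set_pmf q \<Longrightarrow> \<phi> \<in> F \<Longrightarrow> y + \<phi> \<in> set_pmf q"
  using invp invq by (auto simp: set_pmf_iff shift_inv_def)

lemma c_reflects:
  assumes "dbl N z \<in> F" "c z \<in> F"
  shows "z \<in> F"
proof -
  obtain \<zeta> where \<zeta>: "\<zeta> \<in> F" "c z = c \<zeta>" using assms(2) cF by (metis imageE)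
  have "dbl N (z - \<zeta>) \<in> F" unfolding dbl_diff
    by (rule add_subgroup_diff[OF sgF assms(1) dbl_subgroup[OF sgF \<zeta>(1)]])
  moreover have "c (z - \<zeta>) = 0" using \<zeta>(2) by (simp add: additive.diff[OF add_c])
  ultimately have "z - \<zeta> = 0" by (rule ker_c)
  then show ?thesis using \<zeta>(1) by simp
qed

text \<open>Averaging over \<open>y + F\<close> makes the right-hand side the same for all \<open>x\<^sub>1 \<in> x + F\<close>.\<close>

lemma averaged:
  assumes x: "x \<in> set_pmf p" and y: "y \<in> set_pmf q"
  obtains R where "\<And>x\<^sub>1 s. x\<^sub>1 - x \<in> F \<Longrightarrow> f x\<^sub>1 (S1 s) * (\<Sum>\<psi>\<in>F. g (y + \<psi>) (S2 s)) = R s"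
proof -
  obtain x' y' where xy': "x' \<in> set_pmf p" "y' \<in> set_pmf q" "x' + y' = x + y" "c y' = m x + n y"
    using partner[OF x y] by blast
  have "f x\<^sub>1 (S1 s) * (\<Sum>\<psi>\<in>F. g (y + \<psi>) (S2 s)) =
      \<theta> s * of_real (pmf p x') * (\<Sum>\<zeta>\<in>F. g (y' + \<zeta>) (S3 s))" if x1: "x\<^sub>1 - x \<in> F" for x\<^sub>1 s
  proof -
    have x1p: "x\<^sub>1 \<in> set_pmf p" using set_pmf_shift(1)[OF x x1] by simp
    have "\<forall>\<psi>\<in>F. \<exists>\<zeta>. \<zeta> \<in> F \<and> c \<zeta> = m (x\<^sub>1 - x) + n \<psi> \<and>
        f x\<^sub>1 (S1 s) * g (y + \<psi>) (S2 s) = \<theta> s * of_real (pmf p x') * g (y' + \<zeta>) (S3 s)"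
    proof
      fix \<psi> assume \<psi>: "\<psi> \<in> F"
      obtain x2 y2 where xy2: "x2 \<in> set_pmf p" "y2 \<in> set_pmf q" "x2 + y2 = x\<^sub>1 + (y + \<psi>)"
        "c y2 = m x\<^sub>1 + n (y + \<psi>)"
        "f x\<^sub>1 (S1 s) * g (y + \<psi>) (S2 s) = \<theta> s * of_real (pmf p x2) * g y2 (S3 s)"
        using partner[OF x1p set_pmf_shift(2)[OF y \<psi>]] by blast
      \<comment> \<open>Moving \<open>x\<close> and \<open>y\<close> inside their cosets of
        \<open>F\<close> moves the partner \<open>y'\<close> inside its coset as well; \<zeta> is
        that displacement.\<close>
      define \<zeta> where "\<zeta> = y2 - y'"
      have c\<zeta>: "c \<zeta> = m (x\<^sub>1 - x) + n \<psi>"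
        unfolding \<zeta>_def additive.diff[OF add_c] xy2(4) xy'(4) additive.add[OF add_n] additive.diff[OF add_m] by simp
      have "c \<zeta> \<in> F" unfolding c\<zeta> using mF nF x1 \<psi> by (intro F_add) auto
      then have \<zeta>: "\<zeta> \<in> F" using c_reflects suppq[OF xy2(2) xy'(2)] by (simp add: \<zeta>_def)
      have y2: "y2 = y' + \<zeta>" by (simp add: \<zeta>_def)
      have "x2 = x1' + ((x\<^sub>1 - x) + \<psi> - \<zeta>)" if "x1' = x'" for x1'
      proof -
        have "x2 = x\<^sub>1 + (y + \<psi>) - y2" using xy2(3) by (metis add_diff_cancel_right')
        also have "\<dots> = (x + y) - y' + ((x\<^sub>1 - x) + \<psi> - \<zeta>)" by (simp add: \<zeta>_def)
        also have "(x + y) - y' = x'" using xy'(3) by (metis add_diff_cancel_right')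
        finally show ?thesis using that by simp
      qed
      moreover have "(x\<^sub>1 - x) + \<psi> - \<zeta> \<in> F" using add_subgroup_diff[OF sgF F_add[OF x1 \<psi>] \<zeta>] .
      ultimately have "pmf p x2 = pmf p x'" using invp by (auto simp: shift_inv_def)
      then show "\<exists>\<zeta>. \<zeta> \<in> F \<and> c \<zeta> = m (x\<^sub>1 - x) + n \<psi> \<and>
        f x\<^sub>1 (S1 s) * g (y + \<psi>) (S2 s) = \<theta> s * of_real (pmf p x') * g (y' + \<zeta>) (S3 s)"
        using \<zeta> c\<zeta> xy2(5) y2 by auto
    qed
    then obtain \<zeta> where \<zeta>: "\<And>\<psi>. \<psi> \<in> F \<Longrightarrow> \<zeta> \<psi> \<in> F" "\<And>\<psi>. \<psi> \<in> F \<Longrightarrow> c (\<zeta> \<psi>) = m (x\<^sub>1 - x) + n \<psi>"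
      "\<And>\<psi>. \<psi> \<in> F \<Longrightarrow> f x\<^sub>1 (S1 s) * g (y + \<psi>) (S2 s) = \<theta> s * of_real (pmf p x') * g (y' + \<zeta> \<psi>) (S3 s)"
      by metis
    \<comment> \<open>\<open>c (\<zeta> \<psi>)\<close> determines \<open>n \<psi>\<close>, so the
      displacement is a permutation of \<open>F\<close> and reindexes the sum.\<close>
    have "inj_on n F" using finF nF by (intro eq_card_imp_inj_on) auto
    then have "inj_on \<zeta> F" using \<zeta>(2) by (auto simp: inj_on_def) (metis add_left_cancel)
    moreover have "\<zeta> ` F \<subseteq> F" using \<zeta>(1) by blast
    ultimately have bij: "bij_betw \<zeta> F F" using finF by (simp add: bij_betw_def endo_inj_surj)
    have "f x\<^sub>1 (S1 s) * (\<Sum>\<psi>\<in>F. g (y + \<psi>) (S2 s)) = \<theta> s * of_real (pmf p x') * (\<Sum>\<psi>\<in>F. g (y' + \<zeta> \<psi>) (S3 s))"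
      unfolding sum_distrib_left using \<zeta>(3) by (intro sum.cong) auto
    also have "(\<Sum>\<psi>\<in>F. g (y' + \<zeta> \<psi>) (S3 s)) = (\<Sum>\<zeta>\<in>F. g (y' + \<zeta>) (S3 s))"
      by (rule sum.reindex_bij_betw[OF bij])
    finally show ?thesis .
  qed
  then show ?thesis by (rule that)
qed

text \<open>When the difference already lies in \<open>F\<close>, \<open>m\<close> only moves it
  within \<open>F\<close> and no order is left to lower. Averaging over a coset replaces the descent
  here: the averaged factor is nonzero at 0, hence near 0, and can be cancelled.\<close>

lemma base:
  assumes x: "x \<in> set_pmf p" and x1: "x\<^sub>1 \<in> set_pmf p" "x\<^sub>1 - x \<in> F"
  shows "\<forall>\<^sub>F s in nhds 0. f x s * of_real (pmf p x\<^sub>1) = f x\<^sub>1 s * of_real (pmf p x)"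
proof -
  obtain y where y: "y \<in> set_pmf q" using set_pmf_not_empty[of q] by blast
  obtain R where R: "\<And>x\<^sub>1 s. x\<^sub>1 - x \<in> F \<Longrightarrow> f x\<^sub>1 (S1 s) * (\<Sum>\<psi>\<in>F. g (y + \<psi>) (S2 s)) = R s"
    using averaged[OF x y] by blast
  have "\<forall>\<^sub>F s in nhds 0. (\<Sum>\<psi>\<in>F. g (y + \<psi>) (S2 s)) \<noteq> 0"
  proof (rule eventually_nhds_nonzero[OF S2, of "\<lambda>s. \<Sum>\<psi>\<in>F. g (y + \<psi>) s"])
    show "continuous_on UNIV (\<lambda>s. \<Sum>\<psi>\<in>F. g (y + \<psi>) s)" by (intro continuous_on_sum cont_g)
    have "(\<Sum>\<psi>\<in>F. g (y + \<psi>) 0) = (\<Sum>\<psi>\<in>F. of_real (pmf q y))"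
      using invq by (intro sum.cong) (auto simp: g0 shift_inv_def)
    moreover have "card F \<noteq> 0" using finF sgF by (auto simp: add_subgroup_def)
    moreover have "pmf q y \<noteq> 0" using y by (simp add: set_pmf_iff)
    ultimately show "(\<Sum>\<psi>\<in>F. g (y + \<psi>) 0) \<noteq> 0" by simp
  qed
  moreover have "x - x \<in> F" using sgF by (simp add: add_subgroup_def)
  ultimately have "\<forall>\<^sub>F s in nhds 0. f x (S1 s) = f x\<^sub>1 (S1 s)"
    using R[OF \<open>x - x \<in> F\<close>] R[OF x1(2)] by (auto elim!: eventually_mono) (metis mult_right_cancel)
  from eventually_nhds_linear[OF S1, where P = "\<lambda>s. f x s = f x\<^sub>1 s", OF this]
  have ev: "\<forall>\<^sub>F s in nhds 0. f x s = f x\<^sub>1 s" .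
  have "pmf p (x + (x\<^sub>1 - x)) = pmf p x" using invp x1(2) unfolding shift_inv_def by blast
  then show ?thesis using ev by simp
qed

text \<open>The partner equations of \<open>x\<close> and \<open>x\<^sub>1\<close> are taken with
  the same \<open>y\<close>. Their right sides involve \<open>y'\<close> and \<open>y1'\<close>,
  whose difference needs one doubling less to enter \<open>F\<close>, so by \<open>IH\<close> they
  are proportional near 0. The common factor \<open>g y\<close> does not vanish near 0 and is
  cancelled.\<close>

lemma step:
  assumes x: "x \<in> set_pmf p" and x1: "x\<^sub>1 \<in> set_pmf p" "dbl (Suc k) (x - x\<^sub>1) \<in> F"
    and IH: "\<And>y y\<^sub>1. y \<in> set_pmf q \<Longrightarrow> y\<^sub>1 \<in> set_pmf q \<Longrightarrow> dbl k (y - y\<^sub>1) \<in> F \<Longrightarrow>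
      \<forall>\<^sub>F s in nhds 0. g y s * of_real (pmf q y\<^sub>1) = g y\<^sub>1 s * of_real (pmf q y)"
  shows "\<forall>\<^sub>F s in nhds 0. f x s * of_real (pmf p x\<^sub>1) = f x\<^sub>1 s * of_real (pmf p x)"
proof -
  obtain y where y: "y \<in> set_pmf q" using set_pmf_not_empty[of q] by blast
  obtain x' y' where 1: "x' \<in> set_pmf p" "y' \<in> set_pmf q" "c y' = m x + n y"
    "\<And>s. f x (S1 s) * g y (S2 s) = \<theta> s * of_real (pmf p x') * g y' (S3 s)"
    using partner[OF x y] by blast
  obtain x1' y1' where 2: "x1' \<in> set_pmf p" "y1' \<in> set_pmf q" "c y1' = m x\<^sub>1 + n y"
    "\<And>s. f x\<^sub>1 (S1 s) * g y (S2 s) = \<theta> s * of_real (pmf p x1') * g y1' (S3 s)"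
    using partner[OF x1(1) y] by blast
  have "c (dbl k (y' - y1')) = dbl k (m (x - x\<^sub>1))"
    using 1(3) 2(3) by (simp add: dbl_additive[OF add_c] additive.diff[OF add_c] additive.diff[OF add_m])
  then have "c (dbl k (y' - y1')) \<in> F" using m_dbl[OF x1(2)] by simp
  moreover have "dbl N (dbl k (y' - y1')) \<in> F"
    using dbl_subgroup[OF sgF suppq[OF 1(2) 2(2)], of k] by (simp add: dbl_dbl add.commute)
  ultimately have "dbl k (y' - y1') \<in> F" using c_reflects by blast
  from IH[OF 1(2) 2(2) this]
  have ev: "\<forall>\<^sub>F s in nhds 0. g y' s * of_real (pmf q y1') = g y1' s * of_real (pmf q y')" .
  have "continuous (at 0) S3" using S3 by (simp add: linear_continuous_at linear_linear)
  then have "filterlim S3 (nhds 0) (nhds 0)"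
    using linear_0[OF S3] by (metis continuous_at tendsto_at_iff_tendsto_nhds)
  from eventually_compose_filterlim[OF ev this]
  have ev3: "\<forall>\<^sub>F s in nhds 0. g y' (S3 s) * of_real (pmf q y1') = g y1' (S3 s) * of_real (pmf q y')" .
  have qy: "pmf q y \<noteq> 0" using y by (simp add: set_pmf_iff)
  have ev2: "\<forall>\<^sub>F s in nhds 0. g y (S2 s) \<noteq> 0"
    using qy by (intro eventually_nhds_nonzero[OF S2 cont_g]) (simp add: g0)
  have z: "S1 0 = 0" "S2 0 = 0" "S3 0 = 0" using linear_0 S1(1) S2 S3 by blast+
  \<comment> \<open>At \<open>s = 0\<close> the partner equations relate the atoms; this fixes the
    constants of proportionality.\<close>
  have e1: "complex_of_real (pmf p x) * of_real (pmf q y) = of_real (pmf p x') * of_real (pmf q y')"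
    using 1(4)[of 0] by (simp add: z f0 g0 \<theta>0)
  have e2: "complex_of_real (pmf p x\<^sub>1) * of_real (pmf q y) = of_real (pmf p x1') * of_real (pmf q y1')"
    using 2(4)[of 0] by (simp add: z f0 g0 \<theta>0)
  have "\<forall>\<^sub>F s in nhds 0. f x (S1 s) * of_real (pmf p x\<^sub>1) = f x\<^sub>1 (S1 s) * of_real (pmf p x)"
    using ev2 ev3
  proof eventually_elim
    fix s assume g: "g y (S2 s) \<noteq> 0" and g3: "g y' (S3 s) * of_real (pmf q y1') = g y1' (S3 s) * of_real (pmf q y')"
    have "(f x (S1 s) * of_real (pmf p x\<^sub>1)) * (g y (S2 s) * of_real (pmf q y)) =
        (f x (S1 s) * g y (S2 s)) * (of_real (pmf p x\<^sub>1) * of_real (pmf q y))" by (simp only: mult_ac)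
    also have "\<dots> = (\<theta> s * of_real (pmf p x') * of_real (pmf p x1')) * (g y' (S3 s) * of_real (pmf q y1'))"
      unfolding 1(4) e2 by (simp only: mult_ac)
    also have "\<dots> = (\<theta> s * of_real (pmf p x1') * g y1' (S3 s)) * (of_real (pmf p x') * of_real (pmf q y'))"
      unfolding g3 by (simp only: mult_ac)
    also have "\<dots> = (f x\<^sub>1 (S1 s) * of_real (pmf p x)) * (g y (S2 s) * of_real (pmf q y))"
      unfolding 2(4)[symmetric] e1[symmetric] by (simp only: mult_ac)
    finally show "f x (S1 s) * of_real (pmf p x\<^sub>1) = f x\<^sub>1 (S1 s) * of_real (pmf p x)"
      using g qy by simp
  qed
  from eventually_nhds_linear[OF S1, where P = "\<lambda>s. f x s * of_real (pmf p x\<^sub>1) = f x\<^sub>1 s * of_real (pmf p x)", OF this]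
  show ?thesis .
qed

end

text \<open>Each half lowers the order of a difference by one factor \<open>2\<close> and hands it to the other half.\<close>

lemma descent:
  assumes P: "descent_half p q f g F c m n N S1 S2 S3 \<theta>"
    and Q: "descent_half q p g f F c m' n' N T1 T2 T3 \<theta>'"
    and x: "x \<in> set_pmf p" "x\<^sub>1 \<in> set_pmf p"
  shows "\<forall>\<^sub>F s in nhds 0. f x s * of_real (pmf p x\<^sub>1) = f x\<^sub>1 s * of_real (pmf p x)"
    and "y \<in> set_pmf q \<Longrightarrow> y\<^sub>1 \<in> set_pmf q \<Longrightarrow> \<forall>\<^sub>F s in nhds 0. g y s * of_real (pmf q y\<^sub>1) = g y\<^sub>1 s * of_real (pmf q y)"
proof -
  interpret P: descent_half p q f g F c m n N S1 S2 S3 \<theta> by (rule P)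
  interpret Q: descent_half q p g f F c m' n' N T1 T2 T3 \<theta>' by (rule Q)
  have swap: "v - u \<in> F" if "u - v \<in> F" for u v
    using that P.sgF unfolding add_subgroup_def by (metis minus_diff_eq)
  have main: "(\<forall>x x\<^sub>1. x \<in> set_pmf p \<longrightarrow> x\<^sub>1 \<in> set_pmf p \<longrightarrow> dbl k (x - x\<^sub>1) \<in> F \<longrightarrow>
      (\<forall>\<^sub>F s in nhds 0. f x s * of_real (pmf p x\<^sub>1) = f x\<^sub>1 s * of_real (pmf p x))) \<and>
    (\<forall>y y\<^sub>1. y \<in> set_pmf q \<longrightarrow> y\<^sub>1 \<in> set_pmf q \<longrightarrow> dbl k (y - y\<^sub>1) \<in> F \<longrightarrow>
      (\<forall>\<^sub>F s in nhds 0. g y s * of_real (pmf q y\<^sub>1) = g y\<^sub>1 s * of_real (pmf q y)))" for k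
  proof (induction k)
    case 0
    show ?case using P.base Q.base swap by auto
  next
    case (Suc k)
    show ?case using P.step[of _ _ k] Q.step[of _ _ k] Suc.IH by blast
  qed
  show "\<forall>\<^sub>F s in nhds 0. f x s * of_real (pmf p x\<^sub>1) = f x\<^sub>1 s * of_real (pmf p x)"
    using main[of N] x Q.suppq[OF x] by blast
  show "\<forall>\<^sub>F s in nhds 0. g y s * of_real (pmf q y\<^sub>1) = g y\<^sub>1 s * of_real (pmf q y)"
    if "y \<in> set_pmf q" "y\<^sub>1 \<in> set_pmf q"
    using main[of N] that P.suppq[OF that] by blast
qed

section \<open>From conditional symmetry to joint laws\<close>

text \<open>Both conditional expectations are integrated over an event of the \<sigma>-algebra
  generated by \<open>L\<^sub>1\<close>. The type class ties no topology to the group operations, so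
  measurability of the negated statistic enters as an assumption.\<close>

lemma cond_symmetric_measure:
  fixes L\<^sub>1 L\<^sub>2 :: "'w \<Rightarrow> 'a::{topological_space, ab_group_add}"
  assumes M: "prob_space M"
    and L [measurable]: "L\<^sub>1 \<in> borel_measurable M" "L\<^sub>2 \<in> borel_measurable M" "(\<lambda>\<omega>. - L\<^sub>2 \<omega>) \<in> borel_measurable M"
    and sym: "cond_symmetric M L\<^sub>1 L\<^sub>2" and C: "C \<in> sets borel" and B [measurable]: "B \<in> sets borel"
  shows "measure M {\<omega> \<in> space M. L\<^sub>1 \<omega> \<in> C \<and> L\<^sub>2 \<omega> \<in> B} = measure M {\<omega> \<in> space M. L\<^sub>1 \<omega> \<in> C \<and> - L\<^sub>2 \<omega> \<in> B}"
proof -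
  interpret prob_space M by fact
  define G where "G = vimage_algebra (space M) L\<^sub>1 borel"
  have setsG: "sets G = {L\<^sub>1 -` A \<inter> space M |A. A \<in> sets borel}"
    unfolding G_def by (intro sets_vimage_algebra2) auto
  have sub: "subalgebra M G"
    unfolding subalgebra_def setsG using L(1) by (auto simp: G_def measurable_sets)
  interpret finite_measure_subalgebra M G by unfold_locales (rule sub)
  define A where "A = L\<^sub>1 -` C \<inter> space M"
  have A: "A \<in> sets G" unfolding setsG A_def using C by blast
  have AM [measurable]: "A \<in> sets M" using A sub by (auto simp: subalgebra_def)
  have int: "integrable M (\<lambda>\<omega>. indicator B (f \<omega>) :: real)" if [measurable]: "f \<in> borel_measurable M" for f :: "'w \<Rightarrow> 'a"
    by (intro integrable_const_bound[where B = 1]) (auto simp: indicator_def)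
  have meas: "(\<integral>\<omega>\<in>A. indicat_real B (f \<omega>) \<partial>M) = measure M {\<omega> \<in> space M. L\<^sub>1 \<omega> \<in> C \<and> f \<omega> \<in> B}"
    if [measurable]: "f \<in> borel_measurable M" for f :: "'w \<Rightarrow> 'a"
  proof -
    have "(\<integral>\<omega>\<in>A. indicat_real B (f \<omega>) \<partial>M) = (\<integral>\<omega>. indicat_real {\<omega> \<in> space M. L\<^sub>1 \<omega> \<in> C \<and> f \<omega> \<in> B} \<omega> \<partial>M)"
      unfolding set_lebesgue_integral_def
      by (intro Bochner_Integration.integral_cong) (auto simp: A_def indicator_def)
    moreover have "{\<omega> \<in> space M. L\<^sub>1 \<omega> \<in> C \<and> f \<omega> \<in> B} = A \<inter> {\<omega> \<in> space M. f \<omega> \<in> B}" by (auto simp: A_def)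
    ultimately show ?thesis by (simp add: Int_absorb2)
  qed
  have "AE \<omega> in M. real_cond_exp M G (\<lambda>\<omega>. indicator B (L\<^sub>2 \<omega>)) \<omega> = real_cond_exp M G (\<lambda>\<omega>. indicator B (- L\<^sub>2 \<omega>)) \<omega>"
    using sym B unfolding cond_symmetric_def G_def by blast
  then have "(\<integral>\<omega>\<in>A. real_cond_exp M G (\<lambda>\<omega>. indicator B (L\<^sub>2 \<omega>)) \<omega> \<partial>M) =
      (\<integral>\<omega>\<in>A. real_cond_exp M G (\<lambda>\<omega>. indicator B (- L\<^sub>2 \<omega>)) \<omega> \<partial>M)"
    unfolding set_lebesgue_integral_def by (intro integral_cong_AE) auto
  then have "(\<integral>\<omega>\<in>A. indicat_real B (L\<^sub>2 \<omega>) \<partial>M) = (\<integral>\<omega>\<in>A. indicat_real B (- L\<^sub>2 \<omega>) \<partial>M)"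
    using real_cond_exp_intA[OF int[OF L(2)] A] real_cond_exp_intA[OF int[OF L(3)] A] by simp
  then show ?thesis using meas[OF L(2)] meas[OF L(3)] by simp
qed

section \<open>Distributions on a product with a discrete group\<close>

lemma sets_borel_discrete: "sets (borel :: 'd::discrete_topology measure) = UNIV"
proof -
  have "A \<in> sets borel" for A :: "'d set" by (rule borel_open) (rule discrete_topology_class.open_discrete)
  then show ?thesis by auto
qed

lemma measurable_borel_discrete:
  "measurable M (borel :: 'd::discrete_topology measure) = measurable M (count_space UNIV)"
  by (rule measurable_cong_sets) (simp_all add: sets_borel_discrete)

lemma measurable_from_borel_discrete [measurable]:
  fixes f :: "'d::discrete_topology \<Rightarrow> 'b"
  shows "f \<in> measurable borel (count_space UNIV)"
proof -
  have "measurable (borel :: 'd measure) (count_space (UNIV :: 'b set)) = measurable (count_space UNIV) (count_space UNIV)"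
    by (rule measurable_cong_sets) (simp_all add: sets_borel_discrete)
  then show ?thesis by simp
qed

definition law :: "'w measure \<Rightarrow> ('w \<Rightarrow> 'd::countable) \<Rightarrow> 'd pmf" where
  "law M X = Abs_pmf (distr M (count_space UNIV) X)"

context prob_space
begin

lemma measure_pmf_law:
  fixes X :: "'a \<Rightarrow> 'd::countable"
  assumes [measurable]: "X \<in> measurable M (count_space UNIV)"
  shows "measure_pmf (law M X) = distr M (count_space UNIV) X"
  unfolding law_def
proof (rule Abs_pmf_inverse, safe)
  let ?D = "distr M (count_space UNIV) X"
  interpret D: prob_space ?D by (rule prob_space_distr) simp
  show "prob_space ?D" by unfold_locales
  have "AE x in ?D. \<forall>y\<in>{y. measure ?D {y} = 0}. x \<noteq> y"
    by (subst AE_ball_countable) (auto intro!: AE_I[of _ _ "{y}" for y] simp: D.emeasure_eq_measure)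
  then show "AE x in ?D. measure ?D {x} \<noteq> 0" by (auto elim!: eventually_mono)
qed auto

lemma pmf_law:
  assumes [measurable]: "X \<in> measurable M (count_space UNIV)"
  shows "pmf (law M X) x = prob {\<omega> \<in> space M. X \<omega> = x}"
  unfolding pmf.rep_eq measure_pmf_law[OF assms]
  by (simp add: measure_distr vimage_def Int_def conj_commute)

lemma map_pmf_law:
  fixes X :: "'a \<Rightarrow> 'd::countable" and f :: "'d \<Rightarrow> 'e::countable"
  assumes [measurable]: "X \<in> measurable M (count_space UNIV)"
  shows "map_pmf f (law M X) = law M (\<lambda>\<omega>. f (X \<omega>))"
proof (rule pmf_eqI)
  fix y
  have "pmf (map_pmf f (law M X)) y = measure (law M X) (f -` {y})" by (simp add: pmf_map)
  also have "\<dots> = prob {\<omega> \<in> space M. f (X \<omega>) = y}"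
    by (simp add: measure_pmf_law measure_distr vimage_def Int_def conj_commute)
  also have "\<dots> = pmf (law M (\<lambda>\<omega>. f (X \<omega>))) y" by (subst pmf_law) auto
  finally show "pmf (map_pmf f (law M X)) y = pmf (law M (\<lambda>\<omega>. f (X \<omega>))) y" .
qed

lemma measurable_pair_countable:
  fixes X :: "'a \<Rightarrow> 'd::countable" and Y :: "'a \<Rightarrow> 'e::countable"
  assumes [measurable]: "X \<in> measurable M (count_space UNIV)" "Y \<in> measurable M (count_space UNIV)"
  shows "(\<lambda>\<omega>. (X \<omega>, Y \<omega>)) \<in> measurable M (count_space UNIV)"
proof -
  have "(\<lambda>\<omega>. (X \<omega>, Y \<omega>)) \<in> measurable M (count_space UNIV \<Otimes>\<^sub>M count_space UNIV)" by measurable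
  then show ?thesis by (simp add: pair_measure_countable)
qed

lemma pair_pmf_law:
  fixes X Y :: "'a \<Rightarrow> 'd::countable"
  assumes ind: "indep_var (count_space UNIV) X (count_space UNIV) Y"
  shows "pair_pmf (law M X) (law M Y) = law M (\<lambda>\<omega>. (X \<omega>, Y \<omega>))"
proof (rule pmf_eqI)
  fix z :: "'d \<times> 'd"
  obtain x y where z: "z = (x, y)" by (cases z)
  have m[measurable]: "X \<in> measurable M (count_space UNIV)" "Y \<in> measurable M (count_space UNIV)"
    using indep_var_rv1[OF ind] indep_var_rv2[OF ind] .
  have "pmf (law M (\<lambda>\<omega>. (X \<omega>, Y \<omega>))) z = prob {\<omega> \<in> space M. X \<omega> = x \<and> Y \<omega> = y}"
    by (subst pmf_law[OF measurable_pair_countable[OF m]]) (simp add: z)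
  also have "{\<omega> \<in> space M. X \<omega> = x \<and> Y \<omega> = y} = (\<lambda>\<omega>. (X \<omega>, Y \<omega>)) -` ({x} \<times> {y}) \<inter> space M" by auto
  also have "prob \<dots> = prob (X -` {x} \<inter> space M) * prob (Y -` {y} \<inter> space M)"
    using ind by (rule indep_varD) auto
  also have "\<dots> = pmf (pair_pmf (law M X) (law M Y)) z"
    by (simp add: z pmf_pair pmf_law vimage_def Int_def conj_commute)
  finally show "pmf (pair_pmf (law M X) (law M Y)) z = pmf (law M (\<lambda>\<omega>. (X \<omega>, Y \<omega>))) z" by simp
qed

lemma heyde_pair_law:
  fixes X Y :: "'a \<Rightarrow> 'd::{countable, ab_group_add}"
  assumes ind: "indep_var (count_space UNIV) X (count_space UNIV) Y"
    and b: "Modules.additive b" "\<And>x. b x = 0 \<Longrightarrow> x = 0" "\<And>x. x + b x = 0 \<Longrightarrow> x = 0"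
    and sym: "\<And>u v. prob {\<omega> \<in> space M. X \<omega> + Y \<omega> = u \<and> X \<omega> + b (Y \<omega>) = v} =
      prob {\<omega> \<in> space M. X \<omega> + Y \<omega> = u \<and> - (X \<omega> + b (Y \<omega>)) = v}"
  shows "heyde_pair (law M X) (law M Y) b"
proof
  have m[measurable]: "X \<in> measurable M (count_space UNIV)" "Y \<in> measurable M (count_space UNIV)"
    using indep_var_rv1[OF ind] indep_var_rv2[OF ind] .
  note mp [measurable] = measurable_pair_countable[OF m]
  define L1 where "L1 \<omega> = X \<omega> + Y \<omega>" for \<omega>
  define L2 where "L2 \<omega> = X \<omega> + b (Y \<omega>)" for \<omega>
  have c: "(\<lambda>\<omega>. f (X \<omega>, Y \<omega>)) \<in> measurable M (count_space UNIV)" for f :: "'d \<times> 'd \<Rightarrow> 'd"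
    by (rule measurable_compose[OF mp]) simp
  have ml: "L1 \<in> measurable M (count_space UNIV)" "L2 \<in> measurable M (count_space UNIV)" "(\<lambda>\<omega>. - L2 \<omega>) \<in> measurable M (count_space UNIV)"
    using c[of "\<lambda>(x, y). x + y"] c[of "\<lambda>(x, y). x + b y"] c[of "\<lambda>(x, y). - (x + b y)"]
    by (simp_all add: L1_def[abs_def] L2_def[abs_def])
  have L: "law M (\<lambda>\<omega>. (L1 \<omega>, L2 \<omega>)) = law M (\<lambda>\<omega>. (L1 \<omega>, - L2 \<omega>))"
  proof (rule pmf_eqI)
    fix z :: "'d \<times> 'd"
    obtain u v where z: "z = (u, v)" by (cases z)
    show "pmf (law M (\<lambda>\<omega>. (L1 \<omega>, L2 \<omega>))) z = pmf (law M (\<lambda>\<omega>. (L1 \<omega>, - L2 \<omega>))) z"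
      using sym[of u v] pmf_law[OF measurable_pair_countable[OF ml(1,2)], of z] pmf_law[OF measurable_pair_countable[OF ml(1,3)], of z]
      by (simp add: z L1_def L2_def)
  qed
  note b_simps = additive.add[OF b(1)] additive.diff[OF b(1)] additive.minus[OF b(1)]
  have "map_pmf (\<lambda>(x, y). (x + b x) + (b y + b y)) (pair_pmf (law M X) (law M Y)) =
      law M (\<lambda>\<omega>. b (L1 \<omega>) + L2 \<omega>)"
    unfolding pair_pmf_law[OF ind] map_pmf_law[OF mp] by (simp add: L1_def L2_def b_simps add_ac)
  also have "\<dots> = map_pmf (\<lambda>(u, v). b u + v) (law M (\<lambda>\<omega>. (L1 \<omega>, L2 \<omega>)))"
    by (simp add: map_pmf_law[OF measurable_pair_countable[OF ml(1,2)]])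
  also have "\<dots> = law M (\<lambda>\<omega>. b (L1 \<omega>) + - L2 \<omega>)"
    unfolding L by (simp add: map_pmf_law[OF measurable_pair_countable[OF ml(1,3)]])
  also have "\<dots> = map_pmf (\<lambda>x. b x - x) (law M X)"
    by (simp add: map_pmf_law[OF m(1)] L1_def L2_def b_simps)
  finally show "map_pmf (\<lambda>(x, y). (x + b x) + (b y + b y)) (pair_pmf (law M X) (law M Y)) =
      map_pmf (\<lambda>x. b x - x) (law M X)" .
  have "map_pmf (\<lambda>(y, x). (y + b y) + (x + x)) (pair_pmf (law M Y) (law M X)) =
      law M (\<lambda>\<omega>. L1 \<omega> + L2 \<omega>)"
    unfolding pair_commute_pmf[of "law M Y"] pair_pmf_law[OF ind] pmf.map_comp o_def map_pmf_law[OF mp]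
    by (simp add: map_pmf_law[OF measurable_pair_countable[OF m(2,1)]] L1_def L2_def b_simps add_ac)
  also have "\<dots> = map_pmf (\<lambda>(u, v). u + v) (law M (\<lambda>\<omega>. (L1 \<omega>, L2 \<omega>)))"
    by (simp add: map_pmf_law[OF measurable_pair_countable[OF ml(1,2)]])
  also have "\<dots> = law M (\<lambda>\<omega>. L1 \<omega> + - L2 \<omega>)"
    unfolding L by (simp add: map_pmf_law[OF measurable_pair_countable[OF ml(1,3)]])
  also have "\<dots> = map_pmf (\<lambda>y. y - b y) (law M Y)"
    by (simp add: map_pmf_law[OF m(2)] L1_def L2_def b_simps)
  finally show "map_pmf (\<lambda>(y, x). (y + b y) + (x + x)) (pair_pmf (law M Y) (law M X)) =
      map_pmf (\<lambda>y. y - b y) (law M Y)" .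
  show "b (x + y) = b x + b y" for x y by (rule additive.add[OF b(1)])
qed (fact b(2) b(3))+

end

section \<open>Orders of elements, Haar distributions and factorization on a discrete group\<close>

text \<open>The least positive period of \<open>t\<close> divides \<open>2 ^ N\<close>, by division
  with remainder on the multiples \<open>S\<close>, and a divisor of a power of 2 is one
  itself.\<close>

lemma two_component_dbl:
  assumes "dbl N t = 0"
  shows "t \<in> two_component"
proof -
  define S where "S m = (\<Sum>i<m. t)" for m :: nat
  have S: "S (i + j) = S i + S j" for i j
    by (induction j) (simp_all add: S_def add.assoc)
  have S0: "S 0 = 0" by (simp add: S_def)
  have S2: "S (2 ^ k) = dbl k t" for k
    by (induction k) (simp_all add: S_def[of 1] S_def[of "Suc 0"] dbl_Suc mult_2 S)
  have Sm: "S (i * j) = 0" if "S i = 0" for i j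
    by (induction j) (simp_all add: S0 S that)
  define m where "m = (LEAST m. 0 < m \<and> S m = 0)"
  have "0 < (2::nat) ^ N \<and> S (2 ^ N) = 0" using assms by (simp add: S2)
  then have m: "0 < m \<and> S m = 0" unfolding m_def by (rule LeastI)
  have least: "S k \<noteq> 0" if "0 < k" "k < m" for k
    using not_less_Least[of k "\<lambda>m. 0 < m \<and> S m = 0"] that by (auto simp: m_def)
  have "S (2 ^ N mod m) = 0"
  proof -
    have "S (m * (2 ^ N div m) + 2 ^ N mod m) = 0" using assms by (simp add: S2)
    then show ?thesis using S[of "m * (2 ^ N div m)" "2 ^ N mod m"] Sm[of m "2 ^ N div m"] m by simp
  qed
  moreover have "2 ^ N mod m < m" using m by simp
  ultimately have "2 ^ N mod m = 0" using least by blast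
  then have "m dvd 2 ^ N" by auto
  then obtain k where "m = 2 ^ k" using divides_primepow_nat[of 2 m N] two_is_prime_nat by blast
  then have "has_order t (2 ^ k)" using m least by (auto simp: has_order_def S_def)
  then show ?thesis by (auto simp: two_component_def)
qed

lemma not_has_order_2:
  assumes "\<And>u. u \<in> F \<Longrightarrow> u + u = 0 \<Longrightarrow> u = 0" "x \<in> F"
  shows "\<not> has_order x 2"
proof
  assume h: "has_order x 2"
  have "(\<Sum>i<2::nat. x) = 0" using h by (simp add: has_order_def)
  then have "x = 0" using assms by (simp add: numeral_2_eq_2)
  moreover have "(\<Sum>i<1::nat. x) \<noteq> 0" using h unfolding has_order_def by (metis one_less_numeral_iff semiring_norm(76) zero_less_one)
  ultimately show False by simp
qed

lemma distribution_measure_pmf: "distribution (measure_pmf p :: 'd::discrete_topology measure)"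
  by (simp add: distribution_def measure_pmf.prob_space_axioms sets_borel_discrete)

lemma measure_eqI_singletons:
  fixes \<mu> \<nu> :: "'d::{countable, discrete_topology} measure"
  assumes "sets \<mu> = sets borel" "sets \<nu> = sets borel" "\<And>x. emeasure \<mu> {x} = emeasure \<nu> {x}"
  shows "\<mu> = \<nu>"
  by (rule measure_eqI_countable[of _ UNIV]) (use assms in \<open>auto simp: sets_borel_discrete\<close>)

text \<open>Uniqueness behind the definite description: invariance makes all atoms in
  \<open>F\<close> equal, and mass 1 on \<open>F\<close> leaves nothing outside.\<close>

lemma haar_distr_finite:
  fixes F :: "'d::{countable, discrete_topology, ab_group_add} set"
  assumes F: "finite F" "add_subgroup F"
  shows "haar_distr F = measure_pmf (pmf_of_set F)"
  unfolding haar_distr_def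
proof (rule the_equality)
  have ne: "F \<noteq> {}" using F(2) by (auto simp: add_subgroup_def)
  have cF: "card F \<noteq> 0" using F ne by auto
  have shift: "distr m borel (\<lambda>y. x + y) = m \<longleftrightarrow> (\<forall>z. emeasure m {z - x} = emeasure m {z})"
    if "sets m = sets borel" for m :: "'d measure" and x
  proof -
    have sp: "space m = UNIV" using sets_eq_imp_space_eq[OF that] by simp
    have mm: "(\<lambda>y. x + y) \<in> measurable m borel"
      by (rule measurableI) (auto simp: that sets_borel_discrete)
    have e: "emeasure (distr m borel (\<lambda>y. x + y)) {z} = emeasure m {z - x}" for z
    proof -
      have "(\<lambda>y. x + y) -` {z} \<inter> space m = {z - x}" by (auto simp: sp algebra_simps)
      then show ?thesis using mm by (simp add: emeasure_distr sets_borel_discrete)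
    qed
    show ?thesis
    proof
      assume "distr m borel (\<lambda>y. x + y) = m"
      then show "\<forall>z. emeasure m {z - x} = emeasure m {z}" using e by metis
    next
      assume "\<forall>z. emeasure m {z - x} = emeasure m {z}"
      then show "distr m borel (\<lambda>y. x + y) = m"
        by (intro measure_eqI_singletons) (auto simp: that e)
    qed
  qed
  show "distribution (measure_pmf (pmf_of_set F)) \<and> emeasure (measure_pmf (pmf_of_set F)) F = 1 \<and>
    (\<forall>x\<in>F. distr (measure_pmf (pmf_of_set F)) borel (\<lambda>y. x + y) = measure_pmf (pmf_of_set F))"
  proof (intro conjI ballI)
    show "distribution (measure_pmf (pmf_of_set F))" by (rule distribution_measure_pmf)
    show "emeasure (measure_pmf (pmf_of_set F)) F = 1" using F ne by (simp add: emeasure_pmf_of_set_space)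
    fix x assume x: "x \<in> F"
    have "z - x \<in> F \<longleftrightarrow> z \<in> F" for z
      using F(2) x add_subgroup_diff[OF F(2), of z x] unfolding add_subgroup_def by (metis diff_add_cancel)
    then have "pmf (pmf_of_set F) (z - x) = pmf (pmf_of_set F) z" for z
      using F ne by (simp add: pmf_of_set indicator_def)
    then show "distr (measure_pmf (pmf_of_set F)) borel (\<lambda>y. x + y) = measure_pmf (pmf_of_set F)"
      by (subst shift) (auto simp: sets_borel_discrete emeasure_pmf_single)
  qed
  fix m :: "'d measure" assume m: "distribution m \<and> emeasure m F = 1 \<and> (\<forall>x\<in>F. distr m borel (\<lambda>y. x + y) = m)"
  then interpret prob_space m by (simp add: distribution_def)
  have sm: "sets m = sets borel" using m by (simp add: distribution_def)
  have sU: "sets m = UNIV" using sm by (simp add: sets_borel_discrete)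
  have inF: "prob {z} = prob {0}" if "z \<in> F" for z
  proof -
    have "emeasure m {z - z} = emeasure m {z}" using m shift[OF sm, of z] that by blast
    then show ?thesis by (simp add: emeasure_eq_measure)
  qed
  have F1: "prob F = 1" using m by (simp add: emeasure_eq_measure)
  have "prob F = (\<Sum>z\<in>F. prob {z})" using F(1) by (intro finite_measure_eq_sum_singleton) (auto simp: sU)
  then have "real (card F) * prob {0} = 1" using F1 inF by simp
  then have p0: "prob {0} = 1 / real (card F)" using cF by (simp add: field_simps)
  have out: "prob {z} = 0" if "z \<notin> F" for z
  proof -
    have "prob (F \<union> {z}) = prob F + prob {z}" using that by (intro finite_measure_Union) (auto simp: sU)
    moreover have "prob (F \<union> {z}) \<le> 1" by simp
    ultimately show ?thesis using F1 measure_nonneg[of m "{z}"] by linarith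
  qed
  show "m = measure_pmf (pmf_of_set F)"
  proof (rule measure_eqI_singletons[OF sm])
    show "sets (measure_pmf (pmf_of_set F)) = sets borel" by (simp add: sets_borel_discrete)
    fix z
    have "prob {z} = pmf (pmf_of_set F) z"
      using F ne inF[of z] out[of z] p0 by (simp add: pmf_of_set indicator_def)
    then show "emeasure m {z} = emeasure (measure_pmf (pmf_of_set F)) {z}"
      by (simp add: emeasure_eq_measure emeasure_pmf_single)
  qed
qed

abbreviation conv_pmf :: "'d::ab_group_add pmf \<Rightarrow> 'd pmf \<Rightarrow> 'd pmf" where
  "conv_pmf p q \<equiv> map_pmf (\<lambda>(x, y). x + y) (pair_pmf p q)"

lemma convol_pmf:
  fixes p q :: "'d::{countable, discrete_topology, ab_group_add} pmf"
  shows "measure_pmf p \<circledast> measure_pmf q = measure_pmf (conv_pmf p q)"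
proof -
  have s: "sets (measure_pmf p \<Otimes>\<^sub>M measure_pmf q) = UNIV"
  proof -
    have "sets (measure_pmf p \<Otimes>\<^sub>M measure_pmf q) = sets (count_space (UNIV :: 'd set) \<Otimes>\<^sub>M count_space (UNIV :: 'd set))"
      by (rule sets_pair_measure_cong) auto
    then show ?thesis unfolding pair_measure_countable[OF countableI_type countableI_type] by simp
  qed
  have meas: "(\<lambda>(x, y). x + y) \<in> measurable (measure_pmf p \<Otimes>\<^sub>M measure_pmf q) (borel :: 'd measure)"
    by (rule measurableI) (auto simp: s)
  show ?thesis unfolding convol_def
  proof (rule measure_eqI_singletons)
    fix z :: 'd
    have "emeasure (distr (measure_pmf p \<Otimes>\<^sub>M measure_pmf q) borel (\<lambda>(x, y). x + y)) {z} =
        emeasure (measure_pmf p \<Otimes>\<^sub>M measure_pmf q) ((\<lambda>(x, y). x + y) -` {z})"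
      using meas by (subst emeasure_distr) (auto simp: sets_borel_discrete space_pair_measure)
    also have "\<dots> = (\<integral>\<^sup>+x. \<integral>\<^sup>+y. indicator ((\<lambda>(x, y). x + y) -` {z}) (x, y) \<partial>q \<partial>p)"
      by (rule measure_pmf.emeasure_pair_measure) (simp add: s)
    also have "\<dots> = emeasure (measure_pmf (pair_pmf p q)) ((\<lambda>(x, y). x + y) -` {z})"
      by (simp add: nn_integral_pair_pmf'[symmetric])
    finally show "emeasure (distr (measure_pmf p \<Otimes>\<^sub>M measure_pmf q) borel (\<lambda>(x, y). x + y)) {z} =
        emeasure (measure_pmf (conv_pmf p q)) {z}" by simp
  qed (simp_all add: sets_borel_discrete)
qed

lemma return_borel_discrete: "return borel (g :: 'd::{countable, discrete_topology}) = measure_pmf (return_pmf g)"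
  by (rule measure_eqI_singletons) (auto simp: sets_borel_discrete emeasure_pmf_single indicator_def)

text \<open>On a finite group of odd order doubling is bijective, so each \<open>x - g\<close>
  splits into an element \<open>\<phi> x\<close> of \<open>F\<close> and a remainder killed by
  \<open>dbl N\<close>. The law of the remainder is \<rho>.\<close>

lemma shift_inv_factorization:
  fixes p :: "'d::ab_group_add pmf"
  assumes F: "finite F" "add_subgroup F" and odd: "\<And>u. u \<in> F \<Longrightarrow> u + u = 0 \<Longrightarrow> u = 0"
    and inv: "shift_inv F p" and supp: "\<And>x. x \<in> set_pmf p \<Longrightarrow> dbl N (x - g) \<in> F"
  shows "\<exists>\<rho>. (\<forall>t\<in>set_pmf \<rho>. dbl N t = 0) \<and>
    p = conv_pmf (conv_pmf \<rho> (pmf_of_set F)) (return_pmf g)"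
proof -
  have ne: "F \<noteq> {}" using F(2) by (auto simp: add_subgroup_def)
  have dF: "dbl N ` F = F"
  proof -
    have ker: "dbl k u = 0 \<Longrightarrow> u \<in> F \<Longrightarrow> u = 0" for k u
    proof (induction k)
      case (Suc k)
      have "dbl k u = 0"
        by (rule odd[OF dbl_subgroup[OF F(2) Suc.prems(2)]]) (use Suc.prems(1) in \<open>simp add: dbl_Suc\<close>)
      then show ?case using Suc by blast
    qed simp
    have "inj_on (dbl N) F"
    proof (rule inj_onI)
      fix u v assume "u \<in> F" "v \<in> F" "dbl N u = dbl N v"
      then show "u = v" using ker[of N "u - v"] add_subgroup_diff[OF F(2), of u v] by (simp add: dbl_diff)
    qed
    moreover have "dbl N ` F \<subseteq> F" using dbl_subgroup[OF F(2)] by blast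
    ultimately show ?thesis using F(1) endo_inj_surj by blast
  qed
  have "\<forall>x. \<exists>\<phi>. x \<in> set_pmf p \<longrightarrow> \<phi> \<in> F \<and> dbl N (x - g - \<phi>) = 0"
  proof
    fix x
    show "\<exists>\<phi>. x \<in> set_pmf p \<longrightarrow> \<phi> \<in> F \<and> dbl N (x - g - \<phi>) = 0"
    proof (cases "x \<in> set_pmf p")
      case True
      then have "dbl N (x - g) \<in> dbl N ` F" using supp dF by simp
      then obtain \<phi> where "\<phi> \<in> F" "dbl N (x - g) = dbl N \<phi>" by blast
      then have "dbl N (x - g - \<phi>) = 0" by (simp add: dbl_diff[of N "x - g"])
      then show ?thesis using \<open>\<phi> \<in> F\<close> by blast
    qed simp
  qed
  then obtain \<phi> where \<phi>: "\<And>x. x \<in> set_pmf p \<Longrightarrow> \<phi> x \<in> F" "\<And>x. x \<in> set_pmf p \<Longrightarrow> dbl N (x - g - \<phi> x) = 0"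
    by metis
  define \<rho> where "\<rho> = map_pmf (\<lambda>x. x - g - \<phi> x) p"
  define U where "U = pmf_of_set F"
  have U: "map_pmf (\<lambda>u. u - v) U = U" if "v \<in> F" for v
  proof -
    have "(\<lambda>u. u - v) ` F \<subseteq> F" using add_subgroup_diff[OF F(2)] that by blast
    moreover have inj: "inj_on (\<lambda>u. u - v) F" by (simp add: inj_on_def)
    ultimately have "(\<lambda>u. u - v) ` F = F" using F(1) endo_inj_surj by blast
    then show ?thesis unfolding U_def using map_pmf_of_set_inj[OF inj ne F(1)] by simp
  qed
  have "conv_pmf (conv_pmf \<rho> U) (return_pmf g) =
      bind_pmf p (\<lambda>x. map_pmf (\<lambda>u. x - \<phi> x + u) U)"
    unfolding \<rho>_def pair_pmf_def map_pmf_def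
    by (simp add: bind_assoc_pmf bind_return_pmf algebra_simps)
  \<comment> \<open>The uniform law on \<open>F\<close> absorbs the shift by
    \<open>\<phi> x\<close>; after exchanging the order, the invariance of \<open>p\<close> absorbs
    \<open>u\<close>.\<close>
  also have "\<dots> = bind_pmf p (\<lambda>x. map_pmf (\<lambda>u. x + u) U)"
  proof (rule bind_pmf_cong[OF refl])
    fix x assume "x \<in> set_pmf p"
    from U[OF \<phi>(1)[OF this]] have "map_pmf (\<lambda>u. x + u) U = map_pmf (\<lambda>u. x + u) (map_pmf (\<lambda>u. u - \<phi> x) U)" by simp
    then show "map_pmf (\<lambda>u. x - \<phi> x + u) U = map_pmf (\<lambda>u. x + u) U" by (simp add: pmf.map_comp o_def algebra_simps)
  qed
  also have "\<dots> = bind_pmf U (\<lambda>u. map_pmf (\<lambda>x. x + u) p)"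
    unfolding map_pmf_def by (rule bind_commute_pmf)
  also have "\<dots> = bind_pmf U (\<lambda>u. p)"
  proof (rule bind_pmf_cong[OF refl])
    fix u assume "u \<in> set_pmf U"
    then have u: "- u \<in> F" using F ne by (simp add: U_def add_subgroup_def)
    show "map_pmf (\<lambda>x. x + u) p = p"
    proof (rule pmf_eqI)
      fix z
      have "pmf (map_pmf (\<lambda>x. x + u) p) ((z + - u) + u) = pmf p (z + - u)"
        by (rule pmf_map_inj') (simp add: inj_def)
      moreover have "pmf p (z + - u) = pmf p z" using inv u unfolding shift_inv_def by blast
      ultimately show "pmf (map_pmf (\<lambda>x. x + u) p) z = pmf p z" by simp
    qed
  qed
  also have "\<dots> = p" by simp
  finally have eq: "p = conv_pmf (conv_pmf \<rho> U) (return_pmf g)" ..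
  have "dbl N t = 0" if "t \<in> set_pmf \<rho>" for t using that \<phi>(2) by (auto simp: \<rho>_def)
  then show ?thesis using eq unfolding U_def by blast
qed

section \<open>Automorphisms and Borel sets of the product\<close>

lemma additive_continuous_linear:
  fixes f :: "'a::real_normed_vector \<Rightarrow> 'b::real_normed_vector"
  assumes add: "Modules.additive f" and cont: "continuous_on UNIV f"
  shows "linear f"
proof (rule linearI)
  show "f (x + y) = f x + f y" for x y by (rule additive.add[OF add])
  fix r x
  have nat: "f (real k *\<^sub>R y) = real k *\<^sub>R f y" for k y
    by (induction k) (simp_all add: scaleR_add_left additive.add[OF add] additive.zero[OF add])
  have int: "f (of_int k *\<^sub>R y) = of_int k *\<^sub>R f y" for k :: int and y
  proof (cases k rule: int_cases2)
    case (nonneg n)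
    then show ?thesis using nat[of n y] by simp
  next
    case (nonpos n)
    then show ?thesis using nat[of n y] by (simp add: additive.minus[OF add])
  qed
  define q where "q n = of_int \<lfloor>r * real (Suc n)\<rfloor> / real (Suc n)" for n
  have q: "q n \<le> r" "r - inverse (real (Suc n)) \<le> q n" for n
  proof -
    show "q n \<le> r" by (simp add: q_def pos_divide_le_eq del: of_nat_Suc)
    have "r < (of_int \<lfloor>r * real (Suc n)\<rfloor> + 1) / real (Suc n)"
      by (simp add: pos_less_divide_eq del: of_nat_Suc)
    then show "r - inverse (real (Suc n)) \<le> q n" by (simp add: q_def add_divide_distrib inverse_eq_divide)
  qed
  have lim: "q \<longlonglongrightarrow> r"
  proof (rule tendsto_sandwich[of "\<lambda>n. r - inverse (real (Suc n))" q _ "\<lambda>_. r"])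
    have "(\<lambda>n. r - inverse (real (Suc n))) \<longlonglongrightarrow> r - 0"
      by (intro tendsto_intros LIMSEQ_inverse_real_of_nat)
    then show "(\<lambda>n. r - inverse (real (Suc n))) \<longlonglongrightarrow> r" by simp
  qed (use q in auto)
  have fq: "f (q n *\<^sub>R x) = q n *\<^sub>R f x" for n
  proof -
    define y where "y = inverse (real (Suc n)) *\<^sub>R x"
    have y: "real (Suc n) *\<^sub>R y = x" unfolding y_def by (simp del: of_nat_Suc)
    have "q n *\<^sub>R x = of_int \<lfloor>r * real (Suc n)\<rfloor> *\<^sub>R y" by (simp add: q_def y_def divide_inverse del: of_nat_Suc)
    then have "f (q n *\<^sub>R x) = of_int \<lfloor>r * real (Suc n)\<rfloor> *\<^sub>R f y" by (simp add: int)
    moreover have "f x = real (Suc n) *\<^sub>R f y" using nat[of "Suc n" y] y by simp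
    ultimately show ?thesis by (simp add: q_def del: of_nat_Suc)
  qed
  have "(\<lambda>n. f (q n *\<^sub>R x)) \<longlonglongrightarrow> f (r *\<^sub>R x)"
    by (rule continuous_on_tendsto_compose[OF cont]) (auto intro!: tendsto_intros lim)
  moreover have "(\<lambda>n. q n *\<^sub>R f x) \<longlonglongrightarrow> r *\<^sub>R f x" by (intro tendsto_intros lim)
  ultimately show "f (r *\<^sub>R x) = r *\<^sub>R f x" unfolding fq by (rule LIMSEQ_unique)
qed

text \<open>The connected component \<open>UNIV \<times> {0}\<close> of \<open>0\<close> is mapped into itself.\<close>

lemma top_automorphism_prod:
  fixes \<delta> :: "'a::euclidean_space \<times> 'd::{discrete_topology, ab_group_add} \<Rightarrow> 'a \<times> 'd"
  assumes aut: "top_automorphism \<delta>" and ker: "{x. x + \<delta> x = 0} = {0}"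
  obtains \<alpha> h \<beta> where "linear \<alpha>" "\<And>t. \<alpha> t = 0 \<Longrightarrow> t = 0" "\<And>t. t + \<alpha> t = 0 \<Longrightarrow> t = 0"
    "Modules.additive h" "Modules.additive \<beta>" "\<And>d. \<beta> d = 0 \<Longrightarrow> d = 0" "\<And>d. d + \<beta> d = 0 \<Longrightarrow> d = 0"
    "\<And>t d. \<delta> (t, d) = (\<alpha> t + h d, \<beta> d)"
proof -
  have add: "Modules.additive \<delta>" using aut by (simp add: top_automorphism_def)
  obtain \<delta>' where "homeomorphism UNIV UNIV \<delta> \<delta>'" using aut by (auto simp: top_automorphism_def)
  then have cont: "continuous_on UNIV \<delta>" and inv: "\<And>x. \<delta>' (\<delta> x) = x" by (auto simp: homeomorphism_def)
  have inj: "x = 0" if "\<delta> x = 0" for x using inv[of x] inv[of 0] that additive.zero[OF add] by simp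
  have ker0: "x = 0" if "x + \<delta> x = 0" for x using ker that by blast
  define \<alpha> where "\<alpha> t = fst (\<delta> (t, 0))" for t
  define h where "h d = fst (\<delta> (0, d))" for d
  define \<beta> where "\<beta> d = snd (\<delta> (0, d))" for d
  have \<delta>add: "\<delta> (x + y) = \<delta> x + \<delta> y" for x y by (rule additive.add[OF add])
  have c1: "continuous_on UNIV (\<lambda>t. \<delta> (t, 0))"
    by (rule continuous_on_compose2[OF cont]) (auto intro!: continuous_intros)
  have s0: "snd (\<delta> (t, 0)) = 0" for t
  proof (rule ccontr)
    assume n: "snd (\<delta> (t, 0)) \<noteq> 0"
    define S where "S = range (\<lambda>t. snd (\<delta> (t, 0)))"
    have "connected S" unfolding S_def
      by (intro connected_continuous_image continuous_on_snd c1 connected_UNIV)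
    moreover have "open {0::'d}" "open (- {0::'d})" by (rule discrete_topology_class.open_discrete)+
    ultimately have "{0} \<inter> S = {} \<or> - {0} \<inter> S = {}"
      by (intro connectedD) auto
    moreover have "0 \<in> S" unfolding S_def
      by (rule image_eqI[of _ _ 0]) (simp_all add: additive.zero[OF add] flip: zero_prod_def)
    moreover have "snd (\<delta> (t, 0)) \<in> S" by (simp add: S_def)
    ultimately show False using n by auto
  qed
  have \<delta>eq: "\<delta> (t, d) = (\<alpha> t + h d, \<beta> d)" for t d
  proof -
    have "\<delta> (t, d) = \<delta> (t, 0) + \<delta> (0, d)" unfolding \<delta>add[symmetric] by simp
    then show ?thesis by (simp add: prod_eq_iff \<alpha>_def h_def \<beta>_def s0)
  qed
  have a\<alpha>: "Modules.additive \<alpha>"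
    by standard (simp add: \<alpha>_def \<delta>add[symmetric] flip: fst_add)
  have lin: "linear \<alpha>"
    by (rule additive_continuous_linear[OF a\<alpha>]) (auto simp: \<alpha>_def intro!: continuous_on_fst c1)
  have ah: "Modules.additive h" by standard (simp add: h_def \<delta>add[symmetric] flip: fst_add)
  have a\<beta>: "Modules.additive \<beta>" by standard (simp add: \<beta>_def \<delta>add[symmetric] flip: snd_add)
  have k\<alpha>: "t = 0" if "\<alpha> t = 0" for t
  proof -
    have "\<delta> (t, 0) = 0" by (simp add: \<delta>eq that additive.zero[OF ah] additive.zero[OF a\<beta>] zero_prod_def)
    then show ?thesis using inj[of "(t, 0)"] by (simp add: zero_prod_def)
  qed
  have kI\<alpha>: "t = 0" if "t + \<alpha> t = 0" for t
  proof -
    have "(t, 0) + \<delta> (t, 0) = 0" by (simp add: \<delta>eq that additive.zero[OF ah] additive.zero[OF a\<beta>] zero_prod_def)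
    then show ?thesis using ker0[of "(t, 0)"] by (simp add: zero_prod_def)
  qed
  have surj\<alpha>: "\<exists>t. \<alpha> t = y" for y
    using linear_injective_imp_surjective[OF lin] linear_injective_0[OF lin] k\<alpha> by (metis surjD)
  have linI: "linear (\<lambda>t. t + \<alpha> t)" by (intro linear_compose_add linear_id[unfolded id_def] lin)
  have surjI\<alpha>: "\<exists>t. t + \<alpha> t = y" for y
    using linear_injective_imp_surjective[OF linI] linear_injective_0[OF linI] kI\<alpha> by (metis surjD)
  \<comment> \<open>A real component \<open>t\<close> with \<open>\<alpha> t = - h d\<close>
    compensates the off-diagonal part, so an element of the kernel of \<beta> lifts to one of the
    kernel of \<delta>. The same works for I + \<beta>.\<close>
  have k\<beta>: "d = 0" if "\<beta> d = 0" for d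
  proof -
    obtain t where "\<alpha> t = - h d" using surj\<alpha> by blast
    then have "\<delta> (t, d) = 0" by (simp add: \<delta>eq that zero_prod_def)
    then show ?thesis using inj[of "(t, d)"] by (simp add: zero_prod_def)
  qed
  have kI\<beta>: "d = 0" if "d + \<beta> d = 0" for d
  proof -
    obtain t where t: "t + \<alpha> t = - h d" using surjI\<alpha> by blast
    have "t + (\<alpha> t + h d) = 0" using t by (simp add: add.assoc[symmetric])
    then have "(t, d) + \<delta> (t, d) = 0" by (simp add: \<delta>eq that zero_prod_def)
    then show ?thesis using ker0[of "(t, d)"] by (simp add: zero_prod_def)
  qed
  show ?thesis using that[OF lin k\<alpha> kI\<alpha> ah a\<beta> k\<beta> kI\<beta> \<delta>eq] .
qed

lemma measurable_fst_borel [measurable]: "(fst :: 'a::topological_space \<times> 'd::topological_space \<Rightarrow> 'a) \<in> borel_measurable borel"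
  by (intro borel_measurable_continuous_onI continuous_on_fst continuous_on_id)

lemma measurable_snd_discrete [measurable]:
  "(snd :: 'a::topological_space \<times> 'd::discrete_topology \<Rightarrow> 'd) \<in> measurable borel (count_space UNIV)"
proof -
  have "(snd :: 'a \<times> 'd \<Rightarrow> 'd) \<in> borel_measurable borel"
    by (intro borel_measurable_continuous_onI continuous_on_snd continuous_on_id)
  then show ?thesis by (simp add: measurable_borel_discrete)
qed

text \<open>An open set of the product is a countable union of open slices, so \<open>'a\<close> may
  be any topological space.\<close>

lemma measurable_prod_discrete:
  fixes f :: "'w \<Rightarrow> 'a::topological_space" and g :: "'w \<Rightarrow> 'd::{countable, discrete_topology}"
  assumes [measurable]: "f \<in> borel_measurable M" "g \<in> measurable M (count_space UNIV)"
  shows "(\<lambda>\<omega>. (f \<omega>, g \<omega>)) \<in> borel_measurable M"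
proof (rule borel_measurableI)
  fix S :: "('a \<times> 'd) set" assume S: "open S"
  have o: "open ((\<lambda>x. (x, d)) -` S)" for d
    using S by (intro open_vimage continuous_on_Pair continuous_on_id continuous_on_const)
  have [measurable]: "(\<lambda>x. (x, d)) -` S \<in> sets borel" for d using o by (rule borel_open)
  have "(\<lambda>\<omega>. (f \<omega>, g \<omega>)) -` S \<inter> space M = (\<Union>d. {\<omega> \<in> space M. f \<omega> \<in> (\<lambda>x. (x, d)) -` S \<and> g \<omega> = d})"
    by auto
  moreover have "(\<Union>d. {\<omega> \<in> space M. f \<omega> \<in> (\<lambda>x. (x, d)) -` S \<and> g \<omega> = d}) \<in> sets M"
  proof (intro sets.countable_UN'' countableI_type)
    fix d
    have "{\<omega> \<in> space M. f \<omega> \<in> (\<lambda>x. (x, d)) -` S \<and> g \<omega> = d} =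
        (f -` ((\<lambda>x. (x, d)) -` S) \<inter> space M) \<inter> (g -` {d} \<inter> space M)" by auto
    also have "\<dots> \<in> sets M"
      by (intro sets.Int measurable_sets[OF assms(1)] measurable_sets[OF assms(2)] borel_open o) simp
    finally show "{\<omega> \<in> space M. f \<omega> \<in> (\<lambda>x. (x, d)) -` S \<and> g \<omega> = d} \<in> sets M" .
  qed
  ultimately show "(\<lambda>\<omega>. (f \<omega>, g \<omega>)) -` S \<inter> space M \<in> sets M" by simp
qed

lemma measurable_section: "S \<in> sets borel \<Longrightarrow> (\<lambda>x::'a::topological_space. (x, d::'d::topological_space)) -` S \<in> sets borel"
proof -
  assume S: "S \<in> sets borel"
  have "(\<lambda>x::'a. (x, d)) \<in> borel_measurable borel"
    by (intro borel_measurable_continuous_onI continuous_on_Pair continuous_on_id continuous_on_const)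
  from measurable_sets[OF this S] show ?thesis by simp
qed

lemma sets_slice [measurable]:
  fixes C :: "'a::topological_space set" and d :: "'d::{countable, discrete_topology}"
  assumes "C \<in> sets borel"
  shows "C \<times> {d} \<in> sets borel"
proof -
  have "C \<times> {d} = {z \<in> space borel. fst z \<in> C \<and> snd z = d}" by auto
  also have "\<dots> \<in> sets borel" using assms by measurable
  finally show ?thesis .
qed

lemma measure_eqI_slices:
  fixes \<mu> \<nu> :: "('a::topological_space \<times> 'd::{countable, discrete_topology}) measure"
  assumes s: "sets \<mu> = sets borel" "sets \<nu> = sets borel"
    and eq: "\<And>C d. C \<in> sets borel \<Longrightarrow> emeasure \<mu> (C \<times> {d}) = emeasure \<nu> (C \<times> {d})"
  shows "\<mu> = \<nu>"
proof (rule measure_eqI)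
  fix S assume "S \<in> sets \<mu>"
  then have S: "S \<in> sets borel" by (simp add: s)
  define P where "P d = ((\<lambda>x. (x, d)) -` S) \<times> {d}" for d
  have P: "P d \<in> sets borel" for d unfolding P_def by (intro sets_slice measurable_section S)
  have SP: "S = (\<Union>d. P d)" by (auto simp: P_def)
  have disj: "disjoint_family_on P UNIV" by (auto simp: disjoint_family_on_def P_def)
  have "emeasure \<mu> (\<Union>d. P d) = (\<integral>\<^sup>+d. emeasure \<mu> (P d) \<partial>count_space UNIV)"
    by (rule emeasure_UN_countable) (use P s disj in auto)
  also have "\<dots> = (\<integral>\<^sup>+d. emeasure \<nu> (P d) \<partial>count_space UNIV)"
    unfolding P_def by (intro nn_integral_cong eq measurable_section S)
  also have "\<dots> = emeasure \<nu> (\<Union>d. P d)"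
    by (rule emeasure_UN_countable[symmetric]) (use P s disj in auto)
  finally show "emeasure \<mu> S = emeasure \<nu> S" using SP by simp
qed (simp add: s)

section \<open>Convolution with laws carried by the discrete factor\<close>

text \<open>The product form of the slices is reproduced with the same \<open>g\<close>, so the
  lemma can be iterated over the three convolutions of the final formula.\<close>

lemma convol_on_snd:
  fixes \<mu> :: "('a::euclidean_space \<times> 'd::{countable, discrete_topology, ab_group_add}) measure" and r p :: "'d pmf"
  assumes \<mu>: "distribution \<mu>"
    and slices: "\<And>C x. C \<in> sets borel \<Longrightarrow> measure \<mu> (C \<times> {x}) = g C * pmf p x"
    and C: "C \<in> sets borel"
  shows "distribution (\<mu> \<circledast> on_snd (measure_pmf r))"
    and "measure (\<mu> \<circledast> on_snd (measure_pmf r)) (C \<times> {z}) = g C * pmf (conv_pmf p r) z"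
proof -
  interpret \<mu>: prob_space \<mu> using \<mu> by (simp add: distribution_def)
  have s\<mu> [measurable_cong]: "sets \<mu> = sets borel" using \<mu> by (simp add: distribution_def)
  have sp\<mu>: "space \<mu> = UNIV" using sets_eq_imp_space_eq[OF s\<mu>] by simp
  define \<nu> where "\<nu> = (on_snd (measure_pmf r) :: ('a \<times> 'd) measure)"
  have m\<nu> [measurable]: "(\<lambda>y. (0::'a, y)) \<in> measurable (measure_pmf r) borel"
    by (rule measurable_prod_discrete) auto
  interpret \<nu>: prob_space \<nu> unfolding \<nu>_def on_snd_def by (rule measure_pmf.prob_space_distr) measurable
  have s\<nu> [measurable_cong]: "sets \<nu> = sets borel" by (simp add: \<nu>_def on_snd_def)
  have sp\<nu>: "space \<nu> = UNIV" using sets_eq_imp_space_eq[OF s\<nu>] by simp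
  interpret pair_prob_space \<mu> \<nu> ..
  have sd: "(\<lambda>w. snd (fst w) + snd (snd w)) \<in> measurable (\<mu> \<Otimes>\<^sub>M \<nu>) (count_space UNIV)"
  proof -
    have "(\<lambda>w. (snd (fst w), snd (snd w))) \<in> measurable (\<mu> \<Otimes>\<^sub>M \<nu>) (count_space UNIV \<Otimes>\<^sub>M count_space UNIV)"
      by measurable
    then have "(\<lambda>w. (snd (fst w), snd (snd w))) \<in> measurable (\<mu> \<Otimes>\<^sub>M \<nu>) (count_space UNIV)"
      unfolding pair_measure_countable[OF countableI_type countableI_type] by simp
    from measurable_compose[OF this, of "\<lambda>(x, y). x + y" "count_space UNIV"] show ?thesis by simp
  qed
  have plus [measurable]: "(\<lambda>(x, y). x + y) \<in> measurable (\<mu> \<Otimes>\<^sub>M \<nu>) borel"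
  proof -
    have "(\<lambda>w. (fst (fst w) + fst (snd w), snd (fst w) + snd (snd w))) \<in> measurable (\<mu> \<Otimes>\<^sub>M \<nu>) borel"
      by (intro measurable_prod_discrete sd) measurable
    then show ?thesis by (simp add: split_def plus_prod_def)
  qed
  show "distribution (\<mu> \<circledast> on_snd (measure_pmf r))"
    unfolding distribution_def convol_def \<nu>_def[symmetric] by (auto intro!: prob_space_distr)
  have Q: "(\<lambda>(x, y). x + y) -` (C \<times> {z}) \<in> sets (\<mu> \<Otimes>\<^sub>M \<nu>)"
    using measurable_sets[OF plus sets_slice[OF C]] by (simp add: space_pair_measure sp\<mu> sp\<nu>)
  have "emeasure (\<mu> \<circledast> \<nu>) (C \<times> {z}) = emeasure (\<mu> \<Otimes>\<^sub>M \<nu>) ((\<lambda>(x, y). x + y) -` (C \<times> {z}))"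
    unfolding convol_def using C sets_slice[OF C]
    by (subst emeasure_distr) (auto simp: space_pair_measure sp\<mu> sp\<nu>)
  also have "\<dots> = (\<integral>\<^sup>+y. emeasure \<mu> ((\<lambda>x. (x, y)) -` ((\<lambda>(x, y). x + y) -` (C \<times> {z}))) \<partial>\<nu>)"
    by (rule emeasure_pair_measure_alt2[OF Q])
  also have "\<dots> = (\<integral>\<^sup>+y. emeasure \<mu> ((\<lambda>x. (x, (0, y))) -` ((\<lambda>(x, y). x + y) -` (C \<times> {z}))) \<partial>measure_pmf r)"
    unfolding \<nu>_def on_snd_def
    by (rule nn_integral_distr[OF m\<nu> measurable_emeasure_Pair2[OF Q, unfolded \<nu>_def on_snd_def]])
  also have "\<dots> = (\<integral>\<^sup>+y. ennreal (g C * pmf p (z - y)) \<partial>measure_pmf r)"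
  proof (rule nn_integral_cong)
    fix y
    have "(\<lambda>x. (x, (0, y))) -` ((\<lambda>(x, y). x + y) -` (C \<times> {z})) = C \<times> {z - y}"
      by (auto simp: plus_prod_def eq_diff_eq)
    then show "emeasure \<mu> ((\<lambda>x. (x, (0, y))) -` ((\<lambda>(x, y). x + y) -` (C \<times> {z}))) = ennreal (g C * pmf p (z - y))"
      by (simp add: \<mu>.emeasure_eq_measure slices[OF C])
  qed
  also have "\<dots> = ennreal (\<integral>y. g C * pmf p (z - y) \<partial>measure_pmf r)"
  proof (rule nn_integral_eq_integral)
    have b: "g C * pmf p x \<le> 1" "0 \<le> g C * pmf p x" for x unfolding slices[OF C, symmetric] by simp_all
    show "AE y in measure_pmf r. 0 \<le> g C * pmf p (z - y)" by (intro AE_I2 b)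
    have "norm (g C * pmf p x) \<le> 1" for x using b[of x] by (simp only: real_norm_def abs_of_nonneg)
    then show "integrable (measure_pmf r) (\<lambda>y. g C * pmf p (z - y))"
      by (intro measure_pmf.integrable_const_bound[where B = 1] AE_I2) auto
  qed
  also have "(\<integral>y. g C * pmf p (z - y) \<partial>measure_pmf r) = g C * pmf (conv_pmf p r) z"
  proof -
    have "{x. x + y = z} = {z - y}" for y by (auto simp: eq_diff_eq)
    then show ?thesis using pmf_map_sum_pair[of "\<lambda>x. x" "\<lambda>y. y" p r z] by (simp add: measure_pmf_single)
  qed
  finally have e: "emeasure (\<mu> \<circledast> \<nu>) (C \<times> {z}) = ennreal (g C * pmf (conv_pmf p r) z)" .
  have "0 \<le> g C * pmf p x" for x unfolding slices[OF C, symmetric] by simp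
  moreover obtain x where "x \<in> set_pmf p" using set_pmf_not_empty[of p] by blast
  ultimately have "0 \<le> g C" using pmf_positive[of x p] by (metis zero_le_mult_iff not_less)
  then show "measure (\<mu> \<circledast> on_snd (measure_pmf r)) (C \<times> {z}) = g C * pmf (conv_pmf p r) z"
    using e by (simp add: measure_def \<nu>_def)
qed

lemma slices_factorization:
  fixes \<mu> :: "('a::euclidean_space \<times> 'd::{countable, discrete_topology, ab_group_add}) measure"
  assumes \<mu>: "distribution \<mu>" and \<gamma>: "distribution \<gamma>"
    and slices: "\<And>C x. C \<in> sets borel \<Longrightarrow> measure \<mu> (C \<times> {x}) = measure \<gamma> C * pmf p x"
    and p: "p = conv_pmf (conv_pmf \<rho> U) (return_pmf g)"
  shows "\<mu> = on_fst \<gamma> \<circledast> on_snd (measure_pmf \<rho>) \<circledast> on_snd (measure_pmf U) \<circledast> return borel (0, g)"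
proof -
  interpret \<gamma>: prob_space \<gamma> using \<gamma> by (simp add: distribution_def)
  have s\<gamma> [measurable_cong]: "sets \<gamma> = sets borel" using \<gamma> by (simp add: distribution_def)
  have sp\<gamma>: "space \<gamma> = UNIV" using sets_eq_imp_space_eq[OF s\<gamma>] by simp
  have m: "(\<lambda>x. (x, 0::'d)) \<in> measurable \<gamma> borel" by (rule measurable_prod_discrete) auto
  have r: "return borel (0, g) = (on_snd (measure_pmf (return_pmf g)) :: ('a \<times> 'd) measure)"
  proof (rule measure_eqI)
    fix A :: "('a \<times> 'd) set" assume "A \<in> sets (return borel (0, g))"
    moreover have "(\<lambda>y. (0::'a, y)) \<in> measurable (measure_pmf (return_pmf g)) borel"
      by (rule measurable_prod_discrete) auto
    ultimately show "emeasure (return borel (0, g)) A = emeasure (on_snd (measure_pmf (return_pmf g))) A"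
      by (simp add: on_snd_def emeasure_distr indicator_def)
  qed (simp add: on_snd_def)
  have d0: "distribution (on_fst \<gamma> :: ('a \<times> 'd) measure)"
    unfolding distribution_def on_fst_def using m by (simp add: \<gamma>.prob_space_distr)
  \<comment> \<open>A measure on the first factor is the product with the point mass at 0, which
    starts the iteration.\<close>
  have s0: "measure (on_fst \<gamma> :: ('a \<times> 'd) measure) (C \<times> {x}) = measure \<gamma> C * pmf (return_pmf 0) x"
    if C: "C \<in> sets borel" for C x
  proof -
    have "(\<lambda>y. (y, 0::'d)) -` (C \<times> {x}) \<inter> space \<gamma> = (if x = 0 then C else {})" by (auto simp: sp\<gamma>)
    then show ?thesis unfolding on_fst_def measure_distr[OF m sets_slice[OF C]]
      by (cases "x = 0") (auto simp: pmf_return)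
  qed
  let ?m1 = "on_fst \<gamma> \<circledast> on_snd (measure_pmf \<rho>)"
  let ?m2 = "?m1 \<circledast> on_snd (measure_pmf U)"
  let ?m3 = "?m2 \<circledast> on_snd (measure_pmf (return_pmf g))"
  have d1: "distribution ?m1" by (rule convol_on_snd(1)[OF d0 _ sets.empty_sets]) (rule s0)
  have s1: "measure ?m1 (C \<times> {x}) = measure \<gamma> C * pmf (conv_pmf (return_pmf 0) \<rho>) x" if "C \<in> sets borel" for C x
    by (rule convol_on_snd(2)[OF d0 _ that]) (rule s0)
  have d2: "distribution ?m2" by (rule convol_on_snd(1)[OF d1 _ sets.empty_sets]) (rule s1)
  have s2: "measure ?m2 (C \<times> {x}) = measure \<gamma> C * pmf (conv_pmf (conv_pmf (return_pmf 0) \<rho>) U) x" if "C \<in> sets borel" for C x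
    by (rule convol_on_snd(2)[OF d1 _ that]) (rule s1)
  have d3: "distribution ?m3" by (rule convol_on_snd(1)[OF d2 _ sets.empty_sets]) (rule s2)
  have s3: "measure ?m3 (C \<times> {x}) = measure \<gamma> C * pmf (conv_pmf (conv_pmf (conv_pmf (return_pmf 0) \<rho>) U) (return_pmf g)) x"
    if "C \<in> sets borel" for C x
    by (rule convol_on_snd(2)[OF d2 _ that]) (rule s2)
  have e: "conv_pmf (return_pmf 0) \<rho> = \<rho>"
    by (simp add: pair_return_pmf1 pmf.map_comp o_def map_pmf_ident)
  show ?thesis unfolding r
  proof (rule measure_eqI_slices)
    show "sets \<mu> = sets borel" using \<mu> by (simp add: distribution_def)
    show "sets (on_fst \<gamma> \<circledast> on_snd (measure_pmf \<rho>) \<circledast> on_snd (measure_pmf U) \<circledast> on_snd (measure_pmf (return_pmf g))) = sets borel"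
      by (rule d3[unfolded distribution_def, THEN conjunct2])
    fix C :: "'a set" and x :: 'd assume C: "C \<in> sets borel"
    interpret \<mu>: prob_space \<mu> using \<mu> by (simp add: distribution_def)
    interpret R: prob_space "on_fst \<gamma> \<circledast> on_snd (measure_pmf \<rho>) \<circledast> on_snd (measure_pmf U) \<circledast> on_snd (measure_pmf (return_pmf g))"
      by (rule d3[unfolded distribution_def, THEN conjunct1])
    show "emeasure \<mu> (C \<times> {x}) = emeasure (on_fst \<gamma> \<circledast> on_snd (measure_pmf \<rho>) \<circledast> on_snd (measure_pmf U) \<circledast> on_snd (measure_pmf (return_pmf g))) (C \<times> {x})"
      unfolding \<mu>.emeasure_eq_measure R.emeasure_eq_measure slices[OF C] s3[OF C] e p ..
  qed
qed

lemma joint_distr_eq: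
  fixes f g g' :: "'w \<Rightarrow> 'a::topological_space"
  assumes M: "prob_space M" and m [measurable]: "f \<in> borel_measurable M" "g \<in> borel_measurable M" "g' \<in> borel_measurable M"
    and eq: "\<And>C B. C \<in> sets borel \<Longrightarrow> B \<in> sets borel \<Longrightarrow>
      measure M {\<omega> \<in> space M. f \<omega> \<in> C \<and> g \<omega> \<in> B} = measure M {\<omega> \<in> space M. f \<omega> \<in> C \<and> g' \<omega> \<in> B}"
  shows "distr M (borel \<Otimes>\<^sub>M borel) (\<lambda>\<omega>. (f \<omega>, g \<omega>)) = distr M (borel \<Otimes>\<^sub>M borel) (\<lambda>\<omega>. (f \<omega>, g' \<omega>))"
proof -
  interpret prob_space M by fact
  let ?E = "{C \<times> B |C B. C \<in> sets (borel :: 'a measure) \<and> B \<in> sets (borel :: 'a measure)}"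
  have st: "sets (borel \<Otimes>\<^sub>M borel :: ('a \<times> 'a) measure) = sigma_sets UNIV ?E"
    by (simp add: sets_pair_measure)
  have e: "emeasure (distr M (borel \<Otimes>\<^sub>M borel) (\<lambda>\<omega>. (f \<omega>, k \<omega>))) (C \<times> B) =
      ennreal (measure M {\<omega> \<in> space M. f \<omega> \<in> C \<and> k \<omega> \<in> B})"
    if [measurable]: "k \<in> borel_measurable M" and CB [measurable]: "C \<in> sets borel" "B \<in> sets borel" for k C B
  proof -
    have "(\<lambda>\<omega>. (f \<omega>, k \<omega>)) -` (C \<times> B) \<inter> space M = {\<omega> \<in> space M. f \<omega> \<in> C \<and> k \<omega> \<in> B}" by auto
    then show ?thesis by (subst emeasure_distr) (auto simp: emeasure_eq_measure)
  qed
  show ?thesis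
  proof (rule measure_eqI_generator_eq[where E = ?E and \<Omega> = UNIV and A = "\<lambda>_. UNIV \<times> UNIV"])
    show "Int_stable ?E" by (rule Int_stable_pair_measure_generator)
    show "emeasure (distr M (borel \<Otimes>\<^sub>M borel) (\<lambda>\<omega>. (f \<omega>, g \<omega>))) X = emeasure (distr M (borel \<Otimes>\<^sub>M borel) (\<lambda>\<omega>. (f \<omega>, g' \<omega>))) X"
      if "X \<in> ?E" for X
      using that e[OF m(2)] e[OF m(3)] eq by auto
    have "UNIV \<times> UNIV \<in> ?E" by (intro CollectI exI[of _ UNIV] conjI refl) auto
    then show "range (\<lambda>_::nat. UNIV \<times> UNIV) \<subseteq> ?E" by blast
    show "emeasure (distr M (borel \<Otimes>\<^sub>M borel) (\<lambda>\<omega>. (f \<omega>, g \<omega>))) (UNIV \<times> UNIV) \<noteq> \<infinity>" for i :: nat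
      by (subst e) auto
  qed (auto simp: st)
qed

text \<open>Doubling an element of maximal norm would double that norm, so the maximum is 0. This is
  what makes the off-diagonal part of an automorphism harmless on \<open>F\<close>.\<close>

lemma finite_subgroup_additive_0:
  fixes h :: "'d::ab_group_add \<Rightarrow> 'a::real_normed_vector"
  assumes "finite F" "add_subgroup F" "Modules.additive h" "x \<in> F"
  shows "h x = 0"
proof -
  have "finite (norm ` h ` F)" "norm ` h ` F \<noteq> {}" using assms by auto
  then have "Max (norm ` h ` F) \<in> norm ` h ` F" by (rule Max_in)
  then obtain w where w: "w \<in> F" "norm (h w) = Max (norm ` h ` F)" by auto
  have le: "norm (h z) \<le> norm (h w)" if "z \<in> F" for z
    unfolding w(2) using assms(1) that by (intro Max_ge) auto
  have "w + w \<in> F" using assms(2) w(1) by (simp add: add_subgroup_def)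
  from le[OF this] have "norm (2 *\<^sub>R h w) \<le> norm (h w)"
    by (simp add: additive.add[OF assms(3)] scaleR_2)
  then have "norm (h w) = 0" by simp
  then show ?thesis using le[OF assms(4)] by simp
qed

lemma dbl_eq_0_real: "dbl k (w::'a::real_vector) = 0 \<Longrightarrow> w = 0"
proof (induction k)
  case (Suc k)
  then have "2 *\<^sub>R dbl k w = 0" by (simp add: dbl_Suc scaleR_2)
  then show ?case using Suc.IH by simp
qed simp

section \<open>Symmetric conditional distributions\<close>

locale heyde_setup = prob_space M
  for M :: "'w measure" +
  fixes \<xi>\<^sub>1 \<xi>\<^sub>2 :: "'w \<Rightarrow> 'a::euclidean_space \<times> 'd::{countable, discrete_topology, ab_group_add}"
    and \<delta> :: "'a \<times> 'd \<Rightarrow> 'a \<times> 'd" and \<alpha> :: "'a \<Rightarrow> 'a" and h :: "'d \<Rightarrow> 'a" and \<beta> :: "'d \<Rightarrow> 'd"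
  assumes lin_\<alpha>: "linear \<alpha>" and ker_\<alpha>: "\<alpha> t = 0 \<Longrightarrow> t = 0" and ker_I\<alpha>: "t + \<alpha> t = 0 \<Longrightarrow> t = 0"
    and add_h: "Modules.additive h" and add_\<beta>: "Modules.additive \<beta>"
    and ker_\<beta>: "\<beta> d = 0 \<Longrightarrow> d = 0" and ker_I\<beta>: "d + \<beta> d = 0 \<Longrightarrow> d = 0"
    and \<delta>_eq: "\<delta> (t, d) = (\<alpha> t + h d, \<beta> d)"
    and ind: "indep_var borel \<xi>\<^sub>1 borel \<xi>\<^sub>2"
    and sym: "cond_symmetric M (\<lambda>\<omega>. \<xi>\<^sub>1 \<omega> + \<xi>\<^sub>2 \<omega>) (\<lambda>\<omega>. \<xi>\<^sub>1 \<omega> + \<delta> (\<xi>\<^sub>2 \<omega>))"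
begin

definition "X\<^sub>1 \<omega> = fst (\<xi>\<^sub>1 \<omega>)"
definition "X\<^sub>2 \<omega> = fst (\<xi>\<^sub>2 \<omega>)"
definition "D\<^sub>1 \<omega> = snd (\<xi>\<^sub>1 \<omega>)"
definition "D\<^sub>2 \<omega> = snd (\<xi>\<^sub>2 \<omega>)"

lemma \<xi>_measurable [measurable]: "\<xi>\<^sub>1 \<in> borel_measurable M" "\<xi>\<^sub>2 \<in> borel_measurable M"
  using indep_var_rv1[OF ind] indep_var_rv2[OF ind] .

lemma XD_measurable [measurable]:
  "X\<^sub>1 \<in> borel_measurable M" "X\<^sub>2 \<in> borel_measurable M"
  "D\<^sub>1 \<in> measurable M (count_space UNIV)" "D\<^sub>2 \<in> measurable M (count_space UNIV)"
  unfolding X\<^sub>1_def X\<^sub>2_def D\<^sub>1_def D\<^sub>2_def by measurable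

lemma D_measurable: "(\<lambda>\<omega>. k (D\<^sub>1 \<omega>, D\<^sub>2 \<omega>)) \<in> measurable M (count_space UNIV)"
  by (rule measurable_compose[OF measurable_pair_countable[OF XD_measurable(3,4)]]) simp

abbreviation "p \<equiv> law M D\<^sub>1"
abbreviation "q \<equiv> law M D\<^sub>2"

lemma AE_supp: "AE \<omega> in M. D\<^sub>1 \<omega> \<in> set_pmf p" "AE \<omega> in M. D\<^sub>2 \<omega> \<in> set_pmf q"
proof -
  have "AE \<omega> in M. X \<omega> \<in> set_pmf (law M X)" if m: "X \<in> measurable M (count_space UNIV)" for X :: "'w \<Rightarrow> 'd"
  proof -
    have "AE x in measure_pmf (law M X). x \<in> set_pmf (law M X)" by (rule AE_pmfI) auto
    then show ?thesis unfolding measure_pmf_law[OF m] by (subst (asm) AE_distr_iff[OF m]) auto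
  qed
  then show "AE \<omega> in M. D\<^sub>1 \<omega> \<in> set_pmf p" "AE \<omega> in M. D\<^sub>2 \<omega> \<in> set_pmf q" by simp_all
qed

text \<open>Not divided by the mass of the event, so that points off the support give 0 and
  independence becomes a plain product.\<close>

definition f :: "'d \<Rightarrow> 'a \<Rightarrow> complex" where
  "f x s = (CLINT \<omega>|M. indicator {x} (D\<^sub>1 \<omega>) * cis (s \<bullet> X\<^sub>1 \<omega>))"

definition g :: "'d \<Rightarrow> 'a \<Rightarrow> complex" where
  "g y s = (CLINT \<omega>|M. indicator {y} (D\<^sub>2 \<omega>) * cis (s \<bullet> X\<^sub>2 \<omega>))"

text \<open>The law of the pair of statistics, Fourier transformed in the real components and
  evaluated at single points in the discrete ones.\<close>

definition J :: "'a \<Rightarrow> 'a \<Rightarrow> 'd \<Rightarrow> 'd \<Rightarrow> complex" where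
  "J u v c d = (CLINT \<omega>|M. indicator {c} (D\<^sub>1 \<omega> + D\<^sub>2 \<omega>) * indicator {d} (D\<^sub>1 \<omega> + \<beta> (D\<^sub>2 \<omega>)) *
     cis (u \<bullet> (X\<^sub>1 \<omega> + X\<^sub>2 \<omega>) + v \<bullet> (X\<^sub>1 \<omega> + (\<alpha> (X\<^sub>2 \<omega>) + h (D\<^sub>2 \<omega>)))))"

lemma L_eq: "\<xi>\<^sub>1 \<omega> + \<xi>\<^sub>2 \<omega> = (X\<^sub>1 \<omega> + X\<^sub>2 \<omega>, D\<^sub>1 \<omega> + D\<^sub>2 \<omega>)"
    "\<xi>\<^sub>1 \<omega> + \<delta> (\<xi>\<^sub>2 \<omega>) = (X\<^sub>1 \<omega> + (\<alpha> (X\<^sub>2 \<omega>) + h (D\<^sub>2 \<omega>)), D\<^sub>1 \<omega> + \<beta> (D\<^sub>2 \<omega>))"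
  by (simp_all add: X\<^sub>1_def X\<^sub>2_def D\<^sub>1_def D\<^sub>2_def plus_prod_def \<delta>_eq[of "fst (\<xi>\<^sub>2 \<omega>)" "snd (\<xi>\<^sub>2 \<omega>)", simplified])

lemma real_measurable [measurable]:
  "(\<lambda>\<omega>. \<alpha> (X\<^sub>2 \<omega>)) \<in> borel_measurable M" "(\<lambda>\<omega>. h (D\<^sub>2 \<omega>)) \<in> borel_measurable M"
proof -
  have "\<alpha> \<in> borel_measurable borel"
    using lin_\<alpha> by (intro borel_measurable_continuous_onI linear_continuous_on) (simp add: linear_linear)
  then show "(\<lambda>\<omega>. \<alpha> (X\<^sub>2 \<omega>)) \<in> borel_measurable M" by measurable
  show "(\<lambda>\<omega>. h (D\<^sub>2 \<omega>)) \<in> borel_measurable M"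
    by (rule measurable_compose[OF XD_measurable(4)]) simp
qed

lemma L_measurable:
  "(\<lambda>\<omega>. \<xi>\<^sub>1 \<omega> + \<xi>\<^sub>2 \<omega>) \<in> borel_measurable M"
  "(\<lambda>\<omega>. \<xi>\<^sub>1 \<omega> + \<delta> (\<xi>\<^sub>2 \<omega>)) \<in> borel_measurable M"
  "(\<lambda>\<omega>. - (\<xi>\<^sub>1 \<omega> + \<delta> (\<xi>\<^sub>2 \<omega>))) \<in> borel_measurable M"
  unfolding L_eq uminus_prod_def fst_conv snd_conv
  using D_measurable[of "\<lambda>(x, y). x + y"] D_measurable[of "\<lambda>(x, y). x + \<beta> y"] D_measurable[of "\<lambda>(x, y). - (x + \<beta> y)"]
  by (auto intro!: measurable_prod_discrete)

lemma joint: "distr M (borel \<Otimes>\<^sub>M borel) (\<lambda>\<omega>. (\<xi>\<^sub>1 \<omega> + \<xi>\<^sub>2 \<omega>, \<xi>\<^sub>1 \<omega> + \<delta> (\<xi>\<^sub>2 \<omega>))) =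
    distr M (borel \<Otimes>\<^sub>M borel) (\<lambda>\<omega>. (\<xi>\<^sub>1 \<omega> + \<xi>\<^sub>2 \<omega>, - (\<xi>\<^sub>1 \<omega> + \<delta> (\<xi>\<^sub>2 \<omega>))))"
  using cond_symmetric_measure[OF prob_space_axioms L_measurable sym]
  by (intro joint_distr_eq[OF prob_space_axioms L_measurable])

lemma J_sym: "J u v c d = J u (- v) c (- d)"
proof -
  define \<Phi> where "\<Phi> = (\<lambda>(l :: 'a \<times> 'd, m :: 'a \<times> 'd).
    indicator {c} (snd l) * indicator {d} (snd m) * cis (u \<bullet> fst l + v \<bullet> fst m))"
  have \<Phi>: "\<Phi> \<in> borel_measurable (borel \<Otimes>\<^sub>M borel)"
    unfolding \<Phi>_def cis_conv_exp split_def by measurable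
  note [measurable] = L_measurable
  have pm: "(\<lambda>\<omega>. (\<xi>\<^sub>1 \<omega> + \<xi>\<^sub>2 \<omega>, \<xi>\<^sub>1 \<omega> + \<delta> (\<xi>\<^sub>2 \<omega>))) \<in> measurable M (borel \<Otimes>\<^sub>M borel)"
    "(\<lambda>\<omega>. (\<xi>\<^sub>1 \<omega> + \<xi>\<^sub>2 \<omega>, - (\<xi>\<^sub>1 \<omega> + \<delta> (\<xi>\<^sub>2 \<omega>)))) \<in> measurable M (borel \<Otimes>\<^sub>M borel)"
    by measurable
  have "J u v c d = (CLINT z|distr M (borel \<Otimes>\<^sub>M borel) (\<lambda>\<omega>. (\<xi>\<^sub>1 \<omega> + \<xi>\<^sub>2 \<omega>, \<xi>\<^sub>1 \<omega> + \<delta> (\<xi>\<^sub>2 \<omega>))). \<Phi> z)"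
    by (subst integral_distr[OF pm(1) \<Phi>]) (simp add: \<Phi>_def J_def L_eq)
  also have "\<dots> = (CLINT \<omega>|M. \<Phi> (\<xi>\<^sub>1 \<omega> + \<xi>\<^sub>2 \<omega>, - (\<xi>\<^sub>1 \<omega> + \<delta> (\<xi>\<^sub>2 \<omega>))))"
    unfolding joint by (rule integral_distr[OF pm(2) \<Phi>])
  also have "\<dots> = J u (- v) c (- d)"
    unfolding J_def
  proof (intro Bochner_Integration.integral_cong refl)
    fix \<omega>
    have "indicator {d} (- (D\<^sub>1 \<omega> + \<beta> (D\<^sub>2 \<omega>))) = (indicator {- d} (D\<^sub>1 \<omega> + \<beta> (D\<^sub>2 \<omega>)) :: complex)"
    proof -
      have "- w = d \<longleftrightarrow> w = - d" for w :: 'd by (metis minus_minus)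
      then show ?thesis by (simp only: indicator_def singleton_iff)
    qed
    then show "\<Phi> (\<xi>\<^sub>1 \<omega> + \<xi>\<^sub>2 \<omega>, - (\<xi>\<^sub>1 \<omega> + \<delta> (\<xi>\<^sub>2 \<omega>))) =
      indicator {c} (D\<^sub>1 \<omega> + D\<^sub>2 \<omega>) * indicator {- d} (D\<^sub>1 \<omega> + \<beta> (D\<^sub>2 \<omega>)) *
      cis (u \<bullet> (X\<^sub>1 \<omega> + X\<^sub>2 \<omega>) + - v \<bullet> (X\<^sub>1 \<omega> + (\<alpha> (X\<^sub>2 \<omega>) + h (D\<^sub>2 \<omega>))))"
      unfolding \<Phi>_def L_eq by (simp only: case_prod_conv snd_conv fst_conv snd_uminus fst_uminus inner_minus_left inner_minus_right)
  qed
  finally show ?thesis .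
qed

lemma fg_prod:
  "(CLINT \<omega>|M. (indicator {x} (D\<^sub>1 \<omega>) * cis (s \<bullet> X\<^sub>1 \<omega>)) * (indicator {y} (D\<^sub>2 \<omega>) * cis (r \<bullet> X\<^sub>2 \<omega>))) = f x s * g y r"
proof -
  have m: "(\<lambda>z :: 'a \<times> 'd. indicator {x} (snd z) * cis (s \<bullet> fst z)) \<in> borel_measurable borel" for x s
    unfolding cis_conv_exp by measurable
  have i: "integrable M (\<lambda>\<omega>. indicator {x} (snd (Y \<omega>)) * cis (s \<bullet> fst (Y \<omega>)))"
    if [measurable]: "Y \<in> borel_measurable M" for Y :: "'w \<Rightarrow> 'a \<times> 'd" and x s
  proof (rule integrable_const_bound[where B = 1])
    show "(\<lambda>\<omega>. indicator {x} (snd (Y \<omega>)) * cis (s \<bullet> fst (Y \<omega>))) \<in> borel_measurable M"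
      using measurable_compose[OF that m] .
  qed (auto simp: norm_mult indicator_def)
  show ?thesis unfolding f_def g_def X\<^sub>1_def X\<^sub>2_def D\<^sub>1_def D\<^sub>2_def
    using indep_var_compose[OF ind m m]
    by (intro indep_var_lebesgue_integral i \<xi>_measurable) (simp add: comp_def)
qed

lemma heyde_pair: "heyde_pair p q \<beta>"
proof (rule heyde_pair_law[OF _ add_\<beta> ker_\<beta> ker_I\<beta>])
  have "indep_var (count_space UNIV) (snd \<circ> \<xi>\<^sub>1) (count_space UNIV) (snd \<circ> \<xi>\<^sub>2)"
    by (rule indep_var_compose[OF ind]) measurable
  then show "indep_var (count_space UNIV) D\<^sub>1 (count_space UNIV) D\<^sub>2"
    by (simp add: comp_def D\<^sub>1_def[abs_def] D\<^sub>2_def[abs_def])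
  fix u v
  have m: "UNIV \<times> {w} \<in> sets (borel :: ('a \<times> 'd) measure)" for w by (rule sets_slice) simp
  show "prob {\<omega> \<in> space M. D\<^sub>1 \<omega> + D\<^sub>2 \<omega> = u \<and> D\<^sub>1 \<omega> + \<beta> (D\<^sub>2 \<omega>) = v} =
      prob {\<omega> \<in> space M. D\<^sub>1 \<omega> + D\<^sub>2 \<omega> = u \<and> - (D\<^sub>1 \<omega> + \<beta> (D\<^sub>2 \<omega>)) = v}"
    using cond_symmetric_measure[OF prob_space_axioms L_measurable sym m[of u] m[of v]] unfolding L_eq by simp
qed

sublocale HP: heyde_pair p q \<beta> by (rule heyde_pair)

definition cond_law :: "'w set \<Rightarrow> ('w \<Rightarrow> 'a) \<Rightarrow> 'a measure" where
  "cond_law E X = distr (uniform_measure M E) borel X"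

lemma cond_law:
  assumes D [measurable]: "D \<in> measurable M (count_space UNIV)" and X [measurable]: "X \<in> borel_measurable M"
    and x: "x \<in> set_pmf (law M D)"
  defines "\<nu> \<equiv> cond_law {\<omega> \<in> space M. D \<omega> = (x::'d)} X"
  shows "distribution \<nu>"
    and "(CLINT \<omega>|M. indicator {x} (D \<omega>) * cis (s \<bullet> X \<omega>)) = of_real (pmf (law M D) x) * chf \<nu> s"
    and "C \<in> sets borel \<Longrightarrow> prob {\<omega> \<in> space M. X \<omega> \<in> C \<and> D \<omega> = x} = measure \<nu> C * pmf (law M D) x"
proof -
  define E where "E = {\<omega> \<in> space M. D \<omega> = x}"
  have E [measurable]: "E \<in> sets M" unfolding E_def by measurable
  have pE: "prob E = pmf (law M D) x" by (simp add: E_def pmf_law[OF D])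
  have pos: "prob E > 0" using x by (simp add: pE pmf_positive)
  have e: "emeasure M E \<noteq> 0" "emeasure M E \<noteq> \<infinity>" using pos by (simp_all add: emeasure_eq_measure)
  interpret U: prob_space "uniform_measure M E" by (rule prob_space_uniform_measure[OF e])
  have XU [measurable]: "X \<in> borel_measurable (uniform_measure M E)" using X by simp
  show "distribution \<nu>"
    unfolding distribution_def \<nu>_def cond_law_def E_def[symmetric] by (auto intro!: U.prob_space_distr)
  have mc: "(\<lambda>\<omega>. cis (s \<bullet> X \<omega>)) \<in> borel_measurable M" unfolding cis_conv_exp by measurable
  have "chf \<nu> s = (CLINT \<omega>|uniform_measure M E. cis (s \<bullet> X \<omega>))"
    unfolding chf_def \<nu>_def cond_law_def E_def[symmetric] cis_conv_exp by (subst integral_distr) auto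
  also have "\<dots> = (CLINT \<omega>|M. (indicator E \<omega> / prob E) *\<^sub>R cis (s \<bullet> X \<omega>))"
  proof -
    have "uniform_measure M E = density M (\<lambda>\<omega>. ennreal (indicator E \<omega> / prob E))"
      unfolding uniform_measure_def using pos
      by (intro density_cong) (auto simp: emeasure_eq_measure indicator_def divide_ennreal[symmetric] ennreal_1[symmetric] simp del: ennreal_1)
    then show ?thesis using mc by (simp only:) (rule integral_density, auto)
  qed
  also have "\<dots> = (CLINT \<omega>|M. indicator {x} (D \<omega>) * cis (s \<bullet> X \<omega>)) / prob E"
    unfolding integral_divide_zero[symmetric]
    by (intro Bochner_Integration.integral_cong) (auto simp: E_def indicator_def scaleR_conv_of_real)
  finally show "(CLINT \<omega>|M. indicator {x} (D \<omega>) * cis (s \<bullet> X \<omega>)) = of_real (pmf (law M D) x) * chf \<nu> s"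
    using pos by (simp add: pE[symmetric])
  assume C [measurable]: "C \<in> sets borel"
  have "measure \<nu> C = measure (uniform_measure M E) (X -` C \<inter> space M)"
    unfolding \<nu>_def cond_law_def E_def[symmetric] by (subst measure_distr) auto
  also have "\<dots> = prob (E \<inter> (X -` C \<inter> space M)) / prob E"
    using e by (intro measure_uniform_measure) auto
  also have "E \<inter> (X -` C \<inter> space M) = {\<omega> \<in> space M. X \<omega> \<in> C \<and> D \<omega> = x}" by (auto simp: E_def)
  finally show "prob {\<omega> \<in> space M. X \<omega> \<in> C \<and> D \<omega> = x} = measure \<nu> C * pmf (law M D) x"
    using pos by (simp add: pE)
qed

end

lemma indicator_mult_0: "\<not> (u = c \<and> v = d) \<Longrightarrow> indicator {c} u * indicator {d} v = (0 :: complex)"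
  by (auto simp: indicator_def)

context heyde_setup
begin

lemma f_0: "f x 0 = of_real (pmf p x)" and g_0: "g x 0 = of_real (pmf q x)"
proof -
  have "(CLINT \<omega>|M. indicator {x} (D \<omega>)) = complex_of_real (pmf (law M D) x)"
    if m [measurable]: "D \<in> measurable M (count_space UNIV)" for D :: "'w \<Rightarrow> 'd"
  proof -
    have "(CLINT \<omega>|M. indicator {x} (D \<omega>)) = (CLINT \<omega>|M. of_real (indicat_real {\<omega> \<in> space M. D \<omega> = x} \<omega>))"
      by (intro Bochner_Integration.integral_cong) (auto simp: indicator_def)
    also have "\<dots> = of_real (pmf (law M D) x)"
      unfolding integral_complex_of_real by (simp add: pmf_law[OF m])
    finally show ?thesis .
  qed
  then show "f x 0 = of_real (pmf p x)" "g x 0 = of_real (pmf q x)" by (simp_all add: f_def g_def)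
qed

lemma continuous_f: "continuous_on UNIV (f x)" and continuous_g: "continuous_on UNIV (g x)"
proof -
  have *: "continuous_on UNIV (\<lambda>s. CLINT \<omega>|M. indicator {x} (D \<omega>) * cis (s \<bullet> X \<omega>))"
    if D [measurable]: "D \<in> measurable M (count_space UNIV)" and X [measurable]: "X \<in> borel_measurable M"
      and supp: "AE \<omega> in M. D \<omega> \<in> set_pmf (law M D)" for D :: "'w \<Rightarrow> 'd" and X :: "'w \<Rightarrow> 'a"
  proof (cases "x \<in> set_pmf (law M D)")
    case True
    interpret C: distr_space "cond_law {\<omega> \<in> space M. D \<omega> = x} X"
      by standard (rule cond_law(1)[OF D X True])
    show ?thesis unfolding cond_law(2)[OF D X True]
      by (intro continuous_intros C.continuous_chf)
  next
    case False
    have "(CLINT \<omega>|M. indicator {x} (D \<omega>) * cis (s \<bullet> X \<omega>)) = 0" for s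
      by (rule integral_eq_zero_AE) (use supp False in \<open>auto elim!: eventually_mono simp: indicator_def\<close>)
    then show ?thesis by simp
  qed
  show "continuous_on UNIV (f x)" "continuous_on UNIV (g x)"
    unfolding f_def[abs_def] g_def[abs_def] by (intro * XD_measurable AE_supp)+
qed

abbreviation "a \<equiv> adjoint \<alpha>"

lemma linear_a: "linear a"
  by (rule adjoint_linear[OF lin_\<alpha>])

lemma adjoint_ker:
  fixes T :: "'a \<Rightarrow> 'a"
  assumes T: "linear T" and ker: "\<And>t. T t = 0 \<Longrightarrow> t = 0" and v: "\<And>x. T x \<bullet> v = 0"
  shows "v = 0"
proof -
  have "surj T" using linear_injective_imp_surjective[OF T] linear_injective_0[OF T] ker by blast
  then obtain x where "T x = v" by (metis surjD)
  then show ?thesis using v[of x] by simp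
qed

lemma ker_a: "a v = 0 \<Longrightarrow> v = 0"
  by (rule adjoint_ker[OF lin_\<alpha> ker_\<alpha>]) (simp_all flip: adjoint_works[OF lin_\<alpha>])

lemma ker_Ia: "v + a v = 0 \<Longrightarrow> v = 0"
proof (rule adjoint_ker[of "\<lambda>t. t + \<alpha> t"])
  show "linear (\<lambda>t. t + \<alpha> t)" by (intro linear_compose_add linear_id[unfolded id_def] lin_\<alpha>)
  assume "v + a v = 0"
  then have "x \<bullet> (v + a v) = 0" for x by simp
  then show "(x + \<alpha> x) \<bullet> v = 0" for x
    by (simp add: inner_add_right inner_add_left adjoint_works[OF lin_\<alpha>])
qed (rule ker_I\<alpha>)

text \<open>\<open>\<gamma>\<^sub>1\<close> and \<open>\<gamma>\<^sub>2\<close> are the conditional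
  laws at the base points \<open>x\<^sub>0\<close> and \<open>y\<^sub>0\<close>. The product form of
  the slices expresses that no other value of the discrete part changes them.\<close>

theorem slice_product:
  obtains \<gamma>\<^sub>1 \<gamma>\<^sub>2 F N x\<^sub>0 y\<^sub>0 where
    "distribution \<gamma>\<^sub>1" "line_gauss \<gamma>\<^sub>1" "distribution \<gamma>\<^sub>2" "line_gauss \<gamma>\<^sub>2"
    "finite F" "add_subgroup F" "\<And>u. u \<in> F \<Longrightarrow> u + u = 0 \<Longrightarrow> u = 0" "\<beta> ` F = F"
    "\<And>x. x \<in> set_pmf p \<Longrightarrow> dbl N (x - x\<^sub>0) \<in> F" "\<And>y. y \<in> set_pmf q \<Longrightarrow> dbl N (y - y\<^sub>0) \<in> F"
    "shift_inv F p" "shift_inv F q"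
    "\<And>C x. C \<in> sets borel \<Longrightarrow> prob {\<omega> \<in> space M. X\<^sub>1 \<omega> \<in> C \<and> D\<^sub>1 \<omega> = x} = measure \<gamma>\<^sub>1 C * pmf p x"
    "\<And>C y. C \<in> sets borel \<Longrightarrow> prob {\<omega> \<in> space M. X\<^sub>2 \<omega> \<in> C \<and> D\<^sub>2 \<omega> = y} = measure \<gamma>\<^sub>2 C * pmf q y"
proof -
  obtain F N x\<^sub>0 y\<^sub>0 where finF: "finite F" and sgF: "add_subgroup F"
    and odd: "\<And>u. u \<in> F \<Longrightarrow> u + u = 0 \<Longrightarrow> u = 0" and bF: "\<beta> ` F = F"
    and Ib: "\<And>u. u \<in> F \<Longrightarrow> \<beta> u = u \<Longrightarrow> u = 0" and x0: "x\<^sub>0 \<in> set_pmf p" and y0: "y\<^sub>0 \<in> set_pmf q"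
    and suppx: "\<And>x. x \<in> set_pmf p \<Longrightarrow> dbl N (x - x\<^sub>0) \<in> F" and suppy: "\<And>y. y \<in> set_pmf q \<Longrightarrow> dbl N (y - y\<^sub>0) \<in> F"
    and invp: "shift_inv F p" and invq: "shift_inv F q"
    by (rule HP.heyde_structure, rule that) (assumption | blast)+
  have diff: "dbl N (u - v) \<in> F" if "dbl N (u - w) \<in> F" "dbl N (v - w) \<in> F" for u v w
    using add_subgroup_diff[OF sgF that] by (simp add: dbl_diff[symmetric])
  have dx: "dbl N (x - x') \<in> F" if "x \<in> set_pmf p" "x' \<in> set_pmf p" for x x'
    using diff[OF suppx[OF that(1)] suppx[OF that(2)]] .
  have dy: "dbl N (y - y') \<in> F" if "y \<in> set_pmf q" "y' \<in> set_pmf q" for y y'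
    using diff[OF suppy[OF that(1)] suppy[OF that(2)]] .
  define \<eta> where "\<eta> = h y\<^sub>0"
  \<comment> \<open>\<open>h\<close> is 0 on the finite group \<open>F\<close>, and a real vector
    space has no torsion, so \<open>h\<close> cannot distinguish support points that agree modulo
    \<open>F\<close> after doubling.\<close>
  have h\<eta>: "h y = \<eta>" if "y \<in> set_pmf q" for y
  proof -
    have "h (dbl N (y - y\<^sub>0)) = 0"
      by (rule finite_subgroup_additive_0[OF finF sgF add_h suppy[OF that]])
    then have "dbl N (h (y - y\<^sub>0)) = 0" by (simp add: dbl_additive[OF add_h])
    then have "h (y - y\<^sub>0) = 0" by (rule dbl_eq_0_real)
    then show ?thesis by (simp add: additive.diff[OF add_h] \<eta>_def)
  qed
  \<comment> \<open>Subtracting the two relations makes \<open>y' - y\<close> a fixed point of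
    \<beta>, and differences of support points admit only the fixed point 0.\<close>
  have uniq: "x' = x \<and> y' = y"
    if "x \<in> set_pmf p" "y \<in> set_pmf q" "x' \<in> set_pmf p" "y' \<in> set_pmf q" "x' + y' = x + y" "x' + \<beta> y' = x + \<beta> y" for x y x' y'
  proof -
    have "\<beta> (y' - y) = y' - y"
    proof -
      have "x' = x + y - y'" using that(5) by (metis add_diff_cancel_right')
      then have "x + y - y' + \<beta> y' = x + \<beta> y" using that(6) by simp
      moreover have "\<beta> y' - \<beta> y = (x + y - y' + \<beta> y') - (x + \<beta> y) + (y' - y)" by simp
      ultimately have "\<beta> y' - \<beta> y = y' - y" by simp
      then show ?thesis by (simp add: HP.b_simps)
    qed
    then have "y' - y = 0" using HP.inj_Ib_torsion[of F N "y' - y"] Ib dy[OF that(4,2)] by blast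
    then show ?thesis using that(5) by simp
  qed
  \<comment> \<open>By \<open>uniq\<close> the two indicators single out
    \<open>D\<^sub>1 \<omega> = x\<close> and \<open>D\<^sub>2 \<omega> = y\<close> on the supports,
    so independence factors the integral.\<close>
  have J_eq: "J u v (x + y) (x + \<beta> y) = f x (u + v) * g y (u + a v) * cis (v \<bullet> \<eta>)"
    if x: "x \<in> set_pmf p" and y: "y \<in> set_pmf q" for u v x y
  proof -
    have "J u v (x + y) (x + \<beta> y) = (CLINT \<omega>|M. cis (v \<bullet> \<eta>) *
        ((indicator {x} (D\<^sub>1 \<omega>) * cis ((u + v) \<bullet> X\<^sub>1 \<omega>)) * (indicator {y} (D\<^sub>2 \<omega>) * cis ((u + a v) \<bullet> X\<^sub>2 \<omega>))))"
      unfolding J_def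
    proof (rule integral_cong_AE)
      have [measurable]: "(\<lambda>\<omega>. indicator {c} (D\<^sub>1 \<omega> + D\<^sub>2 \<omega>) :: complex) \<in> borel_measurable M"
        "(\<lambda>\<omega>. indicator {c} (D\<^sub>1 \<omega> + \<beta> (D\<^sub>2 \<omega>)) :: complex) \<in> borel_measurable M" for c
        using measurable_compose[OF D_measurable[of "\<lambda>(x, y). x + y"], of "indicator {c}"]
          measurable_compose[OF D_measurable[of "\<lambda>(x, y). x + \<beta> y"], of "indicator {c}"] by simp_all
      show "(\<lambda>\<omega>. indicator {x + y} (D\<^sub>1 \<omega> + D\<^sub>2 \<omega>) * indicator {x + \<beta> y} (D\<^sub>1 \<omega> + \<beta> (D\<^sub>2 \<omega>)) *
          cis (u \<bullet> (X\<^sub>1 \<omega> + X\<^sub>2 \<omega>) + v \<bullet> (X\<^sub>1 \<omega> + (\<alpha> (X\<^sub>2 \<omega>) + h (D\<^sub>2 \<omega>))))) \<in> borel_measurable M"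
        unfolding cis_conv_exp by measurable
      show "(\<lambda>\<omega>. cis (v \<bullet> \<eta>) * ((indicator {x} (D\<^sub>1 \<omega>) * cis ((u + v) \<bullet> X\<^sub>1 \<omega>)) *
          (indicator {y} (D\<^sub>2 \<omega>) * cis ((u + a v) \<bullet> X\<^sub>2 \<omega>)))) \<in> borel_measurable M"
        unfolding cis_conv_exp by measurable
      show "AE \<omega> in M. indicator {x + y} (D\<^sub>1 \<omega> + D\<^sub>2 \<omega>) * indicator {x + \<beta> y} (D\<^sub>1 \<omega> + \<beta> (D\<^sub>2 \<omega>)) *
          cis (u \<bullet> (X\<^sub>1 \<omega> + X\<^sub>2 \<omega>) + v \<bullet> (X\<^sub>1 \<omega> + (\<alpha> (X\<^sub>2 \<omega>) + h (D\<^sub>2 \<omega>)))) =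
          cis (v \<bullet> \<eta>) * ((indicator {x} (D\<^sub>1 \<omega>) * cis ((u + v) \<bullet> X\<^sub>1 \<omega>)) * (indicator {y} (D\<^sub>2 \<omega>) * cis ((u + a v) \<bullet> X\<^sub>2 \<omega>)))"
        using AE_supp
      proof eventually_elim
        fix \<omega> assume s: "D\<^sub>1 \<omega> \<in> set_pmf p" "D\<^sub>2 \<omega> \<in> set_pmf q"
        show "indicator {x + y} (D\<^sub>1 \<omega> + D\<^sub>2 \<omega>) * indicator {x + \<beta> y} (D\<^sub>1 \<omega> + \<beta> (D\<^sub>2 \<omega>)) *
          cis (u \<bullet> (X\<^sub>1 \<omega> + X\<^sub>2 \<omega>) + v \<bullet> (X\<^sub>1 \<omega> + (\<alpha> (X\<^sub>2 \<omega>) + h (D\<^sub>2 \<omega>)))) =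
          cis (v \<bullet> \<eta>) * ((indicator {x} (D\<^sub>1 \<omega>) * cis ((u + v) \<bullet> X\<^sub>1 \<omega>)) * (indicator {y} (D\<^sub>2 \<omega>) * cis ((u + a v) \<bullet> X\<^sub>2 \<omega>)))"
        proof (cases "D\<^sub>1 \<omega> = x \<and> D\<^sub>2 \<omega> = y")
          case True
          have "u \<bullet> (X\<^sub>1 \<omega> + X\<^sub>2 \<omega>) + v \<bullet> (X\<^sub>1 \<omega> + (\<alpha> (X\<^sub>2 \<omega>) + h (D\<^sub>2 \<omega>))) =
              v \<bullet> \<eta> + ((u + v) \<bullet> X\<^sub>1 \<omega> + (u + a v) \<bullet> X\<^sub>2 \<omega>)"
          proof -
            have "v \<bullet> \<alpha> (X\<^sub>2 \<omega>) = a v \<bullet> X\<^sub>2 \<omega>"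
              using adjoint_works[OF lin_\<alpha>, of "X\<^sub>2 \<omega>" v] by (simp add: inner_commute)
            then show ?thesis using True h\<eta>[OF y] by (simp add: inner_add_left inner_add_right)
          qed
          then show ?thesis using True by (simp add: cis_mult)
        next
          case False
          then have "\<not> (D\<^sub>1 \<omega> + D\<^sub>2 \<omega> = x + y \<and> D\<^sub>1 \<omega> + \<beta> (D\<^sub>2 \<omega>) = x + \<beta> y)"
            using uniq[OF x y s] by blast
          then show ?thesis using False by (auto simp: indicator_def)
        qed
      qed
    qed
    also have "\<dots> = cis (v \<bullet> \<eta>) * (f x (u + v) * g y (u + a v))"
      by (simp only: integral_mult_right_zero fg_prod)
    finally show ?thesis by (simp add: mult_ac)
  qed
  \<comment> \<open>The phase is \<open>v \<bullet> \<eta>\<close> on one side and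
    \<open>- v \<bullet> \<eta>\<close> on the reflected side, whence the factor 2.\<close>
  define \<kappa> where "\<kappa> v = - 2 * (v \<bullet> \<eta>)" for v
  \<comment> \<open>Symmetry carries the positive mass at the point given by (x, y) to the reflected
    point, so some support pair must lie over that point; \<open>J_sym\<close> then compares the two
    values of \<open>J\<close>.\<close>
  have partner: "\<exists>x'\<in>set_pmf p. \<exists>y'\<in>set_pmf q. x' + y' = x + y \<and> x' + \<beta> y' = - (x + \<beta> y) \<and>
      (\<forall>u v. f x (u + v) * g y (u + a v) = cis (\<kappa> v) * f x' (u - v) * g y' (u - a v))"
    if x: "x \<in> set_pmf p" and y: "y \<in> set_pmf q" for x y
  proof -
    have "J 0 0 (x + y) (x + \<beta> y) = of_real (pmf p x * pmf q y)"
      using J_eq[OF x y, of 0 0] by (simp add: f_0 g_0 linear_0[OF linear_a])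
    moreover have "pmf p x * pmf q y \<noteq> 0" using x y by (simp add: set_pmf_iff)
    ultimately have nz: "J 0 0 (x + y) (- (x + \<beta> y)) \<noteq> 0"
      using J_sym[of 0 0 "x + y" "x + \<beta> y"] by simp
    have "\<exists>x'\<in>set_pmf p. \<exists>y'\<in>set_pmf q. x' + y' = x + y \<and> x' + \<beta> y' = - (x + \<beta> y)"
    proof (rule ccontr)
      assume n: "\<not> ?thesis"
      have "J 0 0 (x + y) (- (x + \<beta> y)) = 0" unfolding J_def
      proof (rule integral_eq_zero_AE)
        show "AE \<omega> in M. indicator {x + y} (D\<^sub>1 \<omega> + D\<^sub>2 \<omega>) * indicator {- (x + \<beta> y)} (D\<^sub>1 \<omega> + \<beta> (D\<^sub>2 \<omega>)) *
            cis (0 \<bullet> (X\<^sub>1 \<omega> + X\<^sub>2 \<omega>) + 0 \<bullet> (X\<^sub>1 \<omega> + (\<alpha> (X\<^sub>2 \<omega>) + h (D\<^sub>2 \<omega>)))) = 0"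
          using AE_supp
        proof eventually_elim
          fix \<omega> assume s: "D\<^sub>1 \<omega> \<in> set_pmf p" "D\<^sub>2 \<omega> \<in> set_pmf q"
          then have "\<not> (D\<^sub>1 \<omega> + D\<^sub>2 \<omega> = x + y \<and> D\<^sub>1 \<omega> + \<beta> (D\<^sub>2 \<omega>) = - (x + \<beta> y))" using n by blast
          then have "indicator {x + y} (D\<^sub>1 \<omega> + D\<^sub>2 \<omega>) * indicator {- (x + \<beta> y)} (D\<^sub>1 \<omega> + \<beta> (D\<^sub>2 \<omega>)) = (0 :: complex)"
            by (rule indicator_mult_0)
          then show "indicator {x + y} (D\<^sub>1 \<omega> + D\<^sub>2 \<omega>) * indicator {- (x + \<beta> y)} (D\<^sub>1 \<omega> + \<beta> (D\<^sub>2 \<omega>)) *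
            cis (0 \<bullet> (X\<^sub>1 \<omega> + X\<^sub>2 \<omega>) + 0 \<bullet> (X\<^sub>1 \<omega> + (\<alpha> (X\<^sub>2 \<omega>) + h (D\<^sub>2 \<omega>)))) = 0" by (simp only: mult_zero_left)
        qed
      qed
      then show False using nz by simp
    qed
    then obtain x' y' where x': "x' \<in> set_pmf p" and y': "y' \<in> set_pmf q"
      and s: "x' + y' = x + y" "x' + \<beta> y' = - (x + \<beta> y)" by blast
    have "f x (u + v) * g y (u + a v) = cis (\<kappa> v) * f x' (u - v) * g y' (u - a v)" for u v
    proof -
      have "f x (u + v) * g y (u + a v) * cis (v \<bullet> \<eta>) = f x' (u + - v) * g y' (u + a (- v)) * cis (- v \<bullet> \<eta>)"
        using J_eq[OF x y, of u v] J_eq[OF x' y', of u "- v"] J_sym[of u v "x + y" "x + \<beta> y"] unfolding s by simp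
      then have "f x (u + v) * g y (u + a v) * (cis (v \<bullet> \<eta>) * cis (- v \<bullet> \<eta>)) =
          f x' (u - v) * g y' (u - a v) * (cis (- v \<bullet> \<eta>) * cis (- v \<bullet> \<eta>))"
        by (simp add: linear_neg[OF linear_a] mult.assoc[symmetric])
      then show ?thesis by (simp add: cis_mult \<kappa>_def mult_ac)
    qed
    then show ?thesis using x' y' s by blast
  qed
  define \<nu>1 where "\<nu>1 x = cond_law {\<omega> \<in> space M. D\<^sub>1 \<omega> = x} X\<^sub>1" for x
  define \<nu>2 where "\<nu>2 y = cond_law {\<omega> \<in> space M. D\<^sub>2 \<omega> = y} X\<^sub>2" for y
  note c1 = cond_law[OF XD_measurable(3,1), folded \<nu>1_def] and c2 = cond_law[OF XD_measurable(4,2), folded \<nu>2_def]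
  have fc: "f x s = of_real (pmf p x) * chf (\<nu>1 x) s" if "x \<in> set_pmf p" for x s
    unfolding f_def by (rule c1(2)[OF that])
  have gc: "g y s = of_real (pmf q y) * chf (\<nu>2 y) s" if "y \<in> set_pmf q" for y s
    unfolding g_def by (rule c2(2)[OF that])
  obtain x1 y1 where x1: "x1 \<in> set_pmf p" and y1: "y1 \<in> set_pmf q"
    and fg: "\<And>u v. f x\<^sub>0 (u + v) * g y\<^sub>0 (u + a v) = cis (\<kappa> v) * f x1 (u - v) * g y1 (u - a v)"
    using partner[OF x0 y0] by blast
  have \<kappa>lin: "linear \<kappa>" unfolding \<kappa>_def by (rule linearI) (simp_all add: inner_add_left algebra_simps)
  have lg: "line_gauss (\<nu>1 x\<^sub>0)" "line_gauss (\<nu>2 y\<^sub>0)"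
  proof -
    have D: "distr_space (\<nu>1 x\<^sub>0)" "distr_space (\<nu>2 y\<^sub>0)" "distr_space (\<nu>1 x1)" "distr_space (\<nu>2 y1)"
      using c1(1)[OF x0] c2(1)[OF y0] c1(1)[OF x1] c2(1)[OF y1] by (simp_all add: distr_space_def)
    \<comment> \<open>Evaluation at 0 shows equal total masses on both sides, so they may be divided
      out to reach \<open>heyde_chf\<close>.\<close>
    have pq: "complex_of_real (pmf p x\<^sub>0) * of_real (pmf q y\<^sub>0) = of_real (pmf p x1) * of_real (pmf q y1)"
      using fg[of 0 0] by (simp add: f_0 g_0 linear_0[OF linear_a] \<kappa>_def)
    have nz: "complex_of_real (pmf p x\<^sub>0) * of_real (pmf q y\<^sub>0) \<noteq> 0" using x0 y0 by (simp add: set_pmf_iff)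
    interpret H: heyde_chf "\<nu>1 x\<^sub>0" "\<nu>2 y\<^sub>0" "\<nu>1 x1" "\<nu>2 y1" a \<kappa>
    proof (rule heyde_chf.intro[OF D], rule heyde_chf_axioms.intro)
      fix u v
      have "(complex_of_real (pmf p x\<^sub>0) * of_real (pmf q y\<^sub>0)) * (chf (\<nu>1 x\<^sub>0) (u + v) * chf (\<nu>2 y\<^sub>0) (u + a v)) =
          (of_real (pmf p x1) * of_real (pmf q y1)) * (cis (\<kappa> v) * chf (\<nu>1 x1) (u - v) * chf (\<nu>2 y1) (u - a v))"
        using fg[of u v] unfolding fc[OF x0] gc[OF y0] fc[OF x1] gc[OF y1] by (simp only: mult_ac)
      then show "chf (\<nu>1 x\<^sub>0) (u + v) * chf (\<nu>2 y\<^sub>0) (u + a v) = cis (\<kappa> v) * chf (\<nu>1 x1) (u - v) * chf (\<nu>2 y1) (u - a v)"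
        unfolding pq[symmetric] using nz by simp
    qed (fact linear_a ker_a ker_Ia \<kappa>lin)+
    show "line_gauss (\<nu>1 x\<^sub>0)" "line_gauss (\<nu>2 y\<^sub>0)" by (rule H.line_gauss_both)+
  qed
  have Fb: "\<beta> u \<in> F" if "u \<in> F" for u using bF that by blast
  have Fadd: "u + v \<in> F" if "u \<in> F" "v \<in> F" for u v using sgF that by (auto simp: add_subgroup_def)
  have Fneg: "- u \<in> F" if "u \<in> F" for u using sgF that by (auto simp: add_subgroup_def)
  have surjF: "k ` F = F" if add: "Modules.additive k" and "k ` F \<subseteq> F" and ker: "\<And>u. u \<in> F \<Longrightarrow> k u = 0 \<Longrightarrow> u = 0" for k
  proof -
    have "inj_on k F"
    proof (rule inj_onI)
      fix u v assume uv: "u \<in> F" "v \<in> F" "k u = k v"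
      then have "k (u - v) = 0" by (simp add: additive.diff[OF add])
      then have "u - v = 0" by (rule ker[OF add_subgroup_diff[OF sgF uv(1,2)]])
      then show "u = v" by simp
    qed
    then show ?thesis using that(2) finF endo_inj_surj by blast
  qed
  have ac: "Modules.additive (\<lambda>z. z - \<beta> z)" and am: "Modules.additive (\<lambda>z::'d. z + z)" and an: "Modules.additive (\<lambda>z. z + \<beta> z)"
    and am': "Modules.additive (\<lambda>z. - (\<beta> z + \<beta> z))" and an': "Modules.additive (\<lambda>z. - (z + \<beta> z))"
    by (unfold_locales, simp add: HP.b_simps)+
  have cF: "(\<lambda>z. z - \<beta> z) ` F = F"
  proof (rule surjF[OF ac])
    show "(\<lambda>z. z - \<beta> z) ` F \<subseteq> F" using add_subgroup_diff[OF sgF] Fb by auto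
    show "u = 0" if "u \<in> F" "u - \<beta> u = 0" for u using Ib[of u] that by simp
  qed
  have nF: "(\<lambda>z. z + \<beta> z) ` F = F"
  proof (rule surjF[OF an])
    show "(\<lambda>z. z + \<beta> z) ` F \<subseteq> F" using Fadd Fb by auto
    show "u = 0" if "u + \<beta> u = 0" for u by (rule ker_I\<beta>[OF that])
  qed
  have n'F: "(\<lambda>z. - (z + \<beta> z)) ` F = F"
  proof (rule surjF[OF an'])
    show "(\<lambda>z. - (z + \<beta> z)) ` F \<subseteq> F" by (intro image_subsetI Fneg Fadd Fb)
    show "u = 0" if "- (u + \<beta> u) = 0" for u using ker_I\<beta>[of u] that by (simp only: neg_equal_0_iff_equal)
  qed
  have kc: "z = 0" if "dbl N z \<in> F" "z - \<beta> z = 0" for z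
  proof -
    have "\<beta> z = z" using that(2) by simp
    then show ?thesis using HP.inj_Ib_torsion[of F N z] Ib that(1) by blast
  qed
  have lin2: "linear (\<lambda>s::'a. s + s)" and inj2: "inj (\<lambda>s::'a. s + s)"
  proof -
    show "linear (\<lambda>s::'a. s + s)" by (intro linear_compose_add linear_id[unfolded id_def])
    show "inj (\<lambda>s::'a. s + s)" by (rule injI) (simp flip: scaleR_2)
  qed
  have linpa: "linear (\<lambda>s. s + a s)" and linma: "linear (\<lambda>s. s - a s)" and linaa: "linear (\<lambda>s. a s + a s)"
    and linap: "linear (\<lambda>s. a s + s)" and linam: "linear (\<lambda>s. a s - s)"
    by (intro linear_compose_add linear_compose_sub linear_id[unfolded id_def] linear_a)+
  have injaa: "inj (\<lambda>s. a s + a s)"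
  proof (rule linear_injective_0[OF linaa, THEN iffD2], intro allI impI)
    fix s assume "a s + a s = 0"
    then have "2 *\<^sub>R a s = 0" by (simp add: scaleR_2)
    then show "s = 0" using ker_a by simp
  qed
  have \<theta>0: "cis (\<kappa> 0) = 1" by (simp add: \<kappa>_def)
  \<comment> \<open>Taking \<open>u = v = s\<close> evaluates the partner factor of the first
    variable at 0. Subtracting the two discrete relations eliminates \<open>x'\<close> and leaves I
    - \<beta> on \<open>y'\<close>.\<close>
  have P: "descent_half p q f g F (\<lambda>z. z - \<beta> z) (\<lambda>z. z + z) (\<lambda>z. z + \<beta> z) N
      (\<lambda>s. s + s) (\<lambda>s. s + a s) (\<lambda>s. s - a s) (\<lambda>s. cis (\<kappa> s))"
  proof (rule descent_half.intro)
    show "(\<lambda>z. z + z) ` F \<subseteq> F" using Fadd by auto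
    show "dbl k (z + z) \<in> F" if "dbl (Suc k) z \<in> F" for k z using that by (simp add: dbl_Suc dbl_add)
    fix x y assume x: "x \<in> set_pmf p" and y: "y \<in> set_pmf q"
    obtain x' y' where x': "x' \<in> set_pmf p" "y' \<in> set_pmf q" and s: "x' + y' = x + y" "x' + \<beta> y' = - (x + \<beta> y)"
      and e: "\<And>u v. f x (u + v) * g y (u + a v) = cis (\<kappa> v) * f x' (u - v) * g y' (u - a v)"
      using partner[OF x y] by blast
    have "y' - \<beta> y' = (x' + y') - (x' + \<beta> y')" by simp
    also have "\<dots> = (x + x) + (y + \<beta> y)" unfolding s by (simp add: algebra_simps)
    finally have "y' - \<beta> y' = (x + x) + (y + \<beta> y)" .
    moreover have "f x (s + s) * g y (s + a s) = cis (\<kappa> s) * of_real (pmf p x') * g y' (s - a s)" for s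
      using e[of s s] by (simp add: f_0)
    ultimately show "\<exists>x'\<in>set_pmf p. \<exists>y'\<in>set_pmf q. x' + y' = x + y \<and> y' - \<beta> y' = x + x + (y + \<beta> y) \<and>
        (\<forall>s. f x (s + s) * g y (s + a s) = cis (\<kappa> s) * of_real (pmf p x') * g y' (s - a s))"
      using x' s(1) by blast
  qed (fact finF sgF invp invq ac am an cF nF kc dy lin2 inj2 linpa linma \<theta>0 f_0 g_0 continuous_g)+
  \<comment> \<open>Taking \<open>u = a s\<close> and \<open>v = s\<close> evaluates the partner
    factor of the second variable at 0. Applying \<beta> to the first discrete relation before
    subtracting eliminates \<open>y'\<close>.\<close>
  have Q: "descent_half q p g f F (\<lambda>z. z - \<beta> z) (\<lambda>z. - (\<beta> z + \<beta> z)) (\<lambda>z. - (z + \<beta> z)) N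
      (\<lambda>s. a s + a s) (\<lambda>s. a s + s) (\<lambda>s. a s - s) (\<lambda>s. cis (\<kappa> s))"
  proof (rule descent_half.intro)
    show "(\<lambda>z. - (\<beta> z + \<beta> z)) ` F \<subseteq> F" by (intro image_subsetI Fneg Fadd Fb)
    show "dbl k (- (\<beta> z + \<beta> z)) \<in> F" if "dbl (Suc k) z \<in> F" for k z
    proof -
      have "dbl k (- (\<beta> z + \<beta> z)) = - \<beta> (dbl (Suc k) z)"
        by (simp add: dbl_diff dbl_minus dbl_Suc dbl_add HP.b_simps dbl_additive[OF add_\<beta>])
      then show ?thesis using Fneg Fb that by simp
    qed
    fix y x assume y: "y \<in> set_pmf q" and x: "x \<in> set_pmf p"
    obtain x' y' where x': "x' \<in> set_pmf p" "y' \<in> set_pmf q" and s: "x' + y' = x + y" "x' + \<beta> y' = - (x + \<beta> y)"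
      and e: "\<And>u v. f x (u + v) * g y (u + a v) = cis (\<kappa> v) * f x' (u - v) * g y' (u - a v)"
      using partner[OF x y] by blast
    have "x' - \<beta> x' = (x' + \<beta> y') - \<beta> (x' + y')" by (simp add: HP.b_simps)
    also have "\<dots> = - (\<beta> y + \<beta> y) + - (x + \<beta> x)" unfolding s by (simp add: HP.b_simps algebra_simps)
    finally have "x' - \<beta> x' = - (\<beta> y + \<beta> y) + - (x + \<beta> x)" .
    moreover have "g y (a s + a s) * f x (a s + s) = cis (\<kappa> s) * of_real (pmf q y') * f x' (a s - s)" for s
      using e[of "a s" s] by (simp add: g_0 mult_ac)
    moreover have "y' + x' = y + x" using s(1) by (simp add: add.commute)
    ultimately show "\<exists>y'\<in>set_pmf q. \<exists>x'\<in>set_pmf p. y' + x' = y + x \<and> x' - \<beta> x' = - (\<beta> y + \<beta> y) + - (x + \<beta> x) \<and>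
        (\<forall>s. g y (a s + a s) * f x (a s + s) = cis (\<kappa> s) * of_real (pmf q y') * f x' (a s - s))"
      using x' by blast
  qed (fact finF sgF invq invp ac am' an' cF n'F kc dx linaa injaa linap linam \<theta>0 g_0 f_0 continuous_f)+
  \<comment> \<open>The descent gives proportionality only near 0. This suffices because the law at
    the base point is locally Gaussian on lines and hence determined near 0.\<close>
  have same: "\<nu> x = \<nu> z"
    if ev: "\<forall>\<^sub>F s in nhds 0. k x s * of_real (pmf r z) = k z s * of_real (pmf r x)"
      and kc: "\<And>s. k x s = of_real (pmf r x) * chf (\<nu> x) s" "\<And>s. k z s = of_real (pmf r z) * chf (\<nu> z) s"
      and d: "distribution (\<nu> x)" "distribution (\<nu> z)" "line_gauss (\<nu> z)" and xz: "x \<in> set_pmf r" "z \<in> set_pmf r"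
    for \<nu> :: "'d \<Rightarrow> 'a measure" and k :: "'d \<Rightarrow> 'a \<Rightarrow> complex" and r x z
  proof -
    have nz: "pmf r x \<noteq> 0" "pmf r z \<noteq> 0" using xz by (auto simp: set_pmf_iff)
    have "\<forall>\<^sub>F s in nhds 0. chf (\<nu> x) s = chf (\<nu> z) s" using ev
      by eventually_elim (use nz in \<open>simp add: kc\<close>)
    then obtain e where "e > 0" "\<And>s. dist s 0 < e \<Longrightarrow> chf (\<nu> x) s = chf (\<nu> z) s"
      unfolding eventually_nhds_metric by blast
    then show ?thesis by (intro line_gauss_determined[OF d(2,3,1)]) (auto simp: dist_norm)
  qed
  have same1: "\<nu>1 x = \<nu>1 x\<^sub>0" if "x \<in> set_pmf p" for x
    by (rule same[OF descent(1)[OF P Q that x0] fc[OF that] fc[OF x0] c1(1)[OF that] c1(1)[OF x0] lg(1) that x0])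
  have same2: "\<nu>2 y = \<nu>2 y\<^sub>0" if "y \<in> set_pmf q" for y
    by (rule same[OF descent(2)[OF P Q x0 x0 that y0] gc[OF that] gc[OF y0] c2(1)[OF that] c2(1)[OF y0] lg(2) that y0])
  have null: "prob {\<omega> \<in> space M. X \<omega> \<in> C \<and> D \<omega> = x} = c * pmf (law M D) x"
    if m [measurable]: "D \<in> measurable M (count_space UNIV)" "X \<in> borel_measurable M" and "x \<notin> set_pmf (law M D)" and C [measurable]: "C \<in> sets borel"
    for X :: "'w \<Rightarrow> 'a" and D :: "'w \<Rightarrow> 'd" and C x c
  proof -
    have "prob {\<omega> \<in> space M. X \<omega> \<in> C \<and> D \<omega> = x} \<le> prob {\<omega> \<in> space M. D \<omega> = x}"
      by (intro finite_measure_mono) auto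
    also have "\<dots> = 0" using that(3) by (simp add: pmf_law[OF m(1), symmetric] set_pmf_iff)
    finally show ?thesis using that(3) by (simp add: set_pmf_iff measure_le_0_iff)
  qed
  have slice1: "prob {\<omega> \<in> space M. X\<^sub>1 \<omega> \<in> C \<and> D\<^sub>1 \<omega> = x} = measure (\<nu>1 x\<^sub>0) C * pmf p x" if "C \<in> sets borel" for C x
    using c1(3)[OF _ that, of x] same1[of x] null[OF XD_measurable(3,1) _ that, of x] by (cases "x \<in> set_pmf p") auto
  have slice2: "prob {\<omega> \<in> space M. X\<^sub>2 \<omega> \<in> C \<and> D\<^sub>2 \<omega> = y} = measure (\<nu>2 y\<^sub>0) C * pmf q y" if "C \<in> sets borel" for C y
    using c2(3)[OF _ that, of y] same2[of y] null[OF XD_measurable(4,2) _ that, of y] by (cases "y \<in> set_pmf q") auto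
  show ?thesis
    by (rule that) (fact c1(1)[OF x0] lg c2(1)[OF y0] finF sgF odd bF suppx suppy invp invq slice1 slice2)+
qed

end

section \<open>Assembling the factorizations\<close>

lemma msupport_two_component:
  fixes \<rho> :: "'d::{discrete_topology, ab_group_add} pmf"
  assumes "\<And>t. t \<in> set_pmf \<rho> \<Longrightarrow> dbl N t = 0"
  shows "msupport (measure_pmf \<rho>) \<subseteq> two_component"
proof
  fix t assume "t \<in> msupport (measure_pmf \<rho>)"
  then have "emeasure (measure_pmf \<rho>) {t} > 0"
    using discrete_topology_class.open_discrete[of "{t}"] by (auto simp: msupport_def)
  then have "t \<in> set_pmf \<rho>" by (simp add: emeasure_pmf_single set_pmf_iff)
  then show "t \<in> two_component" by (intro two_component_dbl[of N] assms)
qed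

lemma heyde_product:
  fixes M :: "'w measure"
    and \<delta> :: "(real^'n) \<times> 'd::{countable, discrete_topology, ab_group_add} \<Rightarrow> (real^'n) \<times> 'd"
    and \<xi>\<^sub>1 \<xi>\<^sub>2 :: "'w \<Rightarrow> (real^'n) \<times> 'd"
  assumes M: "prob_space M" and aut: "top_automorphism \<delta>" and ker: "{x. x + \<delta> x = 0} = {0}"
    and ind: "prob_space.indep_var M borel \<xi>\<^sub>1 borel \<xi>\<^sub>2"
    and sym: "cond_symmetric M (\<lambda>\<omega>. \<xi>\<^sub>1 \<omega> + \<xi>\<^sub>2 \<omega>) (\<lambda>\<omega>. \<xi>\<^sub>1 \<omega> + \<delta> (\<xi>\<^sub>2 \<omega>))"
  shows "\<exists>(\<gamma>\<^sub>1 :: (real^'n) measure) (\<gamma>\<^sub>2 :: (real^'n) measure) (\<rho>\<^sub>1 :: 'd measure) (\<rho>\<^sub>2 :: 'd measure)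
        (g\<^sub>1 :: 'd) (g\<^sub>2 :: 'd) (F :: 'd set).
        gaussian \<gamma>\<^sub>1 \<and> gaussian \<gamma>\<^sub>2 \<and>
        distribution \<rho>\<^sub>1 \<and> msupport \<rho>\<^sub>1 \<subseteq> two_component \<and>
        distribution \<rho>\<^sub>2 \<and> msupport \<rho>\<^sub>2 \<subseteq> two_component \<and>
        finite F \<and> add_subgroup F \<and> (\<forall>x\<in>F. \<not> has_order x 2) \<and>
        distr M borel \<xi>\<^sub>1 =
          on_fst \<gamma>\<^sub>1 \<circledast> on_snd \<rho>\<^sub>1 \<circledast> on_snd (haar_distr F) \<circledast> return borel (0, g\<^sub>1) \<and>
        distr M borel \<xi>\<^sub>2 =
          on_fst \<gamma>\<^sub>2 \<circledast> on_snd \<rho>\<^sub>2 \<circledast> on_snd (haar_distr F) \<circledast> return borel (0, g\<^sub>2) \<and>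
        \<delta> ` ({0} \<times> F) = {0} \<times> F"
proof -
  interpret prob_space M by fact
  obtain \<alpha> h \<beta> where \<delta>: "linear \<alpha>" "\<And>t. \<alpha> t = 0 \<Longrightarrow> t = 0" "\<And>t. t + \<alpha> t = 0 \<Longrightarrow> t = 0"
    "Modules.additive h" "Modules.additive \<beta>" "\<And>d. \<beta> d = 0 \<Longrightarrow> d = 0" "\<And>d. d + \<beta> d = 0 \<Longrightarrow> d = 0"
    "\<And>t d. \<delta> (t, d) = (\<alpha> t + h d, \<beta> d)"
    by (rule top_automorphism_prod[OF aut ker], rule that) (assumption | blast)+
  interpret S: heyde_setup M \<xi>\<^sub>1 \<xi>\<^sub>2 \<delta> \<alpha> h \<beta>
    by (rule heyde_setup.intro[OF M], rule heyde_setup_axioms.intro) (fact \<delta> ind sym)+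
  show ?thesis
  proof (rule S.slice_product)
    fix \<gamma>\<^sub>1 \<gamma>\<^sub>2 F N x\<^sub>0 y\<^sub>0 assume \<gamma>: "distribution \<gamma>\<^sub>1" "line_gauss \<gamma>\<^sub>1" "distribution \<gamma>\<^sub>2" "line_gauss \<gamma>\<^sub>2"
      and F: "finite F" "add_subgroup F" and odd: "\<And>u. u \<in> F \<Longrightarrow> u + u = 0 \<Longrightarrow> u = 0" and bF: "\<beta> ` F = F"
      and supp: "\<And>x. x \<in> set_pmf S.p \<Longrightarrow> dbl N (x - x\<^sub>0) \<in> F" "\<And>y. y \<in> set_pmf S.q \<Longrightarrow> dbl N (y - y\<^sub>0) \<in> F"
      and inv: "shift_inv F S.p" "shift_inv F S.q"
      and sl: "\<And>C x. C \<in> sets borel \<Longrightarrow> prob {\<omega> \<in> space M. S.X\<^sub>1 \<omega> \<in> C \<and> S.D\<^sub>1 \<omega> = x} = measure \<gamma>\<^sub>1 C * pmf S.p x"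
        "\<And>C y. C \<in> sets borel \<Longrightarrow> prob {\<omega> \<in> space M. S.X\<^sub>2 \<omega> \<in> C \<and> S.D\<^sub>2 \<omega> = y} = measure \<gamma>\<^sub>2 C * pmf S.q y"
    have "\<exists>\<rho>. (\<forall>t\<in>set_pmf \<rho>. dbl N t = 0) \<and>
      S.p = conv_pmf (conv_pmf \<rho> (pmf_of_set F)) (return_pmf x\<^sub>0)"
      by (rule shift_inv_factorization[OF F _ inv(1)]) (fact odd supp(1))+
    then obtain \<rho>1 where \<rho>1: "\<And>t. t \<in> set_pmf \<rho>1 \<Longrightarrow> dbl N t = 0"
      "S.p = conv_pmf (conv_pmf \<rho>1 (pmf_of_set F)) (return_pmf x\<^sub>0)"
      by blast
    have "\<exists>\<rho>. (\<forall>t\<in>set_pmf \<rho>. dbl N t = 0) \<and>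
      S.q = conv_pmf (conv_pmf \<rho> (pmf_of_set F)) (return_pmf y\<^sub>0)"
      by (rule shift_inv_factorization[OF F _ inv(2)]) (fact odd supp(2))+
    then obtain \<rho>2 where \<rho>2: "\<And>t. t \<in> set_pmf \<rho>2 \<Longrightarrow> dbl N t = 0"
      "S.q = conv_pmf (conv_pmf \<rho>2 (pmf_of_set F)) (return_pmf y\<^sub>0)"
      by blast
    have dist: "distribution (distr M borel \<xi>)" if "\<xi> \<in> borel_measurable M" for \<xi> :: "'w \<Rightarrow> (real^'n) \<times> 'd"
      using prob_space_distr[OF that] by (simp add: distribution_def)
    have slice: "measure (distr M borel \<xi>) (C \<times> {x}) = prob {\<omega> \<in> space M. fst (\<xi> \<omega>) \<in> C \<and> snd (\<xi> \<omega>) = x}"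
      if "\<xi> \<in> borel_measurable M" "C \<in> sets borel" for \<xi> :: "'w \<Rightarrow> (real^'n) \<times> 'd" and C x
    proof -
      have "\<xi> -` (C \<times> {x}) \<inter> space M = {\<omega> \<in> space M. fst (\<xi> \<omega>) \<in> C \<and> snd (\<xi> \<omega>) = x}"
        by (auto simp: mem_Times_iff)
      then show ?thesis by (simp add: measure_distr[OF that(1) sets_slice[OF that(2)]])
    qed
    have 1: "distr M borel \<xi>\<^sub>1 = on_fst \<gamma>\<^sub>1 \<circledast> on_snd (measure_pmf \<rho>1) \<circledast> on_snd (haar_distr F) \<circledast> return borel (0, x\<^sub>0)"
      unfolding haar_distr_finite[OF F]
      by (rule slices_factorization[OF dist[OF S.\<xi>_measurable(1)] \<gamma>(1) _ \<rho>1(2)])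
        (use slice[OF S.\<xi>_measurable(1)] sl(1) in \<open>simp add: S.X\<^sub>1_def S.D\<^sub>1_def\<close>)
    have 2: "distr M borel \<xi>\<^sub>2 = on_fst \<gamma>\<^sub>2 \<circledast> on_snd (measure_pmf \<rho>2) \<circledast> on_snd (haar_distr F) \<circledast> return borel (0, y\<^sub>0)"
      unfolding haar_distr_finite[OF F]
      by (rule slices_factorization[OF dist[OF S.\<xi>_measurable(2)] \<gamma>(3) _ \<rho>2(2)])
        (use slice[OF S.\<xi>_measurable(2)] sl(2) in \<open>simp add: S.X\<^sub>2_def S.D\<^sub>2_def\<close>)
    \<comment> \<open>\<open>h\<close> vanishes on \<open>F\<close>, so \<delta> acts on this
      subgroup as \<beta>, without a real component.\<close>
    have im: "\<delta> ` ({0} \<times> F) = {0} \<times> F"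
    proof -
      have "\<delta> (0, d) = (0, \<beta> d)" if "d \<in> F" for d
        using \<delta>(8)[of 0 d] finite_subgroup_additive_0[OF F \<delta>(4) that] linear_0[OF \<delta>(1)] by simp
      then have "\<delta> ` ({0} \<times> F) = {0} \<times> \<beta> ` F" by (force simp: image_iff)
      then show ?thesis by (simp add: bF)
    qed
    have fin: "\<forall>x\<in>F. \<not> has_order x 2" using not_has_order_2[of F] odd by blast
    show ?thesis
      by (rule exI[of _ \<gamma>\<^sub>1], rule exI[of _ \<gamma>\<^sub>2], rule exI[of _ "measure_pmf \<rho>1"], rule exI[of _ "measure_pmf \<rho>2"],
          rule exI[of _ x\<^sub>0], rule exI[of _ y\<^sub>0], rule exI[of _ F],
          intro conjI line_gauss_gaussian \<gamma> distribution_measure_pmf msupport_two_component[of _ N] \<rho>1(1) \<rho>2(1) F fin 1 2 im)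
  qed
qed

lemma heyde_discrete:
  fixes M :: "'w measure"
    and \<epsilon> :: "'d::{countable, discrete_topology, ab_group_add} \<Rightarrow> 'd" and \<eta>\<^sub>1 \<eta>\<^sub>2 :: "'w \<Rightarrow> 'd"
  assumes M: "prob_space M" and aut: "top_automorphism \<epsilon>" and ker: "{x. x + \<epsilon> x = 0} = {0}"
    and ind: "prob_space.indep_var M borel \<eta>\<^sub>1 borel \<eta>\<^sub>2"
    and sym: "cond_symmetric M (\<lambda>\<omega>. \<eta>\<^sub>1 \<omega> + \<eta>\<^sub>2 \<omega>) (\<lambda>\<omega>. \<eta>\<^sub>1 \<omega> + \<epsilon> (\<eta>\<^sub>2 \<omega>))"
  shows "\<exists>(\<rho>\<^sub>1 :: 'd measure) (\<rho>\<^sub>2 :: 'd measure) (g\<^sub>1 :: 'd) (g\<^sub>2 :: 'd) (F :: 'd set).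
        distribution \<rho>\<^sub>1 \<and> msupport \<rho>\<^sub>1 \<subseteq> two_component \<and>
        distribution \<rho>\<^sub>2 \<and> msupport \<rho>\<^sub>2 \<subseteq> two_component \<and>
        finite F \<and> add_subgroup F \<and> (\<forall>x\<in>F. \<not> has_order x 2) \<and>
        distr M borel \<eta>\<^sub>1 = \<rho>\<^sub>1 \<circledast> haar_distr F \<circledast> return borel g\<^sub>1 \<and>
        distr M borel \<eta>\<^sub>2 = \<rho>\<^sub>2 \<circledast> haar_distr F \<circledast> return borel g\<^sub>2 \<and>
        \<epsilon> ` F = F"
proof -
  interpret prob_space M by fact
  have add: "Modules.additive \<epsilon>" using aut by (simp add: top_automorphism_def)
  obtain \<epsilon>' where "homeomorphism UNIV UNIV \<epsilon> \<epsilon>'" using aut by (auto simp: top_automorphism_def)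
  then have inv\<epsilon>: "\<epsilon>' (\<epsilon> x) = x" for x by (auto simp: homeomorphism_def)
  have k1: "x = 0" if "\<epsilon> x = 0" for x using inv\<epsilon>[of x] inv\<epsilon>[of 0] that additive.zero[OF add] by simp
  have k2: "x = 0" if "x + \<epsilon> x = 0" for x using ker that by blast
  have ind': "indep_var (count_space UNIV) \<eta>\<^sub>1 (count_space UNIV) \<eta>\<^sub>2"
    using indep_var_compose[OF ind measurable_from_borel_discrete[of "\<lambda>x. x"] measurable_from_borel_discrete[of "\<lambda>x. x"]]
    by (simp add: comp_def)
  have m [measurable]: "\<eta>\<^sub>1 \<in> measurable M (count_space UNIV)" "\<eta>\<^sub>2 \<in> measurable M (count_space UNIV)"
    using indep_var_rv1[OF ind'] indep_var_rv2[OF ind'] .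
  have mk: "(\<lambda>\<omega>. k (\<eta>\<^sub>1 \<omega>, \<eta>\<^sub>2 \<omega>)) \<in> borel_measurable M" for k :: "'d \<times> 'd \<Rightarrow> 'd"
    unfolding measurable_borel_discrete by (rule measurable_compose[OF measurable_pair_countable[OF m]]) simp
  have mL: "(\<lambda>\<omega>. \<eta>\<^sub>1 \<omega> + \<eta>\<^sub>2 \<omega>) \<in> borel_measurable M" "(\<lambda>\<omega>. \<eta>\<^sub>1 \<omega> + \<epsilon> (\<eta>\<^sub>2 \<omega>)) \<in> borel_measurable M"
    "(\<lambda>\<omega>. - (\<eta>\<^sub>1 \<omega> + \<epsilon> (\<eta>\<^sub>2 \<omega>))) \<in> borel_measurable M"
    using mk[of "\<lambda>(x, y). x + y"] mk[of "\<lambda>(x, y). x + \<epsilon> y"] mk[of "\<lambda>(x, y). - (x + \<epsilon> y)"] by simp_all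
  have "prob {\<omega> \<in> space M. \<eta>\<^sub>1 \<omega> + \<eta>\<^sub>2 \<omega> = u \<and> \<eta>\<^sub>1 \<omega> + \<epsilon> (\<eta>\<^sub>2 \<omega>) = v} =
      prob {\<omega> \<in> space M. \<eta>\<^sub>1 \<omega> + \<eta>\<^sub>2 \<omega> = u \<and> - (\<eta>\<^sub>1 \<omega> + \<epsilon> (\<eta>\<^sub>2 \<omega>)) = v}" for u v
    using cond_symmetric_measure[OF M mL sym, of "{u}" "{v}"] by (simp add: sets_borel_discrete)
  from heyde_pair_law[OF ind' add k1 k2 this]
  interpret HP: heyde_pair "law M \<eta>\<^sub>1" "law M \<eta>\<^sub>2" \<epsilon> .
  obtain F N x\<^sub>0 y\<^sub>0 where F: "finite F" "add_subgroup F" and odd: "\<And>u. u \<in> F \<Longrightarrow> u + u = 0 \<Longrightarrow> u = 0" and bF: "\<epsilon> ` F = F"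
    and "\<And>u. u \<in> F \<Longrightarrow> \<epsilon> u = u \<Longrightarrow> u = 0" "x\<^sub>0 \<in> set_pmf (law M \<eta>\<^sub>1)" "y\<^sub>0 \<in> set_pmf (law M \<eta>\<^sub>2)"
    and supp: "\<And>x. x \<in> set_pmf (law M \<eta>\<^sub>1) \<Longrightarrow> dbl N (x - x\<^sub>0) \<in> F" "\<And>y. y \<in> set_pmf (law M \<eta>\<^sub>2) \<Longrightarrow> dbl N (y - y\<^sub>0) \<in> F"
    and inv: "shift_inv F (law M \<eta>\<^sub>1)" "shift_inv F (law M \<eta>\<^sub>2)"
    by (rule HP.heyde_structure, rule that) (assumption | blast)+
  have "\<exists>\<rho>. (\<forall>t\<in>set_pmf \<rho>. dbl N t = 0) \<and>
    law M \<eta>\<^sub>1 = conv_pmf (conv_pmf \<rho> (pmf_of_set F)) (return_pmf x\<^sub>0)"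
    by (rule shift_inv_factorization[OF F _ inv(1)]) (fact odd supp(1))+
  then obtain \<rho>1 where \<rho>1: "\<And>t. t \<in> set_pmf \<rho>1 \<Longrightarrow> dbl N t = 0"
    "law M \<eta>\<^sub>1 = conv_pmf (conv_pmf \<rho>1 (pmf_of_set F)) (return_pmf x\<^sub>0)"
    by blast
  have "\<exists>\<rho>. (\<forall>t\<in>set_pmf \<rho>. dbl N t = 0) \<and>
    law M \<eta>\<^sub>2 = conv_pmf (conv_pmf \<rho> (pmf_of_set F)) (return_pmf y\<^sub>0)"
    by (rule shift_inv_factorization[OF F _ inv(2)]) (fact odd supp(2))+
  then obtain \<rho>2 where \<rho>2: "\<And>t. t \<in> set_pmf \<rho>2 \<Longrightarrow> dbl N t = 0"
    "law M \<eta>\<^sub>2 = conv_pmf (conv_pmf \<rho>2 (pmf_of_set F)) (return_pmf y\<^sub>0)"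
    by blast
  have law: "distr M borel \<eta> = measure_pmf (law M \<eta>)" if "\<eta> \<in> measurable M (count_space UNIV)" for \<eta> :: "'w \<Rightarrow> 'd"
    unfolding measure_pmf_law[OF that] by (rule distr_cong) (simp_all add: sets_borel_discrete)
  have 1: "distr M borel \<eta>\<^sub>1 = measure_pmf \<rho>1 \<circledast> haar_distr F \<circledast> return borel x\<^sub>0"
    unfolding haar_distr_finite[OF F] return_borel_discrete convol_pmf law[OF m(1)] by (simp only: \<rho>1(2)[symmetric])
  have 2: "distr M borel \<eta>\<^sub>2 = measure_pmf \<rho>2 \<circledast> haar_distr F \<circledast> return borel y\<^sub>0"
    unfolding haar_distr_finite[OF F] return_borel_discrete convol_pmf law[OF m(2)] by (simp only: \<rho>2(2)[symmetric])
  have fin: "\<forall>x\<in>F. \<not> has_order x 2" using not_has_order_2[of F] odd by blast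
  show ?thesis
    by (rule exI[of _ "measure_pmf \<rho>1"], rule exI[of _ "measure_pmf \<rho>2"],
        rule exI[of _ x\<^sub>0], rule exI[of _ y\<^sub>0], rule exI[of _ F],
        intro conjI distribution_measure_pmf msupport_two_component[of _ N] \<rho>1(1) \<rho>2(1) F fin 1 2 bF)
qed

(* Type-indexed vectors real^'n have dimension at least 1, so the case n = 0, in which X = D and
   the Gaussian factor is trivial, is the second conjunct. *)
theorem theorem1:
  fixes M :: "'w measure"
    and \<delta> :: "(real^'n) \<times> 'd::{countable, discrete_topology, ab_group_add} \<Rightarrow> (real^'n) \<times> 'd"
    and \<xi>\<^sub>1 \<xi>\<^sub>2 :: "'w \<Rightarrow> (real^'n) \<times> 'd"
    and \<epsilon> :: "'d \<Rightarrow> 'd"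
    and \<eta>\<^sub>1 \<eta>\<^sub>2 :: "'w \<Rightarrow> 'd"
  assumes "prob_space M"
  shows
   "(top_automorphism \<delta> \<and> {x. x + \<delta> x = 0} = {0} \<and>
     prob_space.indep_var M borel \<xi>\<^sub>1 borel \<xi>\<^sub>2 \<and>
     cond_symmetric M (\<lambda>\<omega>. \<xi>\<^sub>1 \<omega> + \<xi>\<^sub>2 \<omega>) (\<lambda>\<omega>. \<xi>\<^sub>1 \<omega> + \<delta> (\<xi>\<^sub>2 \<omega>)) \<longrightarrow>
     (\<exists>(\<gamma>\<^sub>1 :: (real^'n) measure) (\<gamma>\<^sub>2 :: (real^'n) measure) (\<rho>\<^sub>1 :: 'd measure) (\<rho>\<^sub>2 :: 'd measure)
        (g\<^sub>1 :: 'd) (g\<^sub>2 :: 'd) (F :: 'd set).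
        gaussian \<gamma>\<^sub>1 \<and> gaussian \<gamma>\<^sub>2 \<and>
        distribution \<rho>\<^sub>1 \<and> msupport \<rho>\<^sub>1 \<subseteq> two_component \<and>
        distribution \<rho>\<^sub>2 \<and> msupport \<rho>\<^sub>2 \<subseteq> two_component \<and>
        finite F \<and> add_subgroup F \<and> (\<forall>x\<in>F. \<not> has_order x 2) \<and>
        distr M borel \<xi>\<^sub>1 =
          on_fst \<gamma>\<^sub>1 \<circledast> on_snd \<rho>\<^sub>1 \<circledast> on_snd (haar_distr F) \<circledast> return borel (0, g\<^sub>1) \<and>
        distr M borel \<xi>\<^sub>2 =
          on_fst \<gamma>\<^sub>2 \<circledast> on_snd \<rho>\<^sub>2 \<circledast> on_snd (haar_distr F) \<circledast> return borel (0, g\<^sub>2) \<and>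
        \<delta> ` ({0} \<times> F) = {0} \<times> F))
    \<and>
    (top_automorphism \<epsilon> \<and> {x. x + \<epsilon> x = 0} = {0} \<and>
     prob_space.indep_var M borel \<eta>\<^sub>1 borel \<eta>\<^sub>2 \<and>
     cond_symmetric M (\<lambda>\<omega>. \<eta>\<^sub>1 \<omega> + \<eta>\<^sub>2 \<omega>) (\<lambda>\<omega>. \<eta>\<^sub>1 \<omega> + \<epsilon> (\<eta>\<^sub>2 \<omega>)) \<longrightarrow>
     (\<exists>(\<rho>\<^sub>1 :: 'd measure) (\<rho>\<^sub>2 :: 'd measure) (g\<^sub>1 :: 'd) (g\<^sub>2 :: 'd) (F :: 'd set).
        distribution \<rho>\<^sub>1 \<and> msupport \<rho>\<^sub>1 \<subseteq> two_component \<and>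
        distribution \<rho>\<^sub>2 \<and> msupport \<rho>\<^sub>2 \<subseteq> two_component \<and>
        finite F \<and> add_subgroup F \<and> (\<forall>x\<in>F. \<not> has_order x 2) \<and>
        distr M borel \<eta>\<^sub>1 = \<rho>\<^sub>1 \<circledast> haar_distr F \<circledast> return borel g\<^sub>1 \<and>
        distr M borel \<eta>\<^sub>2 = \<rho>\<^sub>2 \<circledast> haar_distr F \<circledast> return borel g\<^sub>2 \<and>
        \<epsilon> ` F = F))"
proof (intro conjI impI; elim conjE)
  assume a: "top_automorphism \<delta>" "{x. x + \<delta> x = 0} = {0}" "prob_space.indep_var M borel \<xi>\<^sub>1 borel \<xi>\<^sub>2"
    "cond_symmetric M (\<lambda>\<omega>. \<xi>\<^sub>1 \<omega> + \<xi>\<^sub>2 \<omega>) (\<lambda>\<omega>. \<xi>\<^sub>1 \<omega> + \<delta> (\<xi>\<^sub>2 \<omega>))"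
  show "\<exists>(\<gamma>\<^sub>1 :: (real^'n) measure) (\<gamma>\<^sub>2 :: (real^'n) measure) (\<rho>\<^sub>1 :: 'd measure) (\<rho>\<^sub>2 :: 'd measure)
        (g\<^sub>1 :: 'd) (g\<^sub>2 :: 'd) (F :: 'd set).
        gaussian \<gamma>\<^sub>1 \<and> gaussian \<gamma>\<^sub>2 \<and>
        distribution \<rho>\<^sub>1 \<and> msupport \<rho>\<^sub>1 \<subseteq> two_component \<and>
        distribution \<rho>\<^sub>2 \<and> msupport \<rho>\<^sub>2 \<subseteq> two_component \<and>
        finite F \<and> add_subgroup F \<and> (\<forall>x\<in>F. \<not> has_order x 2) \<and>
        distr M borel \<xi>\<^sub>1 =
          on_fst \<gamma>\<^sub>1 \<circledast> on_snd \<rho>\<^sub>1 \<circledast> on_snd (haar_distr F) \<circledast> return borel (0, g\<^sub>1) \<and>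
        distr M borel \<xi>\<^sub>2 =
          on_fst \<gamma>\<^sub>2 \<circledast> on_snd \<rho>\<^sub>2 \<circledast> on_snd (haar_distr F) \<circledast> return borel (0, g\<^sub>2) \<and>
        \<delta> ` ({0} \<times> F) = {0} \<times> F"
    by (rule heyde_product[OF assms a])
next
  assume a: "top_automorphism \<epsilon>" "{x. x + \<epsilon> x = 0} = {0}" "prob_space.indep_var M borel \<eta>\<^sub>1 borel \<eta>\<^sub>2"
    "cond_symmetric M (\<lambda>\<omega>. \<eta>\<^sub>1 \<omega> + \<eta>\<^sub>2 \<omega>) (\<lambda>\<omega>. \<eta>\<^sub>1 \<omega> + \<epsilon> (\<eta>\<^sub>2 \<omega>))"
  show "\<exists>(\<rho>\<^sub>1 :: 'd measure) (\<rho>\<^sub>2 :: 'd measure) (g\<^sub>1 :: 'd) (g\<^sub>2 :: 'd) (F :: 'd set).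
        distribution \<rho>\<^sub>1 \<and> msupport \<rho>\<^sub>1 \<subseteq> two_component \<and>
        distribution \<rho>\<^sub>2 \<and> msupport \<rho>\<^sub>2 \<subseteq> two_component \<and>
        finite F \<and> add_subgroup F \<and> (\<forall>x\<in>F. \<not> has_order x 2) \<and>
        distr M borel \<eta>\<^sub>1 = \<rho>\<^sub>1 \<circledast> haar_distr F \<circledast> return borel g\<^sub>1 \<and>
        distr M borel \<eta>\<^sub>2 = \<rho>\<^sub>2 \<circledast> haar_distr F \<circledast> return borel g\<^sub>2 \<and>
        \<epsilon> ` F = F"
    by (rule heyde_discrete[OF assms a])
qed

end
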